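(* Let $G$ be a countable group that is linear sofic over $\mathbb{C}$. Then: (1) If $G$ is torsion-free, then $G$ is $1$-linear sofic over $\mathbb{C}$. (2) Unconditionally (whether or not $G$ is torsion-free), $G$ is $1/2$-linear sofic over $\mathbb{C}$. Moreover, the constant $1/2$ cannot be improved: for every $\kappa$ with $1/2<\kappa\le 1$ there is a countable group that is linear sofic over $\mathbb{C}$ but is not $\kappa$-linear sofic over $\mathbb{C}$.
   Context: For a field $F$, $d\ge 1$ and $d\times d$ matrices $A,B$ over $F$, put $\rho_d(A,B)=\frac1d\operatorname{rank}(A-B)$. Let $G$ be a countable group with identity $e$ and let $0<\kappa\le 1$. $G$ is called $\kappa$-linear sofic over $F$ if for every finite set $S\subseteq G$, every $\delta>0$ and every $0\le\kappa'<\kappa$ there exist $d\ge1$ and a map $\phi:S\to \mathrm{GL}_d(F)$ such that: (AH) for all $g,h\in S$ with $gh\in S$, $\rho_d(\phi(gh),\phi(g)\phi(h))<\delta$; (D) for all $g\in S\setminus\{e\}$, $\rho_d(\phi(g),\mathrm{Id})\ge\kappa'$. $G$ is called linear sofic over $F$ if it is $\kappa$-linear sofic over $F$ for some $\kappa>0$. *)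

theory Defs
  imports Complex_Main
    "HOL-Library.Countable_Set"
    "HOL-Algebra.Group"
    "Jordan_Normal_Form.DL_Rank"
begin

definition rank_dist :: "nat \<Rightarrow> 'f::field mat \<Rightarrow> 'f mat \<Rightarrow> real" where
  "rank_dist d A B = real (vec_space.rank d (A - B)) / real d"

definition GL :: "nat \<Rightarrow> 'f::field mat set" where
  "GL d = {A \<in> carrier_mat d d. invertible_mat A}"

text \<open>The field is the type argument \<open>'f\<close>, passed as \<open>TYPE('f)\<close>. The two predicates below are
  meant for groups with countable carrier, and the first one for \<open>0 < \<kappa> \<le> 1\<close>; these
  requirements are imposed where the predicates are used. Values of \<open>\<phi>\<close> outside \<open>S\<close>
  are irrelevant.\<close>

definition kappa_linear_sofic ::
    "'f::field itself \<Rightarrow> real \<Rightarrow> ('a, 'm) monoid_scheme \<Rightarrow> bool" where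
  "kappa_linear_sofic F \<kappa> G \<longleftrightarrow>
    (\<forall>S \<delta> \<kappa>'. S \<subseteq> carrier G \<longrightarrow> finite S \<longrightarrow> 0 < \<delta> \<longrightarrow> 0 \<le> \<kappa>' \<longrightarrow> \<kappa>' < \<kappa> \<longrightarrow>
      (\<exists>d\<ge>1. \<exists>\<phi> :: 'a \<Rightarrow> 'f mat.
        (\<forall>g\<in>S. \<phi> g \<in> GL d) \<and>
        (\<forall>g\<in>S. \<forall>h\<in>S. g \<otimes>\<^bsub>G\<^esub> h \<in> S \<longrightarrow> rank_dist d (\<phi> (g \<otimes>\<^bsub>G\<^esub> h)) (\<phi> g * \<phi> h) < \<delta>) \<and>
        (\<forall>g\<in>S - {\<one>\<^bsub>G\<^esub>}. rank_dist d (\<phi> g) (1\<^sub>m d) \<ge> \<kappa>')))"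

definition linear_sofic :: "'f::field itself \<Rightarrow> ('a, 'm) monoid_scheme \<Rightarrow> bool" where
  "linear_sofic F G \<longleftrightarrow> (\<exists>\<kappa>. 0 < \<kappa> \<and> \<kappa> \<le> 1 \<and> kappa_linear_sofic F \<kappa> G)"

definition torsion_free :: "('a, 'm) monoid_scheme \<Rightarrow> bool" where
  "torsion_free G \<longleftrightarrow>
    (\<forall>g\<in>carrier G. \<forall>n::nat. g \<noteq> \<one>\<^bsub>G\<^esub> \<longrightarrow> n > 0 \<longrightarrow> g [^]\<^bsub>G\<^esub> n \<noteq> \<one>\<^bsub>G\<^esub>)"

end

theory Submission
  imports Defs
    "Jordan_Normal_Form.Jordan_Normal_Form_Existence"
    "Jordan_Normal_Form.Jordan_Normal_Form_Uniqueness"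
    "HOL-Library.Groups_Big_Fun"
begin

text \<open>An approximate representation \<open>\<phi>\<close> that separates the elements of the group from the identity only a
little is amplified by a tensor power: \<open>\<phi> g\<close> is replaced by the \<open>n\<close>-fold Kronecker power of
\<open>\<phi> g \<oplus> 1\<close>. The new map is multiplicative up to \<open>n\<close> times the old error, so the question is how
large the fixed space of such a power of \<open>A \<oplus> 1\<close> can be, for \<open>A\<close> invertible of size \<open>d\<close>. The bound
has to be uniform in \<open>d\<close>.

If \<open>A\<close> is diagonalisable, the relative dimension of the fixed space is the probability that a product of \<open>n\<close>
random eigenvalues of \<open>A \<oplus> 1\<close> equals 1, that is, a return probability of a lazy random walk on
the multiplicative group. Nontrivial Jordan blocks fit into the same picture: in characteristic 0
a block of size 2 with eigenvalue \<open>\<lambda>\<close> behaves like two formal eigenvalues \<open>\<lambda> t\<close> and \<open>\<lambda> / t\<close>, where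
\<open>t\<close> has infinite order (the Clebsch-Gordan rule, which appears here as an estimate for
\<open>dim ker (X - \<mu>)\<^sup>b\<close> with \<open>b\<close> shifted by one up and down), and a larger block is cut into blocks of
size 2 and at most one block of size 1. The result is
\<open>dim_gen_eigenspace_amplify_le_walk\<close>: the fixed space is controlled by a lazy walk on pairs
\<open>(\<mu>, b)\<close> with steps read off from the Jordan form of \<open>A\<close>. Steps of the form \<open>(\<lambda>, 0)\<close> with
\<open>\<lambda> ^ M = 1\<close> are harmful, but each comes from its own Jordan block, whose eigenvector is fixed by
\<open>A ^ M\<close>; hence they are at most \<open>dim ker (A ^ M - 1)\<close> in number (\<open>bad_steps_le_kernel_dim\<close>).

Two estimates for lazy walks finish the positive part. If a fixed proportion of the steps has
order at least \<open>k\<close>, the sum of squares of the distribution falls geometrically until it is of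
size \<open>1 / k\<close>: a distribution almost invariant under a shift of large order is spread out
(\<open>energy_drop\<close>, \<open>lazy_walk_decay\<close>). For a torsion-free group this applies with \<open>M = k!\<close>, because
\<open>g ^ M\<close> is still separated from the identity, and gives the constant 1. In general only \<open>M = 1\<close> is
available. Then either many steps move the second coordinate, and these have infinite order, or
many steps multiply the first coordinate by some \<open>\<lambda> \<noteq> 1\<close>; since two different points cannot both
carry more than half of the mass, the return probability tends to at most \<open>1/2\<close>
(\<open>walk_unit_ind_le\<close>).

For the optimality of \<open>1/2\<close>, let \<open>\<phi>\<close> be an approximate representation of the elementary abelian
group of order \<open>h = 2 ^ n\<close>. The vectors on which \<open>\<phi>\<close> is exactly multiplicative form a
\<open>\<phi>\<close>-invariant subspace of almost full dimension, on which \<open>\<phi>\<close> is a representation by involutions.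
The average of these involutions is idempotent, so its trace is nonnegative, and therefore their
fixed spaces have on average at least half of the dimension. Thus the rank distances to the
identity add up to about \<open>h / 2\<close> at most, over \<open>h - 1\<close> nontrivial elements
(\<open>approximate_xor_rep_rank_sum\<close>).\<close>

section \<open>Kernels and ranks of complex matrices\<close>

definition conj_transpose :: "complex mat \<Rightarrow> complex mat" where
  "conj_transpose M = mat (dim_col M) (dim_row M) (\<lambda>(i, j). cnj (M $$ (j, i)))"

lemma conj_transpose_carrier: "M \<in> carrier_mat r n \<Longrightarrow> conj_transpose M \<in> carrier_mat n r"
  by (simp add: conj_transpose_def)

lemma conj_transpose_inner:
  assumes M: "M \<in> carrier_mat r n" and u: "u \<in> carrier_vec r" and v: "v \<in> carrier_vec n"
  shows "(\<Sum>j<n. cnj (v $ j) * (conj_transpose M *\<^sub>v u) $ j) = (\<Sum>i<r. cnj ((M *\<^sub>v v) $ i) * u $ i)"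
proof -
  have 1: "(conj_transpose M *\<^sub>v u) $ j = (\<Sum>i<r. cnj (M $$ (i, j)) * u $ i)" if "j < n" for j
    using that M u by (simp add: conj_transpose_def scalar_prod_def atLeast0LessThan)
  have 2: "cnj ((M *\<^sub>v v) $ i) = (\<Sum>j<n. cnj (M $$ (i, j)) * cnj (v $ j))" if "i < r" for i
    using that M v by (simp add: scalar_prod_def atLeast0LessThan)
  have "(\<Sum>j<n. cnj (v $ j) * (conj_transpose M *\<^sub>v u) $ j) = (\<Sum>j<n. \<Sum>i<r. cnj (v $ j) * (cnj (M $$ (i, j)) * u $ i))"
    by (intro sum.cong refl) (simp add: 1 sum_distrib_left)
  also have "\<dots> = (\<Sum>i<r. \<Sum>j<n. cnj (v $ j) * (cnj (M $$ (i, j)) * u $ i))"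
    by (rule sum.swap)
  also have "\<dots> = (\<Sum>i<r. cnj ((M *\<^sub>v v) $ i) * u $ i)"
    by (intro sum.cong refl) (simp add: 2 sum_distrib_left mult_ac)
  finally show ?thesis .
qed

text \<open>Over the complex numbers a left inverse can be written down: for \<open>B\<close> injective, \<open>B\<^sup>* B\<close> is
invertible because \<open>v\<^sup>* B\<^sup>* B v\<close> is the squared norm of \<open>B v\<close>, and \<open>(B\<^sup>* B)\<^sup>-\<^sup>1 B\<^sup>*\<close> does it.\<close>

lemma injective_mat_left_inverse:
  fixes B :: "complex mat"
  assumes B: "B \<in> carrier_mat n k"
    and inj: "\<And>v. v \<in> carrier_vec k \<Longrightarrow> B *\<^sub>v v = 0\<^sub>v n \<Longrightarrow> v = 0\<^sub>v k"
  shows "\<exists>C \<in> carrier_mat k n. C * B = 1\<^sub>m k"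
proof -
  define H where "H = conj_transpose B"
  have H: "H \<in> carrier_mat k n" unfolding H_def by (rule conj_transpose_carrier[OF B])
  have HB: "H * B \<in> carrier_mat k k" by (rule mult_carrier_mat[OF H B])
  have "det (H * B) \<noteq> 0"
  proof
    assume "det (H * B) = 0"
    then obtain v where v: "v \<in> carrier_vec k" "v \<noteq> 0\<^sub>v k" "(H * B) *\<^sub>v v = 0\<^sub>v k"
      using det_0_iff_vec_prod_zero_field[OF HB] by auto
    define u where "u = B *\<^sub>v v"
    have u: "u \<in> carrier_vec n" using B v by (simp add: u_def)
    have Hu: "H *\<^sub>v u = 0\<^sub>v k" using v H B by (simp add: u_def)
    have "(\<Sum>i<n. cnj (u $ i) * u $ i) = (\<Sum>j<k. cnj (v $ j) * (H *\<^sub>v u) $ j)"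
      unfolding H_def conj_transpose_inner[OF B u v(1)] u_def[symmetric] ..
    also have "\<dots> = 0" by (simp add: Hu)
    finally have "(\<Sum>i<n. complex_of_real ((cmod (u $ i))\<^sup>2)) = 0"
      by (simp add: complex_norm_square[symmetric] mult.commute)
    then have "complex_of_real (\<Sum>i<n. (cmod (u $ i))\<^sup>2) = 0" by simp
    then have "(\<Sum>i<n. (cmod (u $ i))\<^sup>2) = 0" unfolding of_real_eq_0_iff .
    then have "\<forall>i<n. u $ i = 0" by (simp add: sum_nonneg_eq_0_iff)
    then have "u = 0\<^sub>v n" using u by auto
    then show False using inj v by (simp add: u_def)
  qed
  from det_non_zero_imp_unit[OF HB this, of "()"]
  obtain D where D: "D \<in> carrier_mat k k" "D * (H * B) = 1\<^sub>m k"
    by (auto simp: Units_def ring_mat_def)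
  then have "(D * H) * B = 1\<^sub>m k" using H B by (simp add: assoc_mult_mat[of D k k H n B k])
  then show ?thesis using D H by (intro bexI[of _ "D * H"]) auto
qed

lemma mat_eq_by_mult_vec:
  fixes A B :: "'a::comm_ring_1 mat"
  assumes A: "A \<in> carrier_mat r n" and B: "B \<in> carrier_mat r n"
    and eq: "\<And>v. v \<in> carrier_vec n \<Longrightarrow> A *\<^sub>v v = B *\<^sub>v v"
  shows "A = B"
proof (rule eq_matI)
  fix i j assume ij: "i < dim_row B" "j < dim_col B"
  then have "(A *\<^sub>v unit_vec n j) $ i = (B *\<^sub>v unit_vec n j) $ i" using eq by simp
  then show "A $$ (i, j) = B $$ (i, j)" using ij A B by (auto simp: scalar_prod_right_unit)
qed (use A B in auto)

text \<open>Otherwise, padding both factors with zeros gives square matrices with product 1, whose product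
in the other order has a zero diagonal entry.\<close>

lemma right_invertible_dim_le:
  fixes R L :: "'a::field mat"
  assumes R: "R \<in> carrier_mat k m" and L: "L \<in> carrier_mat m k" and LR: "L * R = 1\<^sub>m m"
  shows "m \<le> k"
proof (rule ccontr)
  assume "\<not> m \<le> k"
  then have km: "k < m" by simp
  define R' where "R' = mat m m (\<lambda>(i, j). if i < k then R $$ (i, j) else 0)"
  define L' where "L' = mat m m (\<lambda>(i, j). if j < k then L $$ (i, j) else 0)"
  have R': "R' \<in> carrier_mat m m" and L': "L' \<in> carrier_mat m m" by (auto simp: R'_def L'_def)
  have "L' * R' = 1\<^sub>m m"
  proof (rule eq_matI)
    fix i j assume ij: "i < dim_row (1\<^sub>m m :: 'a mat)" "j < dim_col (1\<^sub>m m :: 'a mat)"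
    then have ij: "i < m" "j < m" by auto
    have "(L' * R') $$ (i, j) = (\<Sum>l<m. if l < k then L $$ (i, l) * R $$ (l, j) else 0)"
      using ij by (auto simp: L'_def R'_def scalar_prod_def atLeast0LessThan intro!: sum.cong)
    also have "\<dots> = (\<Sum>l<k. L $$ (i, l) * R $$ (l, j))"
      using km by (intro sum.mono_neutral_cong_right) auto
    also have "\<dots> = (L * R) $$ (i, j)"
      using ij L R by (simp add: scalar_prod_def atLeast0LessThan)
    finally show "(L' * R') $$ (i, j) = (1\<^sub>m m :: 'a mat) $$ (i, j)" by (simp add: LR)
  qed (auto simp: L' R' R'_def L'_def)
  from mat_mult_left_right_inverse[OF L' R' this] have "(R' * L') $$ (k, k) = 1" using km by simp
  moreover have "(R' * L') $$ (k, k) = 0"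
    using km by (auto simp: L'_def R'_def scalar_prod_def)
  ultimately show False by simp
qed

text \<open>A basis of the kernel of \<open>M\<close>, as the columns of \<open>B\<close>, together with coordinate functionals, the
rows of \<open>C\<close>. In this form dimension counts for kernels become matrix identities.\<close>

lemma kernel_basis_coordinates:
  fixes M :: "complex mat"
  assumes M: "M \<in> carrier_mat r n" and k: "kernel_dim M = k"
  obtains B C where "B \<in> carrier_mat n k" "C \<in> carrier_mat k n" "C * B = 1\<^sub>m k"
    "\<And>v. v \<in> carrier_vec k \<Longrightarrow> M *\<^sub>v (B *\<^sub>v v) = 0\<^sub>v r"
    "\<And>v. v \<in> carrier_vec n \<Longrightarrow> M *\<^sub>v v = 0\<^sub>v r \<Longrightarrow> B *\<^sub>v (C *\<^sub>v v) = v"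
proof -
  interpret K: kernel r n M using M by unfold_locales
  obtain S where S: "finite S" "K.basis S" using kernel_basis_exists[OF M] by auto
  have Sk: "S \<subseteq> mat_kernel M" and li: "\<not> K.lin_dep S" and gen: "K.span S = mat_kernel M"
    using S(2) by (auto simp: K.Ker.basis_def)
  have Sc: "S \<subseteq> carrier_vec n" using Sk mat_kernel_carrier[OF M] by auto
  have card: "card S = k" using K.Ker.dim_basis[OF S] k by simp
  obtain vs where vs: "set vs = S" "distinct vs" using finite_distinct_list[OF S(1)] by auto
  define B where "B = mat_of_cols n vs"
  have len: "length vs = k" using vs card distinct_card by fastforce
  have B: "B \<in> carrier_mat n k" by (simp add: B_def len carrier_matI)
  have cols: "cols B = vs" using Sc vs by (simp add: B_def)
  have MB: "M *\<^sub>v (B *\<^sub>v v) = 0\<^sub>v r" if v: "v \<in> carrier_vec k" for v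
  proof -
    have "K.NC.lincomb (\<lambda>a. v $ find_first a (cols B)) S = B *\<^sub>v v"
      using K.NC.lincomb_eq_mat_mult[OF B v] cols vs by simp
    then have "B *\<^sub>v v = K.lincomb (\<lambda>a. v $ find_first a (cols B)) S" using K.lincomb_same[OF Sk] by simp
    then have "B *\<^sub>v v \<in> K.span S" unfolding K.Ker.span_def using S(1) by auto
    then have "B *\<^sub>v v \<in> mat_kernel M" using gen by simp
    then show ?thesis using mat_kernelD[OF M] by auto
  qed
  have inj: "v = 0\<^sub>v k" if v: "v \<in> carrier_vec k" and "B *\<^sub>v v = 0\<^sub>v n" for v
    using K.NC.lin_depI[OF B v _ that(2)] cols vs li K.lindep_same[OF Sk] by auto
  obtain C where C: "C \<in> carrier_mat k n" "C * B = 1\<^sub>m k"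
    using injective_mat_left_inverse[OF B inj] by auto
  have "B *\<^sub>v (C *\<^sub>v v) = v" if v: "v \<in> carrier_vec n" "M *\<^sub>v v = 0\<^sub>v r" for v
  proof -
    have "v \<in> K.span S" using v gen mat_kernelI[OF M] by auto
    then have "v \<in> K.NC.span S" using K.span_same[OF Sk] by simp
    then obtain a where a: "v = K.NC.lincomb a S" using K.NC.finite_span[OF S(1)] Sc by auto
    define w where "w = vec k (\<lambda>i. a (col B i))"
    have w: "w \<in> carrier_vec k" by (simp add: w_def)
    have vw: "v = B *\<^sub>v w"
      using K.NC.mat_mult_eq_lincomb[OF B, of a] cols vs a by (simp add: w_def)
    have "C *\<^sub>v v = (C * B) *\<^sub>v w"
      unfolding vw by (rule assoc_mult_mat_vec[symmetric, OF C(1) B w])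
    then show ?thesis using C w vw by simp
  qed
  then show ?thesis using that[OF B C MB] by blast
qed

text \<open>Lower bounds are certified by \<open>m\<close> independent kernel vectors: expressing them in the basis of the
kernel gives an injective matrix with \<open>m\<close> columns and \<open>kernel_dim M\<close> rows.\<close>

lemma kernel_dim_ge:
  fixes M :: "complex mat"
  assumes M: "M \<in> carrier_mat r n" and B: "B \<in> carrier_mat n m" and C: "C \<in> carrier_mat m n"
    and CB: "C * B = 1\<^sub>m m" and MB: "\<And>v. v \<in> carrier_vec m \<Longrightarrow> M *\<^sub>v (B *\<^sub>v v) = 0\<^sub>v r"
  shows "m \<le> kernel_dim M"
proof -
  define k where "k = kernel_dim M"
  obtain B' C' where B': "B' \<in> carrier_mat n k" and C': "C' \<in> carrier_mat k n"
    and f': "\<And>v. v \<in> carrier_vec n \<Longrightarrow> M *\<^sub>v v = 0\<^sub>v r \<Longrightarrow> B' *\<^sub>v (C' *\<^sub>v v) = v"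
    by (rule kernel_basis_coordinates[OF M k_def[symmetric]]) (rule that; blast)
  have "(C * B') * (C' * B) = 1\<^sub>m m"
  proof (rule mat_eq_by_mult_vec[of _ m m])
    fix v :: "complex vec" assume v: "v \<in> carrier_vec m"
    have "((C * B') * (C' * B)) *\<^sub>v v = (C * B') *\<^sub>v ((C' * B) *\<^sub>v v)"
      using v B C B' C' by (intro assoc_mult_mat_vec) auto
    also have "\<dots> = C *\<^sub>v (B' *\<^sub>v (C' *\<^sub>v (B *\<^sub>v v)))"
      using v B C B' C' by simp
    also have "\<dots> = (C * B) *\<^sub>v v" using f'[of "B *\<^sub>v v"] MB[OF v] B v C by simp
    finally show "((C * B') * (C' * B)) *\<^sub>v v = 1\<^sub>m m *\<^sub>v v" by (simp add: CB)
  qed (use B C B' C' in auto)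
  then show ?thesis unfolding k_def[symmetric]
    using right_invertible_dim_le[of "C' * B" k m "C * B'"] B C B' C' by auto
qed

text \<open>Upper bounds are certified by \<open>m\<close> linear functionals, the rows of \<open>D\<close>, without a common zero on
the kernel except 0.\<close>

lemma kernel_dim_le:
  fixes M :: "complex mat"
  assumes M: "M \<in> carrier_mat r n" and D: "D \<in> carrier_mat m n"
    and 0: "\<And>v. v \<in> carrier_vec n \<Longrightarrow> M *\<^sub>v v = 0\<^sub>v r \<Longrightarrow> D *\<^sub>v v = 0\<^sub>v m \<Longrightarrow> v = 0\<^sub>v n"
  shows "kernel_dim M \<le> m"
proof -
  define k where "k = kernel_dim M"
  obtain B C where B: "B \<in> carrier_mat n k" and C: "C \<in> carrier_mat k n" and CB: "C * B = 1\<^sub>m k"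
    and f: "\<And>v. v \<in> carrier_vec k \<Longrightarrow> M *\<^sub>v (B *\<^sub>v v) = 0\<^sub>v r"
    by (rule kernel_basis_coordinates[OF M k_def[symmetric]]) (rule that; blast)
  have DB: "D * B \<in> carrier_mat m k" using D B by simp
  have inj: "v = 0\<^sub>v k" if v: "v \<in> carrier_vec k" and z: "(D * B) *\<^sub>v v = 0\<^sub>v m" for v
  proof -
    have "B *\<^sub>v v = 0\<^sub>v n" using 0[of "B *\<^sub>v v"] f[OF v] z D B v by simp
    then have "(C * B) *\<^sub>v v = C *\<^sub>v 0\<^sub>v n" using C B v by simp
    also have "\<dots> = 0\<^sub>v k" using C by auto
    finally have "(C * B) *\<^sub>v v = 0\<^sub>v k" .
    then show ?thesis using CB v by simp
  qed
  obtain L where "L \<in> carrier_mat k m" "L * (D * B) = 1\<^sub>m k"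
    using injective_mat_left_inverse[OF DB inj] by auto
  then show ?thesis using right_invertible_dim_le[OF DB] k_def by auto
qed

lemma rank_plus_kernel_dim:
  fixes M :: "complex mat"
  assumes M: "M \<in> carrier_mat n n"
  shows "vec_space.rank n M + kernel_dim M = n"
proof -
  interpret K: kernel n n M using M by unfold_locales
  interpret L: linear_map class_ring K.NC.V K.NC.V "\<lambda>v. M *\<^sub>v v"
    apply unfold_locales
    using M by (auto simp: LinearCombinations.module_hom_def mult_add_distrib_mat_vec[OF M] mult_mat_vec[OF M])
  have 1: "L.kerT = mat_kernel M" unfolding L.ker_def mat_kernel[OF M] by auto
  have 2: "L.imT = K.NC.span (set (cols M))"
    using K.NC.col_space_eq[OF M] M unfolding K.NC.col_space_def L.im_def by force
  show ?thesis using L.rank_nullity[unfolded 1 2] K.kernel_dim K.NC.dim_is_n K.NC.fin_dim unfolding K.NC.rank_def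
    by simp
qed

lemma obtain_vec_append:
  assumes "v \<in> carrier_vec (n + m)"
  obtains a d where "a \<in> carrier_vec n" "d \<in> carrier_vec m" "v = a @\<^sub>v d"
  using vec_first_last_append[OF assms] vec_first_carrier vec_last_carrier by metis

lemma zero_vec_append: "0\<^sub>v (n + m) = 0\<^sub>v n @\<^sub>v 0\<^sub>v m"
  by (intro eq_vecI) (auto simp: append_vec_def)

lemma zero_mat_mult_vec: "v \<in> carrier_vec n \<Longrightarrow> 0\<^sub>m m n *\<^sub>v (v :: 'a::comm_ring_1 vec) = 0\<^sub>v m"
  by (intro eq_vecI) auto

lemma mult_mat_zero_vec: "A \<in> carrier_mat m n \<Longrightarrow> A *\<^sub>v 0\<^sub>v n = (0\<^sub>v m :: 'a::comm_ring_1 vec)"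
  by (intro eq_vecI) auto

lemma smult_mat_mult_vec:
  "A \<in> carrier_mat m n \<Longrightarrow> v \<in> carrier_vec n \<Longrightarrow> (c \<cdot>\<^sub>m A) *\<^sub>v v = c \<cdot>\<^sub>v (A *\<^sub>v (v :: 'a::comm_ring_1 vec))"
  by (intro eq_vecI) (auto simp: scalar_prod_def sum_distrib_left mult_ac)

lemma mat_kernel_smult_eq:
  fixes M :: "'a::field mat"
  assumes M: "M \<in> carrier_mat r n" and c: "c \<noteq> 0"
  shows "mat_kernel (c \<cdot>\<^sub>m M) = mat_kernel M"
proof -
  have cM: "c \<cdot>\<^sub>m M \<in> carrier_mat r n" using M by simp
  show ?thesis unfolding mat_kernel[OF M] mat_kernel[OF cM] using c smult_mat_mult_vec[OF M]
    by (auto simp: vec_eq_iff)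
qed

lemma four_block_mult_vec_eq_zero:
  fixes A B C E :: "'a::comm_ring_1 mat"
  assumes "A \<in> carrier_mat r1 n" "B \<in> carrier_mat r1 m" "C \<in> carrier_mat r2 n" "E \<in> carrier_mat r2 m"
    and "a \<in> carrier_vec n" "d \<in> carrier_vec m"
    and "four_block_mat A B C E *\<^sub>v (a @\<^sub>v d) = 0\<^sub>v (r1 + r2)"
  shows "A *\<^sub>v a + B *\<^sub>v d = 0\<^sub>v r1" "C *\<^sub>v a + E *\<^sub>v d = 0\<^sub>v r2"
proof -
  have "(A *\<^sub>v a + B *\<^sub>v d) @\<^sub>v (C *\<^sub>v a + E *\<^sub>v d) = 0\<^sub>v r1 @\<^sub>v 0\<^sub>v r2"
    using four_block_mat_mult_vec[OF assms(1-6)] assms(7) by (simp add: zero_vec_append)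
  moreover have "A *\<^sub>v a + B *\<^sub>v d \<in> carrier_vec r1" using assms by simp
  ultimately show "A *\<^sub>v a + B *\<^sub>v d = 0\<^sub>v r1" "C *\<^sub>v a + E *\<^sub>v d = 0\<^sub>v r2"
    using append_vec_eq[of "A *\<^sub>v a + B *\<^sub>v d" r1 "0\<^sub>v r1"] by auto
qed

lemma commute_pow_mat:
  fixes X Y :: "'a::comm_ring_1 mat"
  assumes X: "X \<in> carrier_mat D D" and Y: "Y \<in> carrier_mat D D" and XY: "X * Y = Y * X"
  shows "Y ^\<^sub>m k * X = X * Y ^\<^sub>m k"
proof (induction k)
  case (Suc k)
  have Yk: "Y ^\<^sub>m k \<in> carrier_mat D D" using Y by auto
  have "Y ^\<^sub>m k * Y * X = Y ^\<^sub>m k * (X * Y)" unfolding XY by (rule assoc_mult_mat[OF Yk Y X])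
  also have "\<dots> = (Y ^\<^sub>m k * X) * Y" by (rule assoc_mult_mat[OF Yk X Y, symmetric])
  also have "\<dots> = X * (Y ^\<^sub>m k * Y)" unfolding Suc by (rule assoc_mult_mat[OF X Yk Y])
  finally show ?case by simp
qed (use X Y in auto)

text \<open>The converse of \<open>kernel_dim_le\<close>: the optimal number of functionals is attained.\<close>

lemma kernel_detecting_functionals:
  fixes M :: "complex mat"
  assumes M: "M \<in> carrier_mat r n"
  shows "\<exists>C \<in> carrier_mat (kernel_dim M) n. \<forall>v\<in>carrier_vec n. M *\<^sub>v v = 0\<^sub>v r \<longrightarrow> C *\<^sub>v v = 0\<^sub>v (kernel_dim M) \<longrightarrow> v = 0\<^sub>v n"
proof -
  let ?k = "kernel_dim M"
  obtain B C where B: "B \<in> carrier_mat n ?k" and C: "C \<in> carrier_mat ?k n"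
    and f: "\<And>v. v \<in> carrier_vec n \<Longrightarrow> M *\<^sub>v v = 0\<^sub>v r \<Longrightarrow> B *\<^sub>v (C *\<^sub>v v) = v"
    by (rule kernel_basis_coordinates[OF M refl]) (rule that; blast)
  have "v = 0\<^sub>v n" if "v \<in> carrier_vec n" "M *\<^sub>v v = 0\<^sub>v r" "C *\<^sub>v v = 0\<^sub>v ?k" for v
    using f[OF that(1,2)] unfolding that(3) mult_mat_zero_vec[OF B] by (rule sym)
  then show ?thesis using C by blast
qed

text \<open>Functionals detecting the kernels of both diagonal blocks, taken together, detect the kernel of
the whole matrix: first the lower component of a kernel vector vanishes, then the upper one.\<close>

lemma kernel_dim_block_triangular:
  fixes P Q R :: "complex mat"
  assumes P: "P \<in> carrier_mat n n" and Q: "Q \<in> carrier_mat n m" and R: "R \<in> carrier_mat m m"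
  shows "kernel_dim (four_block_mat P Q (0\<^sub>m m n) R) \<le> kernel_dim P + kernel_dim R"
proof -
  let ?p = "kernel_dim P" and ?r = "kernel_dim R"
  obtain C where C: "C \<in> carrier_mat ?p n"
    and C0: "\<And>v. v \<in> carrier_vec n \<Longrightarrow> P *\<^sub>v v = 0\<^sub>v n \<Longrightarrow> C *\<^sub>v v = 0\<^sub>v ?p \<Longrightarrow> v = 0\<^sub>v n"
    using kernel_detecting_functionals[OF P] by auto
  obtain E where E: "E \<in> carrier_mat ?r m"
    and E0: "\<And>v. v \<in> carrier_vec m \<Longrightarrow> R *\<^sub>v v = 0\<^sub>v m \<Longrightarrow> E *\<^sub>v v = 0\<^sub>v ?r \<Longrightarrow> v = 0\<^sub>v m"
    using kernel_detecting_functionals[OF R] by auto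
  show ?thesis
  proof (rule kernel_dim_le[of _ "n + m" "n + m" "four_block_mat C (0\<^sub>m ?p m) (0\<^sub>m ?r n) E"])
    fix v :: "complex vec"
    assume v: "v \<in> carrier_vec (n + m)" and M0: "four_block_mat P Q (0\<^sub>m m n) R *\<^sub>v v = 0\<^sub>v (n + m)"
      and D0: "four_block_mat C (0\<^sub>m ?p m) (0\<^sub>m ?r n) E *\<^sub>v v = 0\<^sub>v (?p + ?r)"
    obtain a d where a: "a \<in> carrier_vec n" and d: "d \<in> carrier_vec m" and vad: "v = a @\<^sub>v d"
      using obtain_vec_append[OF v] by metis
    have M1: "P *\<^sub>v a + Q *\<^sub>v d = 0\<^sub>v n" "0\<^sub>m m n *\<^sub>v a + R *\<^sub>v d = 0\<^sub>v m"
      using four_block_mult_vec_eq_zero[OF P Q zero_carrier_mat R a d] M0 vad by auto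
    have D1: "C *\<^sub>v a + 0\<^sub>m ?p m *\<^sub>v d = 0\<^sub>v ?p" "0\<^sub>m ?r n *\<^sub>v a + E *\<^sub>v d = 0\<^sub>v ?r"
      using four_block_mult_vec_eq_zero[OF C zero_carrier_mat zero_carrier_mat E a d] D0 vad by auto
    have "R *\<^sub>v d = 0\<^sub>v m" "E *\<^sub>v d = 0\<^sub>v ?r" "C *\<^sub>v a = 0\<^sub>v ?p"
      using M1 D1 a d C E R by (auto simp: zero_mat_mult_vec)
    note z = this
    have d0: "d = 0\<^sub>v m" using E0[OF d] z by auto
    have "P *\<^sub>v a = 0\<^sub>v n" using M1(1) d0 a P Q by (auto simp: mult_mat_zero_vec)
    then have "a = 0\<^sub>v n" using C0[OF a] z by auto
    with d0 show "v = 0\<^sub>v (n + m)" using vad by (simp add: zero_vec_append)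
  qed (use P Q R C E in auto)
qed

lemma pow_block_triangular:
  fixes P Q R :: "complex mat"
  assumes P: "P \<in> carrier_mat n n" and Q: "Q \<in> carrier_mat n m" and R: "R \<in> carrier_mat m m"
  shows "\<exists>Q'\<in>carrier_mat n m. four_block_mat P Q (0\<^sub>m m n) R ^\<^sub>m b = four_block_mat (P ^\<^sub>m b) Q' (0\<^sub>m m n) (R ^\<^sub>m b)"
proof (induction b)
  case 0
  show ?case using P Q R by (intro bexI[of _ "0\<^sub>m n m"]) auto
next
  case (Suc b)
  then obtain Q' where Q': "Q' \<in> carrier_mat n m"
    and eq: "four_block_mat P Q (0\<^sub>m m n) R ^\<^sub>m b = four_block_mat (P ^\<^sub>m b) Q' (0\<^sub>m m n) (R ^\<^sub>m b)" by auto
  have Pb: "P ^\<^sub>m b \<in> carrier_mat n n" and Rb: "R ^\<^sub>m b \<in> carrier_mat m m" using P R by auto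
  show ?case
    using mult_four_block_mat[OF Pb Q' zero_carrier_mat Rb P Q zero_carrier_mat R] P Q Q' R Pb Rb
    by (intro bexI[of _ "P ^\<^sub>m b * Q + Q' * R"]) (auto simp: eq)
qed

lemma char_matrix_block_triangular:
  assumes P: "P \<in> carrier_mat n n" and Q: "Q \<in> carrier_mat n m" and R: "R \<in> carrier_mat m m"
  shows "char_matrix (four_block_mat P Q (0\<^sub>m m n) R) e
    = four_block_mat (char_matrix P e) Q (0\<^sub>m m n) (char_matrix R e)"
  using P Q R by (intro eq_matI) (auto simp: char_matrix_def)

lemma dim_gen_eigenspace_block_triangular:
  fixes P Q R :: "complex mat"
  assumes P: "P \<in> carrier_mat n n" and Q: "Q \<in> carrier_mat n m" and R: "R \<in> carrier_mat m m"
  shows "dim_gen_eigenspace (four_block_mat P Q (0\<^sub>m m n) R) e b \<le> dim_gen_eigenspace P e b + dim_gen_eigenspace R e b"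
proof -
  have cP: "char_matrix P e \<in> carrier_mat n n" and cR: "char_matrix R e \<in> carrier_mat m m" using P R by auto
  obtain Q' where "Q' \<in> carrier_mat n m"
    "char_matrix (four_block_mat P Q (0\<^sub>m m n) R) e ^\<^sub>m b = four_block_mat (char_matrix P e ^\<^sub>m b) Q' (0\<^sub>m m n) (char_matrix R e ^\<^sub>m b)"
    using pow_block_triangular[OF cP Q cR] unfolding char_matrix_block_triangular[OF P Q R] by metis
  then show ?thesis unfolding dim_gen_eigenspace_def
    using kernel_dim_block_triangular[of "char_matrix P e ^\<^sub>m b" n Q' m "char_matrix R e ^\<^sub>m b"] cP cR by auto
qed

lemma smult_smult_mat: "a \<cdot>\<^sub>m (b \<cdot>\<^sub>m (A :: 'a::comm_ring_1 mat)) = (a * b) \<cdot>\<^sub>m A"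
  by (intro eq_matI) (auto simp: mult.assoc)

lemma pow_smult:
  assumes A: "A \<in> carrier_mat D D"
  shows "((l :: 'a::field) \<cdot>\<^sub>m A) ^\<^sub>m b = l ^ b \<cdot>\<^sub>m (A ^\<^sub>m b)"
proof (induction b)
  case (Suc b)
  have Ab: "A ^\<^sub>m b \<in> carrier_mat D D" using A by auto
  show ?case using A Ab Suc
    by (simp add: mult_smult_assoc_mat[of _ D D _ D] mult_smult_distrib[of _ D D _ D] smult_smult_mat mult.commute)
qed (use A in auto)

section \<open>Generalised eigenspaces of Kronecker products with Jordan blocks\<close>

lemma dim_gen_eigenspace_smult:
  fixes X :: "complex mat"
  assumes X: "X \<in> carrier_mat D D" and l: "l \<noteq> 0"
  shows "dim_gen_eigenspace (l \<cdot>\<^sub>m X) \<mu> b = dim_gen_eigenspace X (\<mu> / l) b"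
proof -
  have "char_matrix (l \<cdot>\<^sub>m X) \<mu> = l \<cdot>\<^sub>m char_matrix X (\<mu> / l)"
    using X l by (intro eq_matI) (auto simp: char_matrix_def field_simps)
  then have *: "char_matrix (l \<cdot>\<^sub>m X) \<mu> ^\<^sub>m b = l ^ b \<cdot>\<^sub>m (char_matrix X (\<mu> / l) ^\<^sub>m b)"
    using pow_smult[of "char_matrix X (\<mu> / l)" D l b] X by simp
  have c: "char_matrix X (\<mu> / l) ^\<^sub>m b \<in> carrier_mat D D" using X by auto
  have ker: "mat_kernel (l ^ b \<cdot>\<^sub>m (char_matrix X (\<mu> / l) ^\<^sub>m b)) = mat_kernel (char_matrix X (\<mu> / l) ^\<^sub>m b)"
    by (rule mat_kernel_smult_eq[OF c]) (simp add: l)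
  have "kernel_dim (l ^ b \<cdot>\<^sub>m (char_matrix X (\<mu> / l) ^\<^sub>m b)) = kernel_dim (char_matrix X (\<mu> / l) ^\<^sub>m b)"
    unfolding kernel_dim_def using ker c by simp
  then show ?thesis unfolding dim_gen_eigenspace_def * .
qed

text \<open>With \<open>n\<^sup>2 = 0\<close>, this is \<open>(Y + n X)\<^sup>b\<^sup>+\<^sup>1 = Y\<^sup>b\<^sup>+\<^sup>1 + n (b + 1) X Y\<^sup>b\<close>, written with 2 by 2 blocks.\<close>

lemma pow_block_equal_diagonal:
  fixes X Y :: "complex mat"
  assumes X: "X \<in> carrier_mat D D" and Y: "Y \<in> carrier_mat D D" and XY: "X * Y = Y * X"
  shows "four_block_mat Y X (0\<^sub>m D D) Y ^\<^sub>m Suc b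
    = four_block_mat (Y ^\<^sub>m Suc b) (of_nat (Suc b) \<cdot>\<^sub>m (X * Y ^\<^sub>m b)) (0\<^sub>m D D) (Y ^\<^sub>m Suc b)"
proof (induction b)
  case 0
  have "1 \<cdot>\<^sub>m X = X" using X by (intro eq_matI) auto
  then show ?case using X Y by (simp add: carrier_matD)
next
  case (Suc b)
  have Yb: "Y ^\<^sub>m k \<in> carrier_mat D D" for k using Y by auto
  have com: "Y ^\<^sub>m k * X = X * Y ^\<^sub>m k" for k by (rule commute_pow_mat[OF X Y XY])
  have "four_block_mat Y X (0\<^sub>m D D) Y ^\<^sub>m Suc (Suc b)
    = four_block_mat (Y ^\<^sub>m Suc b) (of_nat (Suc b) \<cdot>\<^sub>m (X * Y ^\<^sub>m b)) (0\<^sub>m D D) (Y ^\<^sub>m Suc b) * four_block_mat Y X (0\<^sub>m D D) Y"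
    using Suc by simp
  also have "\<dots> = four_block_mat (Y ^\<^sub>m Suc b * Y) (Y ^\<^sub>m Suc b * X + (of_nat (Suc b) \<cdot>\<^sub>m (X * Y ^\<^sub>m b)) * Y)
      (0\<^sub>m D D) (Y ^\<^sub>m Suc b * Y)"
    using mult_four_block_mat[of "Y ^\<^sub>m Suc b" D D "of_nat (Suc b) \<cdot>\<^sub>m (X * Y ^\<^sub>m b)" D "0\<^sub>m D D" D "Y ^\<^sub>m Suc b" Y D X D "0\<^sub>m D D" Y]
      X Y Yb[of b] Yb[of "Suc b"] by (simp del: assoc_mult_mat)
  also have "Y ^\<^sub>m Suc b * X + (of_nat (Suc b) \<cdot>\<^sub>m (X * Y ^\<^sub>m b)) * Y = of_nat (Suc (Suc b)) \<cdot>\<^sub>m (X * Y ^\<^sub>m Suc b)"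
  proof -
    have 1: "(of_nat (Suc b) \<cdot>\<^sub>m (X * Y ^\<^sub>m b)) * Y = of_nat (Suc b) \<cdot>\<^sub>m (X * Y ^\<^sub>m Suc b)"
      using X Y Yb[of b] by (simp add: mult_smult_assoc_mat[of _ D D _ D] assoc_mult_mat[of _ D D _ D _ D])
    have Z: "X * Y ^\<^sub>m Suc b \<in> carrier_mat D D" using X Yb[of "Suc b"] by (rule mult_carrier_mat)
    show ?thesis unfolding 1 com using Z by (intro eq_matI) (auto simp: algebra_simps simp del: index_mult_mat(1) pow_mat.simps)
  qed
  finally show ?case by simp
qed

text \<open>The Clebsch-Gordan rule. The matrix on the left is the Kronecker product of a Jordan block of
size 2 with \<open>X\<close>; applied to a Jordan block \<open>X\<close> of size \<open>m\<close>, the estimate says that the product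
has at most as large kernels as blocks of size \<open>m + 1\<close> and \<open>m - 1\<close>. With \<open>Y = l X - \<mu>\<close> the
\<open>b\<close>-th power has kernel vectors \<open>(x, w)\<close> given by \<open>Y\<^sup>b x + b X Y\<^sup>b\<^sup>-\<^sup>1 w = 0\<close> and \<open>Y\<^sup>b w = 0\<close>. Since
\<open>X = (Y + \<mu>) / l\<close>, the change of variables \<open>u = Y x + c w\<close> with \<open>c = b \<mu> / l\<close> turns them into
\<open>Y\<^sup>b\<^sup>-\<^sup>1 u = 0\<close> and \<open>Y\<^sup>b\<^sup>+\<^sup>1 x = 0\<close>. Characteristic 0 enters through \<open>c \<noteq> 0\<close>.\<close>

lemma dim_gen_eigenspace_size2_block:
  fixes X :: "complex mat"
  assumes X: "X \<in> carrier_mat D D" and l: "l \<noteq> 0" and mu: "\<mu> \<noteq> 0" and b: "b > 0"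
  shows "dim_gen_eigenspace (four_block_mat (l \<cdot>\<^sub>m X) X (0\<^sub>m D D) (l \<cdot>\<^sub>m X)) \<mu> b
    \<le> dim_gen_eigenspace (l \<cdot>\<^sub>m X) \<mu> (b + 1) + dim_gen_eigenspace (l \<cdot>\<^sub>m X) \<mu> (b - 1)"
proof -
  obtain a where ba: "b = Suc a" using b by (cases b) auto
  define Y where "Y = char_matrix (l \<cdot>\<^sub>m X) \<mu>"
  have Y: "Y \<in> carrier_mat D D" using X by (simp add: Y_def)
  have Yp: "Y ^\<^sub>m k \<in> carrier_mat D D" for k using Y by auto
  have XY: "X = (1 / l) \<cdot>\<^sub>m (Y + \<mu> \<cdot>\<^sub>m 1\<^sub>m D)"
    using X l by (intro eq_matI) (auto simp: Y_def char_matrix_def)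
  have com: "X * Y = Y * X"
    using X by (simp add: Y_def char_matrix_def mult_add_distrib_mat[of _ D D _ D] add_mult_distrib_mat[of _ D D _ _ D]
      mult_smult_distrib[of _ D D _ D] mult_smult_assoc_mat[of _ D D _ D])
  let ?M = "four_block_mat (Y ^\<^sub>m b) (of_nat b \<cdot>\<^sub>m (X * Y ^\<^sub>m a)) (0\<^sub>m D D) (Y ^\<^sub>m b)"
  have M: "char_matrix (four_block_mat (l \<cdot>\<^sub>m X) X (0\<^sub>m D D) (l \<cdot>\<^sub>m X)) \<mu> ^\<^sub>m b = ?M"
    using char_matrix_block_triangular[of "l \<cdot>\<^sub>m X" D X D "l \<cdot>\<^sub>m X" \<mu>] pow_block_equal_diagonal[OF X Y com, of a] X ba
    by (simp add: Y_def)
  define c where "c = of_nat b * \<mu> / l"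
  have c: "c \<noteq> 0" using b l mu by (simp add: c_def)
  let ?p = "kernel_dim (Y ^\<^sub>m Suc b)" and ?r = "kernel_dim (Y ^\<^sub>m a)"
  obtain C where C: "C \<in> carrier_mat ?p D"
    and C0: "\<And>v. v \<in> carrier_vec D \<Longrightarrow> Y ^\<^sub>m Suc b *\<^sub>v v = 0\<^sub>v D \<Longrightarrow> C *\<^sub>v v = 0\<^sub>v ?p \<Longrightarrow> v = 0\<^sub>v D"
    using kernel_detecting_functionals[OF Yp[of "Suc b"]] by auto
  obtain E where E: "E \<in> carrier_mat ?r D"
    and E0: "\<And>v. v \<in> carrier_vec D \<Longrightarrow> Y ^\<^sub>m a *\<^sub>v v = 0\<^sub>v D \<Longrightarrow> E *\<^sub>v v = 0\<^sub>v ?r \<Longrightarrow> v = 0\<^sub>v D"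
    using kernel_detecting_functionals[OF Yp[of a]] by auto
  have "kernel_dim ?M \<le> ?p + ?r"
  proof (rule kernel_dim_le[of _ "D + D" "D + D" "four_block_mat C (0\<^sub>m ?p D) (E * Y) (c \<cdot>\<^sub>m E)"])
    fix v :: "complex vec"
    assume v: "v \<in> carrier_vec (D + D)" and M0: "?M *\<^sub>v v = 0\<^sub>v (D + D)"
      and D0: "four_block_mat C (0\<^sub>m ?p D) (E * Y) (c \<cdot>\<^sub>m E) *\<^sub>v v = 0\<^sub>v (?p + ?r)"
    obtain x w where x: "x \<in> carrier_vec D" and w: "w \<in> carrier_vec D" and vxw: "v = x @\<^sub>v w"
      using obtain_vec_append[OF v] by metis
    have Q: "of_nat b \<cdot>\<^sub>m (X * Y ^\<^sub>m a) \<in> carrier_mat D D" using X Yp by auto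
    have M1: "Y ^\<^sub>m b *\<^sub>v x + (of_nat b \<cdot>\<^sub>m (X * Y ^\<^sub>m a)) *\<^sub>v w = 0\<^sub>v D" "0\<^sub>m D D *\<^sub>v x + Y ^\<^sub>m b *\<^sub>v w = 0\<^sub>v D"
      using four_block_mult_vec_eq_zero[OF Yp[of b] Q zero_carrier_mat Yp[of b] x w] M0 vxw by auto
    have D1: "C *\<^sub>v x + 0\<^sub>m ?p D *\<^sub>v w = 0\<^sub>v ?p" "(E * Y) *\<^sub>v x + (c \<cdot>\<^sub>m E) *\<^sub>v w = 0\<^sub>v ?r"
      using four_block_mult_vec_eq_zero[OF C zero_carrier_mat _ _ x w, of "E * Y" ?r "c \<cdot>\<^sub>m E"] D0 vxw E Y by auto
    define u where "u = Y *\<^sub>v x + c \<cdot>\<^sub>v w"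
    have u: "u \<in> carrier_vec D" using Y x w by (simp add: u_def)
    have w0: "Y ^\<^sub>m b *\<^sub>v w = 0\<^sub>v D" using M1(2) x w Yp[of b] by (auto simp: zero_mat_mult_vec)
    have Cx: "C *\<^sub>v x = 0\<^sub>v ?p" using D1(1) C x w by (auto simp: zero_mat_mult_vec)
    have Eu: "E *\<^sub>v u = 0\<^sub>v ?r" using D1(2) E Y x w
      by (simp add: u_def mult_add_distrib_mat_vec[of _ ?r D] mult_mat_vec[of _ ?r D] smult_mat_mult_vec[of _ ?r D])
    have Yu: "Y ^\<^sub>m a *\<^sub>v u = 0\<^sub>v D"
    proof -
      have 1: "(of_nat b \<cdot>\<^sub>m (X * Y ^\<^sub>m a)) *\<^sub>v w = c \<cdot>\<^sub>v (Y ^\<^sub>m a *\<^sub>v w)"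
      proof -
        have "X * Y ^\<^sub>m a = (1 / l) \<cdot>\<^sub>m (Y * Y ^\<^sub>m a + \<mu> \<cdot>\<^sub>m Y ^\<^sub>m a)"
          unfolding XY using Y Yp[of a] by (simp add: mult_smult_assoc_mat[of _ D D _ D] add_mult_distrib_mat[of _ D D _ _ D])
        also have "Y * Y ^\<^sub>m a = Y ^\<^sub>m b" using commute_pow_mat[OF Y Y refl, of a] ba by simp
        finally have "(X * Y ^\<^sub>m a) *\<^sub>v w = (1 / l) \<cdot>\<^sub>v (Y ^\<^sub>m b *\<^sub>v w + \<mu> \<cdot>\<^sub>v (Y ^\<^sub>m a *\<^sub>v w))"
          using w Yp[of a] Yp[of b]
          by (simp add: smult_mat_mult_vec[of _ D D] add_mult_distrib_mat_vec[of _ D D])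
        then show ?thesis using w0 w Yp[of a] Q X
          by (simp add: smult_mat_mult_vec[of _ D D] smult_smult_assoc c_def)
      qed
      have 2: "Y ^\<^sub>m b *\<^sub>v x = Y ^\<^sub>m a *\<^sub>v (Y *\<^sub>v x)"
        unfolding ba pow_mat.simps by (rule assoc_mult_mat_vec[OF Yp Y x])
      show ?thesis using M1(1) Y x w Yp[of a] unfolding 1 2
        by (simp add: u_def mult_add_distrib_mat_vec[of _ D D] mult_mat_vec[of _ D D])
    qed
    have u0: "u = 0\<^sub>v D" by (rule E0[OF u Yu Eu])
    have Yx: "Y ^\<^sub>m Suc b *\<^sub>v x = 0\<^sub>v D"
    proof -
      have "Y ^\<^sub>m b *\<^sub>v u = Y ^\<^sub>m Suc b *\<^sub>v x + c \<cdot>\<^sub>v (Y ^\<^sub>m b *\<^sub>v w)"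
        using Y x w Yp[of b] assoc_mult_mat_vec[OF Yp[of b] Y x]
        by (simp add: u_def mult_add_distrib_mat_vec[of _ D D] mult_mat_vec[of _ D D])
      moreover have "c \<cdot>\<^sub>v 0\<^sub>v D = 0\<^sub>v D" by (intro eq_vecI) auto
      ultimately have "0\<^sub>v D = Y ^\<^sub>m Suc b *\<^sub>v x + 0\<^sub>v D" unfolding u0 w0 mult_mat_zero_vec[OF Yp] by simp
      moreover have "Y ^\<^sub>m Suc b *\<^sub>v x \<in> carrier_vec D" using Yp[of "Suc b"] x by (rule mult_mat_vec_carrier)
      ultimately show ?thesis by (simp del: pow_mat.simps)
    qed
    have x0: "x = 0\<^sub>v D" by (rule C0[OF x Yx Cx])
    have "c \<cdot>\<^sub>v w = 0\<^sub>v D" using u0 w by (simp add: u_def x0 mult_mat_zero_vec[OF Y])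
    then have "w = 0\<^sub>v D" using c w by (auto simp: vec_eq_iff)
    then show "v = 0\<^sub>v (D + D)" using x0 vxw by (simp add: zero_vec_append)
  qed (use Yp C E X Y in auto)
  then show ?thesis unfolding dim_gen_eigenspace_def M Y_def[symmetric] by (simp add: ba)
qed

text \<open>The Kronecker product, with the index of the left factor as the more significant digit, so that
block matrices on the left stay block matrices (\<open>kron_four_block\<close>).\<close>

definition kron :: "'a::semiring_1 mat \<Rightarrow> 'a mat \<Rightarrow> 'a mat" where
  "kron A B = mat (dim_row A * dim_row B) (dim_col A * dim_col B)
     (\<lambda>(i, j). A $$ (i div dim_row B, j div dim_col B) * B $$ (i mod dim_row B, j mod dim_col B))"

lemma kron_carrier [simp]:
  "A \<in> carrier_mat r1 c1 \<Longrightarrow> B \<in> carrier_mat r2 c2 \<Longrightarrow> kron A B \<in> carrier_mat (r1 * r2) (c1 * c2)"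
  by (auto simp: kron_def)

lemma sum_div_mod:
  fixes f :: "nat \<Rightarrow> nat \<Rightarrow> 'a::comm_monoid_add"
  shows "(\<Sum>l<n * m. f (l div m) (l mod m)) = (\<Sum>a<n. \<Sum>b<m. f a b)"
proof -
  have "(\<Sum>l<n * m. f (l div m) (l mod m)) = (\<Sum>a<n. \<Sum>l\<in>{a * m..<a * m + m}. f (l div m) (l mod m))"
    by (rule sum.nat_group[symmetric])
  also have "\<dots> = (\<Sum>a<n. \<Sum>b<m. f a b)"
  proof (rule sum.cong[OF refl])
    fix a
    have "(\<Sum>l\<in>{a * m..<a * m + m}. f (l div m) (l mod m)) = (\<Sum>b\<in>{0..<m}. f ((b + a * m) div m) ((b + a * m) mod m))"
      using sum.shift_bounds_nat_ivl[of "\<lambda>l. f (l div m) (l mod m)" 0 "a * m" m] by (simp add: add.commute)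
    also have "\<dots> = (\<Sum>b<m. f a b)"
      unfolding atLeast0LessThan by (rule sum.cong[OF refl]) auto
    finally show "(\<Sum>l\<in>{a * m..<a * m + m}. f (l div m) (l mod m)) = (\<Sum>b<m. f a b)" .
  qed
  finally show ?thesis .
qed

lemma div_mod_less_mult:
  "i < n * m \<Longrightarrow> i div m < n \<and> i mod m < (m :: nat)"
  by (cases "m = 0") (auto simp: less_mult_imp_div_less)

lemma kron_mult:
  fixes A B C E :: "'a::comm_semiring_1 mat"
  assumes A: "A \<in> carrier_mat r1 n1" and C: "C \<in> carrier_mat n1 c1"
    and B: "B \<in> carrier_mat r2 n2" and E: "E \<in> carrier_mat n2 c2"
  shows "kron A B * kron C E = kron (A * C) (B * E)"
proof (rule eq_matI)
  fix i j assume "i < dim_row (kron (A * C) (B * E))" "j < dim_col (kron (A * C) (B * E))"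
  then have i: "i < r1 * r2" and j: "j < c1 * c2" using A B C E by (auto simp: kron_def)
  note ij = div_mod_less_mult[OF i] div_mod_less_mult[OF j]
  have "(kron A B * kron C E) $$ (i, j) = (\<Sum>l<n1 * n2.
      A $$ (i div r2, l div n2) * B $$ (i mod r2, l mod n2) * (C $$ (l div n2, j div c2) * E $$ (l mod n2, j mod c2)))"
    using A B C E i j by (simp add: kron_def scalar_prod_def atLeast0LessThan)
  also have "\<dots> = (\<Sum>a<n1. \<Sum>b<n2. A $$ (i div r2, a) * B $$ (i mod r2, b) * (C $$ (a, j div c2) * E $$ (b, j mod c2)))"
    by (rule sum_div_mod)
  also have "\<dots> = (\<Sum>a<n1. A $$ (i div r2, a) * C $$ (a, j div c2)) * (\<Sum>b<n2. B $$ (i mod r2, b) * E $$ (b, j mod c2))"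
    by (simp add: sum_product mult_ac)
  also have "\<dots> = kron (A * C) (B * E) $$ (i, j)"
    using A B C E i j ij by (simp add: kron_def scalar_prod_def atLeast0LessThan)
  finally show "(kron A B * kron C E) $$ (i, j) = kron (A * C) (B * E) $$ (i, j)" .
qed (use A B C E in \<open>auto simp: kron_def\<close>)

lemma kron_one: "kron (1\<^sub>m n) (1\<^sub>m m) = (1\<^sub>m (n * m) :: 'a::semiring_1 mat)"
proof (rule eq_matI)
  fix i j assume "i < dim_row (1\<^sub>m (n * m) :: 'a mat)" "j < dim_col (1\<^sub>m (n * m) :: 'a mat)"
  then have i: "i < n * m" and j: "j < n * m" by auto
  note ij = div_mod_less_mult[OF i] div_mod_less_mult[OF j]
  have "i = j \<longleftrightarrow> i div m = j div m \<and> i mod m = j mod m" by (metis div_mult_mod_eq)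
  then show "kron (1\<^sub>m n) (1\<^sub>m m) $$ (i, j) = (1\<^sub>m (n * m) :: 'a mat) $$ (i, j)"
    using i j ij by (auto simp: kron_def)
qed (auto simp: kron_def)

lemma kron_diff_split:
  fixes A B X Y :: "'a::comm_ring_1 mat"
  assumes "A \<in> carrier_mat n n" "B \<in> carrier_mat n n" "X \<in> carrier_mat m m" "Y \<in> carrier_mat m m"
  shows "kron A X - kron B Y = kron (A - B) X + kron B (X - Y)"
  using assms by (intro eq_matI) (auto simp: kron_def div_mod_less_mult algebra_simps)

lemma kron_zero_left: "X \<in> carrier_mat p q \<Longrightarrow> kron (0\<^sub>m n m) X = (0\<^sub>m (n * p) (m * q) :: 'a::semiring_1 mat)"
  by (intro eq_matI) (auto simp: kron_def div_mod_less_mult)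

lemma kron_zero_right: "X \<in> carrier_mat p q \<Longrightarrow> kron X (0\<^sub>m n m) = (0\<^sub>m (p * n) (q * m) :: 'a::semiring_1 mat)"
  by (intro eq_matI) (auto simp: kron_def div_mod_less_mult)

lemma div_diff_mult: "r * m \<le> i \<Longrightarrow> (i - r * m) div m = i div m - (r :: nat)"
  by (cases "m = 0") (auto simp: le_iff_add)

lemma mod_diff_mult: "r * m \<le> i \<Longrightarrow> (i - r * m) mod m = i mod (m :: nat)"
  by (auto simp: le_iff_add)

lemma div_less_iff_mult: "m > 0 \<Longrightarrow> i div m < r \<longleftrightarrow> i < r * (m :: nat)"
  by (simp add: div_less_iff_less_mult)

lemma kron_four_block:
  fixes A B C E X :: "'a::semiring_1 mat"
  assumes A: "A \<in> carrier_mat r1 c1" and B: "B \<in> carrier_mat r1 c2" and C: "C \<in> carrier_mat r2 c1" and E: "E \<in> carrier_mat r2 c2"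
    and X: "X \<in> carrier_mat m m"
  shows "kron (four_block_mat A B C E) X = four_block_mat (kron A X) (kron B X) (kron C X) (kron E X)"
proof (rule eq_matI)
  fix i j
  assume "i < dim_row (four_block_mat (kron A X) (kron B X) (kron C X) (kron E X))"
    "j < dim_col (four_block_mat (kron A X) (kron B X) (kron C X) (kron E X))"
  then have i: "i < (r1 + r2) * m" and j: "j < (c1 + c2) * m" using A B C E X by (auto simp: kron_def algebra_simps)
  note ij = div_mod_less_mult[OF i] div_mod_less_mult[OF j]
  have m: "m > 0" using i by (cases m) auto
  have i2: "i - r1 * m < r2 * m" if "\<not> i < r1 * m" using i that by (auto simp: algebra_simps)
  have j2: "j - c1 * m < c2 * m" if "\<not> j < c1 * m" using j that by (auto simp: algebra_simps)
  show "kron (four_block_mat A B C E) X $$ (i, j) = four_block_mat (kron A X) (kron B X) (kron C X) (kron E X) $$ (i, j)"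
    using A B C E X i j ij i2 j2 m
    by (simp add: kron_def div_less_iff_mult div_diff_mult mod_diff_mult add_mult_distrib not_less)
qed (unfold kron_def carrier_matD[OF A] carrier_matD[OF E] carrier_matD[OF X] index_mat_four_block dim_row_mat dim_col_mat add_mult_distrib, rule refl, rule refl)

lemma similar_mat_kron:
  fixes A A' X :: "'a::comm_ring_1 mat"
  assumes "similar_mat A A'" and A: "A \<in> carrier_mat n n" and X: "X \<in> carrier_mat m m"
  shows "similar_mat (kron A X) (kron A' X)"
proof -
  obtain P Q where w: "similar_mat_wit A A' P Q" using assms(1) unfolding similar_mat_def by blast
  from similar_mat_witD2[OF A w] have PQ: "P * Q = 1\<^sub>m n" "Q * P = 1\<^sub>m n" "A = P * A' * Q"
    and c: "A' \<in> carrier_mat n n" "P \<in> carrier_mat n n" "Q \<in> carrier_mat n n" by auto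
  have "kron P (1\<^sub>m m) * kron A' X * kron Q (1\<^sub>m m) = kron (P * A' * Q) X"
    using kron_mult[of P n n A' n "1\<^sub>m m" m m X m] kron_mult[of "P * A'" n n Q n X m m "1\<^sub>m m" m] c X by simp
  then have "similar_mat_wit (kron A X) (kron A' X) (kron P (1\<^sub>m m)) (kron Q (1\<^sub>m m))"
    using c X A PQ kron_mult[of P n n Q n "1\<^sub>m m" m m "1\<^sub>m m" m] kron_mult[of Q n n P n "1\<^sub>m m" m m "1\<^sub>m m" m]
    by (intro similar_mat_witI[of _ _ "n * m"]) (simp_all add: kron_one)
  then show ?thesis unfolding similar_mat_def by blast
qed

lemma dim_gen_eigenspace_empty:
  fixes M :: "complex mat"
  assumes "M \<in> carrier_mat 0 0"
  shows "dim_gen_eigenspace M \<mu> b = 0"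
proof -
  have "kernel_dim (char_matrix M \<mu> ^\<^sub>m b) \<le> 0"
    by (rule kernel_dim_le[of _ 0 0 "0\<^sub>m 0 0"]) (use assms in auto)
  then show ?thesis by (simp add: dim_gen_eigenspace_def)
qed

text \<open>A block of size \<open>a + 2\<close> is block triangular with diagonal blocks of sizes 2 and \<open>a\<close>. Cutting it in
this way loses nothing that matters: a block of size 2 already corresponds to a step of infinite
order, and only a single block of size 1 can remain.\<close>

lemma dim_gen_eigenspace_kron_jordan_block:
  fixes X :: "complex mat"
  assumes X: "X \<in> carrier_mat D D" and l: "l \<noteq> 0" and mu: "\<mu> \<noteq> 0" and b: "b > 0"
  shows "dim_gen_eigenspace (kron (jordan_block a l) X) \<mu> b
    \<le> (a mod 2) * dim_gen_eigenspace X (\<mu> / l) b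
      + (a div 2) * (dim_gen_eigenspace X (\<mu> / l) (b + 1) + dim_gen_eigenspace X (\<mu> / l) (b - 1))"
proof (induction a rule: induct_nat_012)
  case 0
  show ?case using X by (simp add: dim_gen_eigenspace_empty kron_def)
next
  case 1
  have "kron (jordan_block 1 l) X = l \<cdot>\<^sub>m X" using X by (intro eq_matI) (auto simp: kron_def)
  then show ?case using dim_gen_eigenspace_smult[OF X l] by simp
next
  case (ge2 a)
  define Q :: "complex mat" where "Q = mat 2 a (\<lambda>(i, j). if i = 1 \<and> j = 0 then 1 else 0)"
  have Q: "Q \<in> carrier_mat 2 a" by (simp add: Q_def)
  have split: "jordan_block (Suc (Suc a)) l = four_block_mat (jordan_block 2 l) Q (0\<^sub>m a 2) (jordan_block a l)"
    by (intro eq_matI) (auto simp: Q_def)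
  have "kron (jordan_block 2 l) X = four_block_mat (l \<cdot>\<^sub>m X) X (0\<^sub>m D D) (l \<cdot>\<^sub>m X)"
  proof -
    have "jordan_block 2 l = four_block_mat (jordan_block 1 l) (1\<^sub>m 1) (0\<^sub>m 1 1) (jordan_block 1 l)"
      by (intro eq_matI) (auto simp: less_2_cases_iff)
    moreover have "kron (jordan_block 1 l) X = l \<cdot>\<^sub>m X" "kron (1\<^sub>m 1) X = X"
      using X by (auto simp: kron_def intro!: eq_matI)
    ultimately show ?thesis using X
      by (simp add: kron_four_block[of _ 1 1 _ 1 _ 1] kron_zero_left)
  qed
  then have 2: "dim_gen_eigenspace (kron (jordan_block 2 l) X) \<mu> b
      \<le> dim_gen_eigenspace X (\<mu> / l) (b + 1) + dim_gen_eigenspace X (\<mu> / l) (b - 1)"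
    using dim_gen_eigenspace_size2_block[OF X l mu b] dim_gen_eigenspace_smult[OF X l] by simp
  have "kron (jordan_block (Suc (Suc a)) l) X
      = four_block_mat (kron (jordan_block 2 l) X) (kron Q X) (0\<^sub>m (a * D) (2 * D)) (kron (jordan_block a l) X)"
    unfolding split using X Q by (simp add: kron_four_block[of _ 2 2 _ a _ a] kron_zero_left)
  then have "dim_gen_eigenspace (kron (jordan_block (Suc (Suc a)) l) X) \<mu> b
      \<le> dim_gen_eigenspace (kron (jordan_block 2 l) X) \<mu> b + dim_gen_eigenspace (kron (jordan_block a l) X) \<mu> b"
    using dim_gen_eigenspace_block_triangular[of "kron (jordan_block 2 l) X" "2 * D" "kron Q X" "a * D" "kron (jordan_block a l) X" \<mu> b]
      X Q by simp
  also have "\<dots> \<le> (dim_gen_eigenspace X (\<mu> / l) (b + 1) + dim_gen_eigenspace X (\<mu> / l) (b - 1)) +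
     ((a mod 2) * dim_gen_eigenspace X (\<mu> / l) b
      + (a div 2) * (dim_gen_eigenspace X (\<mu> / l) (b + 1) + dim_gen_eigenspace X (\<mu> / l) (b - 1)))"
    using 2 ge2(1) by (rule add_mono)
  finally show ?case by simp
qed

lemma dim_gen_eigenspace_kron_jordan_matrix:
  fixes X :: "complex mat"
  assumes X: "X \<in> carrier_mat D D" and mu: "\<mu> \<noteq> 0" and b: "b > 0"
    and nz: "\<And>a l. (a, l) \<in> set n_as \<Longrightarrow> l \<noteq> 0"
  shows "dim_gen_eigenspace (kron (jordan_matrix n_as) X) \<mu> b
    \<le> (\<Sum>(a, l)\<leftarrow>n_as. (a mod 2) * dim_gen_eigenspace X (\<mu> / l) b
      + (a div 2) * (dim_gen_eigenspace X (\<mu> / l) (b + 1) + dim_gen_eigenspace X (\<mu> / l) (b - 1)))"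
  using nz
proof (induction n_as)
  case Nil
  show ?case using X by (simp add: dim_gen_eigenspace_empty kron_def jordan_matrix_def)
next
  case (Cons al n_as)
  obtain a l where al: "al = (a, l)" by force
  let ?n = "sum_list (map fst n_as)"
  have l: "l \<noteq> 0" using Cons.prems al by auto
  have "kron (jordan_matrix (al # n_as)) X = four_block_mat (kron (jordan_block a l) X) (0\<^sub>m (a * D) (?n * D))
      (0\<^sub>m (?n * D) (a * D)) (kron (jordan_matrix n_as) X)"
    unfolding al jordan_matrix_Cons using X
    by (simp add: kron_four_block[of _ a a _ ?n _ ?n] kron_zero_left)
  then have "dim_gen_eigenspace (kron (jordan_matrix (al # n_as)) X) \<mu> b
     \<le> dim_gen_eigenspace (kron (jordan_block a l) X) \<mu> b + dim_gen_eigenspace (kron (jordan_matrix n_as) X) \<mu> b"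
    using dim_gen_eigenspace_block_triangular[of "kron (jordan_block a l) X" "a * D" "0\<^sub>m (a * D) (?n * D)" "?n * D"
      "kron (jordan_matrix n_as) X" \<mu> b] X by simp
  then show ?case using dim_gen_eigenspace_kron_jordan_block[OF X l mu b, of a] Cons al by fastforce
qed

section \<open>Rank distance of Kronecker products\<close>

lemma kernel_dim_kron_left:
  fixes A X :: "complex mat"
  assumes A: "A \<in> carrier_mat n n" and X: "X \<in> carrier_mat m m"
  shows "kernel_dim A * m \<le> kernel_dim (kron A X)"
proof -
  let ?k = "kernel_dim A"
  obtain B C where B: "B \<in> carrier_mat n ?k" and C: "C \<in> carrier_mat ?k n" and CB: "C * B = 1\<^sub>m ?k"
    and f: "\<And>v. v \<in> carrier_vec ?k \<Longrightarrow> A *\<^sub>v (B *\<^sub>v v) = 0\<^sub>v n"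
    by (rule kernel_basis_coordinates[OF A refl]) (rule that; blast)
  have AB: "A * B = 0\<^sub>m n ?k"
    by (rule mat_eq_by_mult_vec[of _ n ?k]) (use A B f in \<open>auto simp: zero_mat_mult_vec\<close>)
  have "kron A X * kron B (1\<^sub>m m) = 0\<^sub>m (n * m) (?k * m)"
    using kron_mult[OF A B X one_carrier_mat] AB X by (simp add: kron_zero_left)
  then show ?thesis
    using A B C X CB kron_mult[OF C B one_carrier_mat one_carrier_mat, of m]
    by (intro kernel_dim_ge[of _ "n * m" "n * m" "kron B (1\<^sub>m m)" _ "kron C (1\<^sub>m m)"])
      (auto simp: kron_one zero_mat_mult_vec assoc_mult_mat_vec[symmetric, of _ "n * m" "n * m" _ "?k * m"]
        simp del: assoc_mult_mat_vec)
qed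

lemma kernel_dim_kron_right:
  fixes A X :: "complex mat"
  assumes A: "A \<in> carrier_mat n n" and X: "X \<in> carrier_mat m m"
  shows "n * kernel_dim X \<le> kernel_dim (kron A X)"
proof -
  let ?k = "kernel_dim X"
  obtain B C where B: "B \<in> carrier_mat m ?k" and C: "C \<in> carrier_mat ?k m" and CB: "C * B = 1\<^sub>m ?k"
    and f: "\<And>v. v \<in> carrier_vec ?k \<Longrightarrow> X *\<^sub>v (B *\<^sub>v v) = 0\<^sub>v m"
    by (rule kernel_basis_coordinates[OF X refl]) (rule that; blast)
  have XB: "X * B = 0\<^sub>m m ?k"
    by (rule mat_eq_by_mult_vec[of _ m ?k]) (use X B f in \<open>auto simp: zero_mat_mult_vec\<close>)
  have "kron A X * kron (1\<^sub>m n) B = 0\<^sub>m (n * m) (n * ?k)"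
    using kron_mult[OF A one_carrier_mat X B] XB A by (simp add: kron_zero_right)
  then show ?thesis
    using A B C X CB kron_mult[OF one_carrier_mat one_carrier_mat C B, of n]
    by (intro kernel_dim_ge[of _ "n * m" "n * m" "kron (1\<^sub>m n) B" _ "kron (1\<^sub>m n) C"])
      (auto simp: kron_one zero_mat_mult_vec assoc_mult_mat_vec[symmetric, of _ "n * m" "n * m" _ "n * ?k"]
        simp del: assoc_mult_mat_vec)
qed

lemma rank_dist_kernel_dim:
  fixes A B :: "complex mat"
  assumes "A \<in> carrier_mat d d" "B \<in> carrier_mat d d" "d > 0"
  shows "rank_dist d A B = 1 - real (kernel_dim (A - B)) / real d"
proof -
  have "A - B \<in> carrier_mat d d" using assms by auto
  from rank_plus_kernel_dim[OF this] show ?thesis using assms(3)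
    by (simp add: rank_dist_def field_simps flip: of_nat_add)
qed

text \<open>The two factors are exchanged one at a time, using
\<open>A \<otimes> X - B \<otimes> Y = (A - B) \<otimes> X + B \<otimes> (X - Y)\<close>.\<close>

lemma rank_dist_kron:
  fixes A B X Y :: "complex mat"
  assumes A: "A \<in> carrier_mat n n" and B: "B \<in> carrier_mat n n"
    and X: "X \<in> carrier_mat m m" and Y: "Y \<in> carrier_mat m m" and n: "n > 0" and m: "m > 0"
  shows "rank_dist (n * m) (kron A X) (kron B Y) \<le> rank_dist n A B + rank_dist m X Y"
proof -
  have AB: "A - B \<in> carrier_mat n n" and XY: "X - Y \<in> carrier_mat m m" using A B X Y by auto
  have c: "kron (A - B) X \<in> carrier_mat (n * m) (n * m)" "kron B (X - Y) \<in> carrier_mat (n * m) (n * m)"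
    using AB XY B X by auto
  let ?r = "vec_space.rank :: nat \<Rightarrow> complex mat \<Rightarrow> nat"
  have "?r (n * m) (kron A X - kron B Y) \<le> ?r (n * m) (kron (A - B) X) + ?r (n * m) (kron B (X - Y))"
    unfolding kron_diff_split[OF A B X Y] by (rule vec_space.rank_subadditive[OF c])
  moreover have "?r (n * m) (kron (A - B) X) \<le> ?r n (A - B) * m"
    using rank_plus_kernel_dim[OF c(1)] rank_plus_kernel_dim[OF AB] kernel_dim_kron_left[OF AB X]
    by (smt (verit) add_le_cancel_left add_mult_distrib le_trans nat_add_left_cancel_le add.commute)
  moreover have "?r (n * m) (kron B (X - Y)) \<le> n * ?r m (X - Y)"
    using rank_plus_kernel_dim[OF c(2)] rank_plus_kernel_dim[OF XY] kernel_dim_kron_right[OF B XY]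
    by (smt (verit) add_le_cancel_left add_mult_distrib2 le_trans nat_add_left_cancel_le add.commute)
  ultimately have "?r (n * m) (kron A X - kron B Y) \<le> ?r n (A - B) * m + n * ?r m (X - Y)" by linarith
  then have "real (?r (n * m) (kron A X - kron B Y)) \<le> real (?r n (A - B) * m + n * ?r m (X - Y))"
    unfolding of_nat_le_iff .
  then show ?thesis unfolding rank_dist_def using n m by (simp add: field_simps)
qed

section \<open>Decay of lazy random walks\<close>

definition fin_supp :: "('s \<Rightarrow> real) \<Rightarrow> bool" where
  "fin_supp f \<longleftrightarrow> finite {z. f z \<noteq> 0}"

lemma fin_supp_subset:
  assumes "fin_supp f" "\<And>z. g z \<noteq> 0 \<Longrightarrow> f z \<noteq> 0"
  shows "fin_supp g"
proof -
  have "{z. g z \<noteq> 0} \<subseteq> {z. f z \<noteq> 0}" using assms(2) by blast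
  then show ?thesis using assms(1) unfolding fin_supp_def by (rule finite_subset)
qed

lemma fin_supp_add:
  assumes "fin_supp f" "fin_supp g"
  shows "fin_supp (\<lambda>z. f z + g z)"
proof -
  have "{z. f z + g z \<noteq> 0} \<subseteq> {z. f z \<noteq> 0} \<union> {z. g z \<noteq> 0}" by auto
  then show ?thesis using assms unfolding fin_supp_def by (meson finite_UnI finite_subset)
qed

lemma fin_supp_mult: "fin_supp f \<Longrightarrow> fin_supp (\<lambda>z. f z * g z)"
  by (erule fin_supp_subset) simp

lemma fin_supp_cmult: "fin_supp f \<Longrightarrow> fin_supp (\<lambda>z. c * f z)"
  by (erule fin_supp_subset) simp

lemma fin_supp_square: "fin_supp f \<Longrightarrow> fin_supp (\<lambda>z. (f z)\<^sup>2)"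
  by (erule fin_supp_subset) simp

lemma fin_supp_diff:
  assumes "fin_supp f" "fin_supp g"
  shows "fin_supp (\<lambda>z. f z - g z)"
proof -
  have "{z. f z - g z \<noteq> 0} \<subseteq> {z. f z \<noteq> 0} \<union> {z. g z \<noteq> 0}" by auto
  then show ?thesis using assms unfolding fin_supp_def by (meson finite_UnI finite_subset)
qed

lemma fin_supp_zero: "fin_supp (\<lambda>z. 0)"
  by (simp add: fin_supp_def)

lemma fin_supp_sum: "finite I \<Longrightarrow> (\<And>i. i \<in> I \<Longrightarrow> fin_supp (f i)) \<Longrightarrow> fin_supp (\<lambda>z. \<Sum>i\<in>I. f i z)"
  by (induction I rule: finite_induct) (auto intro: fin_supp_add fin_supp_zero)

lemma fin_supp_bij:
  assumes "fin_supp f" "bij \<tau>"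
  shows "fin_supp (\<lambda>z. f (\<tau> z))"
proof -
  have *: "{z. f (\<tau> z) \<noteq> 0} = \<tau> -` {z. f z \<noteq> 0}" by auto
  show ?thesis using assms unfolding fin_supp_def * by (intro finite_vimageI bij_is_inj)
qed

lemma Sum_any_superset:
  "finite A \<Longrightarrow> {z. f z \<noteq> 0} \<subseteq> A \<Longrightarrow> Sum_any f = sum f A"
  by (rule Sum_any.expand_superset)

lemma Sum_any_add:
  fixes f g :: "'s \<Rightarrow> real"
  shows "fin_supp f \<Longrightarrow> fin_supp g \<Longrightarrow> Sum_any (\<lambda>z. f z + g z) = Sum_any f + Sum_any g"
  unfolding fin_supp_def by (rule Sum_any.distrib)

lemma Sum_any_mono:
  fixes f g :: "'s \<Rightarrow> real"
  assumes "fin_supp f" "fin_supp g" "\<And>z. f z \<le> g z"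
  shows "Sum_any f \<le> Sum_any g"
proof -
  let ?A = "{z. f z \<noteq> 0} \<union> {z. g z \<noteq> 0}"
  have "finite ?A" using assms by (simp add: fin_supp_def)
  then have "Sum_any f = sum f ?A" "Sum_any g = sum g ?A"
    by (auto intro!: Sum_any_superset)
  then show ?thesis using assms(3) by (simp add: sum_mono)
qed

lemma Sum_any_sum:
  fixes f :: "'i \<Rightarrow> 's \<Rightarrow> real"
  assumes "finite I" "\<And>i. i \<in> I \<Longrightarrow> fin_supp (f i)"
  shows "Sum_any (\<lambda>z. \<Sum>i\<in>I. f i z) = (\<Sum>i\<in>I. Sum_any (f i))"
  using assms
proof (induction I rule: finite_induct)
  case (insert i I)
  then show ?case
    using Sum_any_add[of "f i" "\<lambda>z. \<Sum>i\<in>I. f i z"] fin_supp_sum[of I f] by simp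
qed simp

lemma Sum_any_cmult: "fin_supp f \<Longrightarrow> Sum_any (\<lambda>z. c * f z) = c * Sum_any f"
  unfolding fin_supp_def by (rule Sum_any_right_distrib[symmetric])

lemma Sum_any_cmult_sum:
  fixes f :: "'i \<Rightarrow> 's \<Rightarrow> real"
  assumes "finite I" "\<And>i. i \<in> I \<Longrightarrow> fin_supp (f i)"
  shows "Sum_any (\<lambda>z. c * (\<Sum>i\<in>I. f i z)) = c * (\<Sum>i\<in>I. Sum_any (f i))"
  by (simp only: Sum_any_cmult[OF fin_supp_sum[OF assms]] Sum_any_sum[OF assms])

lemma Sum_any_bij:
  fixes f :: "'s \<Rightarrow> real"
  assumes "bij \<tau>"
  shows "Sum_any (\<lambda>z. f (\<tau> z)) = Sum_any f"
  using Sum_any.reindex_cong[OF assms, of f "\<lambda>z. f (\<tau> z)"] unfolding comp_def by simp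

lemma sum_power2_le_card:
  fixes a :: "nat \<Rightarrow> real"
  shows "(\<Sum>i<n. a i)\<^sup>2 \<le> real n * (\<Sum>i<n. (a i)\<^sup>2)"
proof -
  have "0 \<le> (\<Sum>i<n. \<Sum>j<n. (a i - a j)\<^sup>2)" by (intro sum_nonneg) auto
  also have "\<dots> = (\<Sum>i<n. \<Sum>j<n. (a i)\<^sup>2) + (\<Sum>i<n. \<Sum>j<n. (a j)\<^sup>2) - (\<Sum>i<n. \<Sum>j<n. 2 * (a i * a j))"
    by (simp only: power2_diff sum.distrib sum_subtractf mult.assoc)
  also have "(\<Sum>i<n. \<Sum>j<n. 2 * (a i * a j)) = 2 * (\<Sum>i<n. a i)\<^sup>2"
    by (simp only: power2_eq_square sum_product) (simp only: sum_distrib_left)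
  also have "(\<Sum>i<n. \<Sum>j<n. (a i)\<^sup>2) = real n * (\<Sum>i<n. (a i)\<^sup>2)"
    by (simp add: sum_distrib_left)
  also have "(\<Sum>i<n. \<Sum>j<n. (a j)\<^sup>2) = real n * (\<Sum>i<n. (a i)\<^sup>2)"
    by simp
  finally show ?thesis by simp
qed

lemma dirichlet_form:
  fixes p :: "'s \<Rightarrow> real"
  assumes "fin_supp p" "bij \<tau>"
  shows "Sum_any (\<lambda>z. (p z - p (\<tau> z))\<^sup>2) = 2 * (Sum_any (\<lambda>z. (p z)\<^sup>2) - Sum_any (\<lambda>z. p z * p (\<tau> z)))"
proof -
  have f: "fin_supp (\<lambda>z. (p z)\<^sup>2)" "fin_supp (\<lambda>z. (p (\<tau> z))\<^sup>2)" "fin_supp (\<lambda>z. (-2) * (p z * p (\<tau> z)))"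
    using fin_supp_square[OF fin_supp_bij[OF assms]]
    by (simp_all only: fin_supp_square fin_supp_mult fin_supp_cmult assms(1))
  have "Sum_any (\<lambda>z. (p z - p (\<tau> z))\<^sup>2) = Sum_any (\<lambda>z. (p z)\<^sup>2 + ((p (\<tau> z))\<^sup>2 + (-2) * (p z * p (\<tau> z))))"
    by (intro Sum_any.cong) (simp add: power2_diff)
  also have "\<dots> = Sum_any (\<lambda>z. (p z)\<^sup>2) + (Sum_any (\<lambda>z. (p (\<tau> z))\<^sup>2) + Sum_any (\<lambda>z. (-2) * (p z * p (\<tau> z))))"
    using f by (simp only: Sum_any_add fin_supp_add)
  also have "Sum_any (\<lambda>z. (p (\<tau> z))\<^sup>2) = Sum_any (\<lambda>z. (p z)\<^sup>2)"
    using Sum_any_bij[OF assms(2), of "\<lambda>z. (p z)\<^sup>2"] .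
  also have "Sum_any (\<lambda>z. (-2) * (p z * p (\<tau> z))) = (-2) * Sum_any (\<lambda>z. p z * p (\<tau> z))"
    using assms by (intro Sum_any_cmult fin_supp_mult)
  finally show ?thesis by simp
qed

lemma shift_correlation_le_energy:
  fixes p :: "'s \<Rightarrow> real"
  assumes "fin_supp p" "bij \<tau>"
  shows "Sum_any (\<lambda>z. p z * p (\<tau> z)) \<le> Sum_any (\<lambda>z. (p z)\<^sup>2)"
proof -
  have "fin_supp (\<lambda>z. p z - p (\<tau> z))"
    by (intro fin_supp_diff fin_supp_bij[OF assms] assms)
  then have "Sum_any (\<lambda>z::'s. 0) \<le> Sum_any (\<lambda>z. (p z - p (\<tau> z))\<^sup>2)"
    by (intro Sum_any_mono fin_supp_square fin_supp_zero) simp_all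
  then show ?thesis using dirichlet_form[OF assms] by simp
qed

text \<open>The difference of \<open>p\<close> and its \<open>j\<close>-th shift telescopes into \<open>j\<close> differences, each of which has the
same sum of squares because \<open>\<tau>\<close> is a bijection; Cauchy-Schwarz costs a factor \<open>j\<close>.\<close>

lemma dirichlet_form_iterate:
  fixes p :: "'s \<Rightarrow> real"
  assumes p: "fin_supp p" and \<tau>: "bij \<tau>"
  shows "Sum_any (\<lambda>z. (p z)\<^sup>2) - Sum_any (\<lambda>z. p z * p ((\<tau> ^^ j) z))
    \<le> real j ^ 2 * (Sum_any (\<lambda>z. (p z)\<^sup>2) - Sum_any (\<lambda>z. p z * p (\<tau> z)))"
proof -
  have bij: "bij (\<tau> ^^ i)" for i using \<tau> by (simp add: bij_fn)
  let ?D = "\<lambda>z. p z - p (\<tau> z)"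
  have fD: "fin_supp ?D" by (intro fin_supp_diff fin_supp_bij[OF p \<tau>] p)
  have fDi: "fin_supp (\<lambda>z. (?D ((\<tau> ^^ i) z))\<^sup>2)" for i
    by (intro fin_supp_square fin_supp_bij[OF fD bij])
  have fj: "fin_supp (\<lambda>z. p z - p ((\<tau> ^^ j) z))"
    by (intro fin_supp_diff fin_supp_bij[OF p bij] p)
  have tel: "p z - p ((\<tau> ^^ j) z) = (\<Sum>i<j. ?D ((\<tau> ^^ i) z))" for z
    using sum_lessThan_telescope'[of "\<lambda>i. p ((\<tau> ^^ i) z)" j] by simp
  have "Sum_any (\<lambda>z. (p z - p ((\<tau> ^^ j) z))\<^sup>2) \<le> Sum_any (\<lambda>z. real j * (\<Sum>i<j. (?D ((\<tau> ^^ i) z))\<^sup>2))"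
    by (intro Sum_any_mono fin_supp_square[OF fj] fin_supp_cmult fin_supp_sum fDi finite_lessThan)
      (simp only: tel sum_power2_le_card)
  also have "\<dots> = real j * (\<Sum>i<j. Sum_any (\<lambda>z. (?D ((\<tau> ^^ i) z))\<^sup>2))"
    using fDi by (simp only: Sum_any_cmult fin_supp_sum Sum_any_sum finite_lessThan)
  also have "\<dots> = real j * (\<Sum>i<j. Sum_any (\<lambda>z. (?D z)\<^sup>2))"
    using Sum_any_bij[OF bij, of "\<lambda>z. (?D z)\<^sup>2"] by simp
  finally have "2 * (Sum_any (\<lambda>z. (p z)\<^sup>2) - Sum_any (\<lambda>z. p z * p ((\<tau> ^^ j) z)))
      \<le> real j * (real j * (2 * (Sum_any (\<lambda>z. (p z)\<^sup>2) - Sum_any (\<lambda>z. p z * p (\<tau> z)))))"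
    unfolding dirichlet_form[OF p \<tau>] dirichlet_form[OF p bij] by simp
  moreover have "x \<le> real j ^ 2 * y" if "2 * x \<le> real j * (real j * (2 * y))" for x y :: real
    using that by (simp add: power2_eq_square)
  ultimately show ?thesis by blast
qed

text \<open>A distribution that is almost invariant under \<open>\<tau>\<close> is almost invariant under the first \<open>k\<close> powers
of \<open>\<tau>\<close>, hence correlated with all these shifts. But if the first \<open>k\<close> points of each orbit are
distinct, the shifts of \<open>p\<close> add up to at most the total mass at any point, so that the sum of the
correlations is at most the square of the mass. Therefore an energy (sum of squares) above \<open>mass\<^sup>2 / k\<close> forces a
definite loss of correlation between \<open>p\<close> and its shift.\<close>

lemma energy_drop:
  fixes p :: "'s \<Rightarrow> real"
  assumes p: "fin_supp p" and nonneg: "\<And>z. p z \<ge> 0" and \<tau>: "bij \<tau>"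
    and inj: "\<And>z. p z \<noteq> 0 \<Longrightarrow> inj_on (\<lambda>j. (\<tau> ^^ j) z) {..<k}"
  shows "real k * Sum_any (\<lambda>z. (p z)\<^sup>2) - (Sum_any p)\<^sup>2
    \<le> real k ^ 3 * (Sum_any (\<lambda>z. (p z)\<^sup>2) - Sum_any (\<lambda>z. p z * p (\<tau> z)))"
proof -
  let ?E = "Sum_any (\<lambda>z. (p z)\<^sup>2)" and ?c = "\<lambda>j. Sum_any (\<lambda>z. p z * p ((\<tau> ^^ j) z))"
  let ?B = "?E - Sum_any (\<lambda>z. p z * p (\<tau> z))"
  have B: "?B \<ge> 0" using shift_correlation_le_energy[OF p \<tau>] by simp
  have bij: "bij (\<tau> ^^ i)" for i using \<tau> by (simp add: bij_fn)
  have "(\<Sum>j<k. ?E - ?c j) \<le> (\<Sum>j<k. real k ^ 2 * ?B)"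
  proof (rule sum_mono)
    fix j assume "j \<in> {..<k}"
    then have "real j ^ 2 * ?B \<le> real k ^ 2 * ?B" using B by (intro mult_right_mono power_mono) auto
    then show "?E - ?c j \<le> real k ^ 2 * ?B" using dirichlet_form_iterate[OF p \<tau>, of j] by linarith
  qed
  then have 1: "real k * ?E - real k ^ 3 * ?B \<le> (\<Sum>j<k. ?c j)"
    by (simp add: sum_subtractf power3_eq_cube power2_eq_square)
  have "(\<Sum>j<k. ?c j) = Sum_any (\<lambda>z. \<Sum>j<k. p z * p ((\<tau> ^^ j) z))"
    using p by (simp only: Sum_any_sum fin_supp_mult finite_lessThan)
  also have "\<dots> \<le> Sum_any (\<lambda>z. p z * Sum_any p)"
  proof (rule Sum_any_mono)
    fix z
    show "(\<Sum>j<k. p z * p ((\<tau> ^^ j) z)) \<le> p z * Sum_any p"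
    proof (cases "p z = 0")
      case False
      have "(\<Sum>j<k. p ((\<tau> ^^ j) z)) = sum p ((\<lambda>j. (\<tau> ^^ j) z) ` {..<k})"
        using inj[OF False] by (simp add: sum.reindex)
      also have "\<dots> \<le> sum p ((\<lambda>j. (\<tau> ^^ j) z) ` {..<k} \<union> {z. p z \<noteq> 0})"
        using p nonneg by (intro sum_mono2) (auto simp: fin_supp_def)
      also have "\<dots> = Sum_any p" using p by (intro Sum_any_superset[symmetric]) (auto simp: fin_supp_def)
      finally show ?thesis using nonneg[of z] by (simp add: sum_distrib_left[symmetric] mult_left_mono)
    qed simp
  qed (intro fin_supp_sum fin_supp_mult p finite_lessThan)+
  also have "\<dots> = (Sum_any p)\<^sup>2"
    using Sum_any_left_distrib[of p "Sum_any p"] p by (simp only: fin_supp_def power2_eq_square)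
  finally show ?thesis using 1 by (simp add: algebra_simps)
qed

text \<open>One averaging step: stay with probability \<open>1/2\<close>, otherwise apply a random element of the list.
The list may contain repetitions, which encode multiplicities.\<close>

definition lazy_step :: "('s \<Rightarrow> 's) list \<Rightarrow> ('s \<Rightarrow> real) \<Rightarrow> 's \<Rightarrow> real" where
  "lazy_step \<tau>s u x = (u x + (\<Sum>\<tau>\<leftarrow>\<tau>s. u (\<tau> x)) / real (length \<tau>s)) / 2"

lemma lazy_step_alt:
  assumes "\<tau>s \<noteq> []"
  shows "lazy_step \<tau>s u x = (1 / (2 * real (length \<tau>s))) * (\<Sum>i<length \<tau>s. u x + u ((\<tau>s ! i) x))"
  using assms by (simp add: lazy_step_def sum_list_sum_nth atLeast0LessThan sum.distrib field_simps)

lemma lazy_step_fin_supp: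
  assumes "fin_supp p" "\<And>\<tau>. \<tau> \<in> set \<tau>s \<Longrightarrow> bij \<tau>" "\<tau>s \<noteq> []"
  shows "fin_supp (lazy_step \<tau>s p)"
proof -
  have "fin_supp (\<lambda>x. (1 / (2 * real (length \<tau>s))) * (\<Sum>i<length \<tau>s. p x + p ((\<tau>s ! i) x)))"
  proof (intro fin_supp_cmult fin_supp_sum finite_lessThan)
    fix i assume "i \<in> {..<length \<tau>s}"
    then have "bij (\<tau>s ! i)" using assms(2) by simp
    then show "fin_supp (\<lambda>x. p x + p ((\<tau>s ! i) x))" by (intro fin_supp_add assms(1) fin_supp_bij[OF assms(1)])
  qed
  moreover have "lazy_step \<tau>s p = (\<lambda>x. (1 / (2 * real (length \<tau>s))) * (\<Sum>i<length \<tau>s. p x + p ((\<tau>s ! i) x)))"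
    by (rule ext) (rule lazy_step_alt[OF assms(3)])
  ultimately show ?thesis by (simp only:)
qed

lemma lazy_step_sum:
  assumes p: "fin_supp p" and \<tau>s: "\<And>\<tau>. \<tau> \<in> set \<tau>s \<Longrightarrow> bij \<tau>" and ne: "\<tau>s \<noteq> []"
  shows "Sum_any (lazy_step \<tau>s p) = Sum_any p"
proof -
  let ?N = "length \<tau>s"
  have b: "bij (\<tau>s ! i)" if "i < ?N" for i using that \<tau>s by simp
  have fi: "fin_supp (\<lambda>x. p x + p ((\<tau>s ! i) x))" if "i < ?N" for i
    by (intro fin_supp_add fin_supp_bij[OF p b[OF that]] p)
  have "Sum_any (lazy_step \<tau>s p) = (1 / (2 * real ?N)) * (\<Sum>i<?N. Sum_any (\<lambda>x. p x + p ((\<tau>s ! i) x)))"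
    unfolding lazy_step_alt[OF ne, abs_def] by (rule Sum_any_cmult_sum) (auto intro: fi)
  also have "(\<Sum>i<?N. Sum_any (\<lambda>x. p x + p ((\<tau>s ! i) x))) = (\<Sum>i<?N. 2 * Sum_any p)"
  proof (rule sum.cong[OF refl])
    fix i assume "i \<in> {..<?N}"
    then have i: "i < ?N" by simp
    show "Sum_any (\<lambda>x. p x + p ((\<tau>s ! i) x)) = 2 * Sum_any p"
      using Sum_any_add[OF p fin_supp_bij[OF p b[OF i]]] Sum_any_bij[OF b[OF i], of p] by simp
  qed
  finally show ?thesis using ne by simp
qed

text \<open>By convexity, averaging \<open>(p + p \<circ> \<tau>) / 2\<close> over \<open>\<tau>\<close> loses at least the average of what each of these
functions loses, and that is half the gap between energy and correlation.\<close>

lemma lazy_step_energy: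
  assumes p: "fin_supp p" and \<tau>s: "\<And>\<tau>. \<tau> \<in> set \<tau>s \<Longrightarrow> bij \<tau>" and ne: "\<tau>s \<noteq> []"
  shows "Sum_any (\<lambda>z. (lazy_step \<tau>s p z)\<^sup>2) \<le> Sum_any (\<lambda>z. (p z)\<^sup>2)
    - (\<Sum>i<length \<tau>s. Sum_any (\<lambda>z. (p z)\<^sup>2) - Sum_any (\<lambda>z. p z * p ((\<tau>s ! i) z))) / (2 * real (length \<tau>s))"
proof -
  let ?N = "length \<tau>s" and ?E = "Sum_any (\<lambda>z. (p z)\<^sup>2)"
  let ?c = "\<lambda>i. Sum_any (\<lambda>z. p z * p ((\<tau>s ! i) z))"
  have N: "?N > 0" using ne by simp
  have b: "bij (\<tau>s ! i)" if "i < ?N" for i using that \<tau>s by simp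
  have fi: "fin_supp (\<lambda>x. (p x + p ((\<tau>s ! i) x))\<^sup>2)" if "i < ?N" for i
    by (intro fin_supp_square fin_supp_add fin_supp_bij[OF p b[OF that]] p)
  have "Sum_any (\<lambda>z. (lazy_step \<tau>s p z)\<^sup>2) \<le> Sum_any (\<lambda>z. (1 / (4 * real ?N)) * (\<Sum>i<?N. (p z + p ((\<tau>s ! i) z))\<^sup>2))"
  proof (rule Sum_any_mono)
    fix z
    have "(lazy_step \<tau>s p z)\<^sup>2 = (1 / (2 * real ?N))\<^sup>2 * (\<Sum>i<?N. p z + p ((\<tau>s ! i) z))\<^sup>2"
      by (simp only: lazy_step_alt[OF ne] power_mult_distrib)
    also have "\<dots> \<le> (1 / (2 * real ?N))\<^sup>2 * (real ?N * (\<Sum>i<?N. (p z + p ((\<tau>s ! i) z))\<^sup>2))"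
      by (intro mult_left_mono sum_power2_le_card) auto
    also have "\<dots> = (1 / (4 * real ?N)) * (\<Sum>i<?N. (p z + p ((\<tau>s ! i) z))\<^sup>2)"
      using N by (simp add: power2_eq_square)
    finally show "(lazy_step \<tau>s p z)\<^sup>2 \<le> (1 / (4 * real ?N)) * (\<Sum>i<?N. (p z + p ((\<tau>s ! i) z))\<^sup>2)" .
  next
    show "fin_supp (\<lambda>z. (1 / (4 * real ?N)) * (\<Sum>i<?N. (p z + p ((\<tau>s ! i) z))\<^sup>2))"
      by (intro fin_supp_cmult fin_supp_sum finite_lessThan fi) simp
  qed (intro fin_supp_square lazy_step_fin_supp p \<tau>s ne)
  also have "\<dots> = (1 / (4 * real ?N)) * (\<Sum>i<?N. Sum_any (\<lambda>z. (p z + p ((\<tau>s ! i) z))\<^sup>2))"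
    by (rule Sum_any_cmult_sum) (auto intro: fi)
  also have "(\<Sum>i<?N. Sum_any (\<lambda>z. (p z + p ((\<tau>s ! i) z))\<^sup>2)) = (\<Sum>i<?N. 4 * ?E - 2 * (?E - ?c i))"
  proof (rule sum.cong[OF refl])
    fix i assume "i \<in> {..<?N}"
    then have i: "i < ?N" by simp
    have f: "fin_supp (\<lambda>z. (p z)\<^sup>2)" "fin_supp (\<lambda>z. (p ((\<tau>s ! i) z))\<^sup>2)" "fin_supp (\<lambda>z. 2 * (p z * p ((\<tau>s ! i) z)))"
      using fin_supp_square[OF fin_supp_bij[OF p b[OF i]]]
      by (simp_all only: fin_supp_square fin_supp_mult fin_supp_cmult p)
    have "Sum_any (\<lambda>z. (p z + p ((\<tau>s ! i) z))\<^sup>2) = Sum_any (\<lambda>z. (p z)\<^sup>2 + ((p ((\<tau>s ! i) z))\<^sup>2 + 2 * (p z * p ((\<tau>s ! i) z))))"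
      by (intro Sum_any.cong) (simp add: power2_sum)
    also have "\<dots> = ?E + (Sum_any (\<lambda>z. (p ((\<tau>s ! i) z))\<^sup>2) + Sum_any (\<lambda>z. 2 * (p z * p ((\<tau>s ! i) z))))"
      using f by (simp only: Sum_any_add fin_supp_add)
    also have "Sum_any (\<lambda>z. (p ((\<tau>s ! i) z))\<^sup>2) = ?E"
      using Sum_any_bij[OF b[OF i], of "\<lambda>z. (p z)\<^sup>2"] .
    also have "Sum_any (\<lambda>z. 2 * (p z * p ((\<tau>s ! i) z))) = 2 * ?c i"
      using p by (intro Sum_any_cmult fin_supp_mult)
    finally show "Sum_any (\<lambda>z. (p z + p ((\<tau>s ! i) z))\<^sup>2) = 4 * ?E - 2 * (?E - ?c i)" by simp
  qed
  also have "(\<Sum>i<?N. 4 * ?E - 2 * (?E - ?c i)) = 4 * real ?N * ?E - 2 * (\<Sum>i<?N. ?E - ?c i)"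
    by (simp only: sum_subtractf sum_distrib_left[symmetric] sum_constant card_lessThan)
  finally show ?thesis using N by (simp add: field_simps)
qed

text \<open>The excess of the energy over \<open>mass\<^sup>2 / k\<close> is multiplied by at most \<open>1 - c / (2 k\<^sup>2)\<close> in each step, by
\<open>energy_drop\<close> applied to the proportion \<open>c\<close> of good steps. Distinctness of orbit points is asked
for only on a set \<open>V\<close> that carries the distribution: below, these are the points with nonzero
first coordinate.\<close>

lemma lazy_walk_energy_decay:
  fixes p :: "'s \<Rightarrow> real"
  assumes p: "fin_supp p" and nonneg: "\<And>z. p z \<ge> 0"
    and \<tau>s: "\<And>\<tau>. \<tau> \<in> set \<tau>s \<Longrightarrow> bij \<tau>" and ne: "\<tau>s \<noteq> []" and k: "k > 0"
    and supp: "\<And>z. p z \<noteq> 0 \<Longrightarrow> z \<in> V"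
    and V: "\<And>\<tau> z. \<tau> \<in> set \<tau>s \<Longrightarrow> \<tau> z \<in> V \<Longrightarrow> z \<in> V"
    and good: "\<And>\<tau> z. \<tau> \<in> set \<tau>s \<Longrightarrow> good \<tau> \<Longrightarrow> z \<in> V \<Longrightarrow> inj_on (\<lambda>j. (\<tau> ^^ j) z) {..<k}"
    and c: "c * real (length \<tau>s) \<le> real (length (filter good \<tau>s))" "0 \<le> c"
  shows "Sum_any (\<lambda>z. ((lazy_step \<tau>s ^^ n) p z)\<^sup>2) \<le> (Sum_any p)\<^sup>2 / real k
    + Sum_any (\<lambda>z. (p z)\<^sup>2) * (1 - c / (2 * real k ^ 2)) ^ n
    \<and> fin_supp ((lazy_step \<tau>s ^^ n) p) \<and> Sum_any ((lazy_step \<tau>s ^^ n) p) = Sum_any p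
    \<and> (\<forall>z. (lazy_step \<tau>s ^^ n) p z \<ge> 0) \<and> (\<forall>z. (lazy_step \<tau>s ^^ n) p z \<noteq> 0 \<longrightarrow> z \<in> V)"
proof (induction n)
  case 0
  have "0 \<le> (Sum_any p)\<^sup>2 / real k" by simp
  then show ?case using p nonneg supp by simp
next
  case (Suc n)
  let ?N = "length \<tau>s"
  define q where "q = (lazy_step \<tau>s ^^ n) p"
  define r where "r = 1 - c / (2 * real k ^ 2)"
  define m where "m = Sum_any p"
  define E where "E = Sum_any (\<lambda>z. (q z)\<^sup>2)"
  define E0 where "E0 = Sum_any (\<lambda>z. (p z)\<^sup>2)"
  have N: "?N > 0" using ne by simp
  from Suc have IH: "E \<le> m\<^sup>2 / real k + E0 * r ^ n" and fq: "fin_supp q" and mq: "Sum_any q = m"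
    and nq: "\<And>z. q z \<ge> 0" and sq: "\<And>z. q z \<noteq> 0 \<Longrightarrow> z \<in> V"
    by (auto simp: q_def r_def m_def E_def E0_def)
  have E0: "E0 \<ge> 0" unfolding E0_def
    using Sum_any_mono[OF fin_supp_zero fin_supp_square[OF p]] by simp
  have c1: "c \<le> 1"
  proof -
    have "c * real ?N \<le> 1 * real ?N" using c(1) length_filter_le[of good \<tau>s] by linarith
    then show ?thesis using N by (simp only: mult_le_cancel_right of_nat_0_less_iff)
  qed
  have k2: "real k ^ 2 \<ge> 1" using k by simp
  have "c / (2 * real k ^ 2) \<le> 1"
    using k2 c1 c(2) by (simp add: divide_le_eq)
  then have r: "0 \<le> r" "r \<le> 1" using c(2) k2 by (auto simp: r_def)
  have nn: "lazy_step \<tau>s q z \<ge> 0" for z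
    unfolding lazy_step_def using nq by (intro divide_nonneg_nonneg add_nonneg_nonneg sum_list_nonneg) auto
  have ss: "z \<in> V" if "lazy_step \<tau>s q z \<noteq> 0" for z
  proof (rule ccontr)
    assume z: "z \<notin> V"
    then have "q z = 0" "\<And>\<tau>. \<tau> \<in> set \<tau>s \<Longrightarrow> q (\<tau> z) = 0" using sq V by blast+
    then have "(\<Sum>\<tau>\<leftarrow>\<tau>s. q (\<tau> z)) = (\<Sum>\<tau>\<leftarrow>\<tau>s. 0)" by (intro arg_cong[of _ _ sum_list] map_cong) auto
    then show False using that \<open>q z = 0\<close> by (simp add: lazy_step_def)
  qed
  let ?B = "\<lambda>i. E - Sum_any (\<lambda>z. q z * q ((\<tau>s ! i) z))"
  define x where "x = E - m\<^sup>2 / real k"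
  have B0: "?B i \<ge> 0" if "i < ?N" for i
    using shift_correlation_le_energy[OF fq, of "\<tau>s ! i"] \<tau>s that by (simp add: E_def)
  have Bg: "x / real k ^ 2 \<le> ?B i" if i: "i < ?N" and g: "good (\<tau>s ! i)" for i
  proof -
    have "real k * E - m\<^sup>2 \<le> real k ^ 3 * ?B i"
      unfolding E_def mq[symmetric]
      using i g \<tau>s good sq by (intro energy_drop[OF fq nq]) auto
    then have "(real k * E - m\<^sup>2) / real k ^ 3 \<le> ?B i" using k by (simp add: divide_le_eq mult.commute)
    moreover have "(real k * E - m\<^sup>2) / real k ^ 3 = x / real k ^ 2"
      using k by (simp add: x_def power3_eq_cube power2_eq_square field_simps)
    ultimately show ?thesis by simp
  qed
  define G where "G = {i. i < ?N \<and> good (\<tau>s ! i)}"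
  have cG: "card G = length (filter good \<tau>s)" by (simp add: G_def length_filter_conv_card)
  have E': "Sum_any (\<lambda>z. (lazy_step \<tau>s q z)\<^sup>2) \<le> E - (\<Sum>i<?N. ?B i) / (2 * real ?N)"
    unfolding E_def by (rule lazy_step_energy[OF fq \<tau>s ne])
  have "Sum_any (\<lambda>z. (lazy_step \<tau>s q z)\<^sup>2) \<le> m\<^sup>2 / real k + E0 * r ^ Suc n"
  proof (cases "x \<ge> 0")
    case True
    have "(\<Sum>i<?N. ?B i) \<ge> (\<Sum>i\<in>G. ?B i)"
      using B0 by (intro sum_mono2) (auto simp: G_def)
    moreover have "(\<Sum>i\<in>G. ?B i) \<ge> (\<Sum>i\<in>G. x / real k ^ 2)"
      using Bg by (intro sum_mono) (auto simp: G_def)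
    moreover have "(\<Sum>i\<in>G. x / real k ^ 2) = real (card G) * (x / real k ^ 2)" by simp
    moreover have "real (card G) * (x / real k ^ 2) \<ge> c * real ?N * (x / real k ^ 2)"
      using c(1) True unfolding cG by (intro mult_right_mono) auto
    ultimately have "(\<Sum>i<?N. ?B i) / (2 * real ?N) \<ge> c * real ?N * (x / real k ^ 2) / (2 * real ?N)"
      by (intro divide_right_mono) linarith+
    then have "(\<Sum>i<?N. ?B i) / (2 * real ?N) \<ge> c / (2 * real k ^ 2) * x"
      using N by simp
    then have "Sum_any (\<lambda>z. (lazy_step \<tau>s q z)\<^sup>2) \<le> m\<^sup>2 / real k + r * x"
      using E' by (simp add: r_def x_def algebra_simps)
    moreover have "r * x \<le> r * (E0 * r ^ n)"
      using IH r(1) by (intro mult_left_mono) (auto simp: x_def)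
    ultimately show ?thesis by (simp add: mult_ac)
  next
    case False
    have "(\<Sum>i<?N. ?B i) / (2 * real ?N) \<ge> 0" using B0 by (intro divide_nonneg_nonneg sum_nonneg) auto
    moreover have "E0 * r ^ Suc n \<ge> 0" using E0 r by simp
    ultimately show ?thesis using E' False by (simp add: x_def)
  qed
  then show ?case
    using lazy_step_fin_supp[OF fq \<tau>s ne] lazy_step_sum[OF fq \<tau>s ne] nn ss mq
    by (simp add: q_def r_def m_def E0_def)
qed

lemma lazy_walk_decay:
  fixes p :: "'s \<Rightarrow> real"
  assumes p: "fin_supp p" and nonneg: "\<And>z. p z \<ge> 0"
    and \<tau>s: "\<And>\<tau>. \<tau> \<in> set \<tau>s \<Longrightarrow> bij \<tau>" and ne: "\<tau>s \<noteq> []" and k: "k > 0"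
    and supp: "\<And>z. p z \<noteq> 0 \<Longrightarrow> z \<in> V"
    and V: "\<And>\<tau> z. \<tau> \<in> set \<tau>s \<Longrightarrow> \<tau> z \<in> V \<Longrightarrow> z \<in> V"
    and good: "\<And>\<tau> z. \<tau> \<in> set \<tau>s \<Longrightarrow> good \<tau> \<Longrightarrow> z \<in> V \<Longrightarrow> inj_on (\<lambda>j. (\<tau> ^^ j) z) {..<k}"
    and c: "c * real (length \<tau>s) \<le> real (length (filter good \<tau>s))" "0 \<le> c"
  shows "((lazy_step \<tau>s ^^ n) p z)\<^sup>2 \<le> (Sum_any p)\<^sup>2 / real k
    + Sum_any (\<lambda>z. (p z)\<^sup>2) * (1 - c / (2 * real k ^ 2)) ^ n"
proof -
  let ?q = "(lazy_step \<tau>s ^^ n) p"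
  have D: "Sum_any (\<lambda>z. (?q z)\<^sup>2) \<le> (Sum_any p)\<^sup>2 / real k
      + Sum_any (\<lambda>z. (p z)\<^sup>2) * (1 - c / (2 * real k ^ 2)) ^ n \<and> fin_supp ?q"
    using lazy_walk_energy_decay[of p \<tau>s k V good c n] assms by blast
  have "(?q z)\<^sup>2 = Sum_any (\<lambda>y. if y = z then (?q y)\<^sup>2 else 0)" by (rule Sum_any.delta[symmetric])
  also have "\<dots> \<le> Sum_any (\<lambda>y. (?q y)\<^sup>2)"
    using D by (intro Sum_any_mono fin_supp_square) (auto simp: fin_supp_def)
  also have "\<dots> \<le> (Sum_any p)\<^sup>2 / real k + Sum_any (\<lambda>z. (p z)\<^sup>2) * (1 - c / (2 * real k ^ 2)) ^ n"
    using D by blast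
  finally show ?thesis .
qed

section \<open>Amplification by Kronecker powers\<close>

text \<open>Adding the identity makes the walk lazy. Without it a scalar matrix such as \<open>-1\<close> would have
trivial even powers.\<close>

definition add_identity :: "complex mat \<Rightarrow> complex mat" where
  "add_identity A = four_block_mat A (0\<^sub>m (dim_row A) (dim_row A)) (0\<^sub>m (dim_row A) (dim_row A)) (1\<^sub>m (dim_row A))"

fun amplify :: "nat \<Rightarrow> complex mat \<Rightarrow> complex mat" where
  "amplify 0 A = 1\<^sub>m 1"
| "amplify (Suc n) A = kron (add_identity A) (amplify n A)"

lemma add_identity_carrier [simp]:
  assumes "A \<in> carrier_mat d d"
  shows "add_identity A \<in> carrier_mat (2 * d) (2 * d)"
  using four_block_carrier_mat[OF assms one_carrier_mat]
  unfolding add_identity_def carrier_matD(1)[OF assms] mult_2 .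

lemma amplify_carrier:
  assumes "A \<in> carrier_mat d d"
  shows "amplify n A \<in> carrier_mat ((2 * d) ^ n) ((2 * d) ^ n)"
proof (induction n)
  case (Suc n)
  show ?case using kron_carrier[OF add_identity_carrier[OF assms] Suc] by (simp only: amplify.simps power_Suc)
qed simp

lemma add_identity_mult:
  assumes "A \<in> carrier_mat d d" "B \<in> carrier_mat d d"
  shows "add_identity A * add_identity B = add_identity (A * B)"
proof -
  have "A * B \<in> carrier_mat d d" using assms by auto
  then show ?thesis
    using assms mult_four_block_mat[OF assms(1) zero_carrier_mat zero_carrier_mat one_carrier_mat
      assms(2) zero_carrier_mat zero_carrier_mat one_carrier_mat]
    by (simp add: add_identity_def)
qed

lemma amplify_mult:
  assumes "A \<in> carrier_mat d d" "B \<in> carrier_mat d d"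
  shows "amplify n A * amplify n B = amplify n (A * B)"
proof (induction n)
  case (Suc n)
  have c: "add_identity A \<in> carrier_mat (2 * d) (2 * d)" "add_identity B \<in> carrier_mat (2 * d) (2 * d)"
    "amplify n A \<in> carrier_mat ((2 * d) ^ n) ((2 * d) ^ n)" "amplify n B \<in> carrier_mat ((2 * d) ^ n) ((2 * d) ^ n)"
    by (intro add_identity_carrier amplify_carrier assms)+
  show ?case
    unfolding amplify.simps kron_mult[OF c] add_identity_mult[OF assms] Suc ..
qed simp

lemma add_identity_one: "add_identity (1\<^sub>m d) = 1\<^sub>m (2 * d)"
  by (intro eq_matI) (auto simp: add_identity_def)

lemma amplify_one: "amplify n (1\<^sub>m d) = 1\<^sub>m ((2 * d) ^ n)"
  by (induction n) (auto simp: add_identity_one kron_one)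

lemma GL_iff:
  "A \<in> GL d \<longleftrightarrow> A \<in> carrier_mat d d \<and> (\<exists>B\<in>carrier_mat d d. A * B = 1\<^sub>m d \<and> B * A = 1\<^sub>m d)"
proof
  assume "A \<in> GL d"
  then have A: "A \<in> carrier_mat d d" and i: "invertible_mat A" by (auto simp: GL_def)
  from i obtain B where B: "inverts_mat A B" "inverts_mat B A" by (auto simp: invertible_mat_def)
  have "dim_row B = d" "dim_col B = d"
    using B A by (metis (no_types) inverts_mat_def carrier_matD index_mult_mat(2,3) index_one_mat(2,3))+
  then show "A \<in> carrier_mat d d \<and> (\<exists>B\<in>carrier_mat d d. A * B = 1\<^sub>m d \<and> B * A = 1\<^sub>m d)"
    using A B by (auto simp: inverts_mat_def intro!: bexI[of _ B])
next
  assume "A \<in> carrier_mat d d \<and> (\<exists>B\<in>carrier_mat d d. A * B = 1\<^sub>m d \<and> B * A = 1\<^sub>m d)"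
  then show "A \<in> GL d" by (auto simp: GL_def invertible_mat_def inverts_mat_def square_mat.simps)
qed

lemma amplify_GL:
  assumes "A \<in> GL d"
  shows "amplify n A \<in> GL ((2 * d) ^ n)"
proof -
  obtain B where A: "A \<in> carrier_mat d d" and B: "B \<in> carrier_mat d d" and AB: "A * B = 1\<^sub>m d" "B * A = 1\<^sub>m d"
    using assms unfolding GL_iff by blast
  show ?thesis unfolding GL_iff
    using amplify_carrier[OF A, of n] amplify_carrier[OF B, of n]
    by (intro conjI bexI[of _ "amplify n B"]) (simp_all only: amplify_mult[OF A B] amplify_mult[OF B A] AB amplify_one)
qed

lemma rank_dist_add_identity:
  assumes A: "A \<in> carrier_mat d d" and B: "B \<in> carrier_mat d d" and d: "d > 0"
  shows "rank_dist (2 * d) (add_identity A) (add_identity B) \<le> rank_dist d A B"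
proof -
  have AB: "A - B \<in> carrier_mat d d" using A B by auto
  have eq: "add_identity A - add_identity B = four_block_mat (A - B) (0\<^sub>m d d) (0\<^sub>m d d) (0\<^sub>m d d)"
    using A B by (intro eq_matI) (auto simp: add_identity_def)
  have "d \<le> kernel_dim (0\<^sub>m d d :: complex mat)"
    by (rule kernel_dim_ge[of _ d d "1\<^sub>m d" d "1\<^sub>m d"]) (auto simp: zero_mat_mult_vec)
  moreover have "kernel_dim (add_identity A - add_identity B) = kernel_dim (A - B) + kernel_dim (0\<^sub>m d d :: complex mat)"
    using kernel_four_block_0_mat[OF eq AB zero_carrier_mat] A B
    unfolding kernel_dim_def by (simp add: add_identity_def)
  ultimately have "kernel_dim (A - B) + d \<le> kernel_dim (add_identity A - add_identity B)" by simp
  then have le: "real (kernel_dim (A - B)) + real d \<le> real (kernel_dim (add_identity A - add_identity B))"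
    unfolding of_nat_add[symmetric] of_nat_le_iff .
  have r: "rank_dist d A B \<ge> 0" by (simp add: rank_dist_def)
  have "rank_dist (2 * d) (add_identity A) (add_identity B) = 1 - real (kernel_dim (add_identity A - add_identity B)) / real (2 * d)"
    using A B d by (intro rank_dist_kernel_dim) auto
  also have "\<dots> \<le> 1 - (real (kernel_dim (A - B)) + real d) / real (2 * d)"
    using le d by (intro diff_left_mono divide_right_mono) auto
  also have "\<dots> = rank_dist d A B / 2"
    unfolding rank_dist_kernel_dim[OF A B d] using d by (simp add: field_simps)
  finally show ?thesis using r by linarith
qed

lemma rank_dist_amplify:
  assumes A: "A \<in> carrier_mat d d" and B: "B \<in> carrier_mat d d" and d: "d > 0"
  shows "rank_dist ((2 * d) ^ n) (amplify n A) (amplify n B) \<le> real n * rank_dist d A B"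
proof (induction n)
  case 0
  have "(1\<^sub>m 1 - 1\<^sub>m 1 :: complex mat) = 0\<^sub>m 1 1" by (intro eq_matI) auto
  then have "rank_dist 1 (1\<^sub>m 1) (1\<^sub>m 1 :: complex mat) = 0"
    by (simp only: rank_dist_def vec_space.rank_0I)
  then show ?case by simp
next
  case (Suc n)
  have "rank_dist (2 * d * (2 * d) ^ n) (kron (add_identity A) (amplify n A)) (kron (add_identity B) (amplify n B))
      \<le> rank_dist (2 * d) (add_identity A) (add_identity B) + rank_dist ((2 * d) ^ n) (amplify n A) (amplify n B)"
    using d by (intro rank_dist_kron add_identity_carrier amplify_carrier A B) simp_all
  moreover have "real (Suc n) * rank_dist d A B = real n * rank_dist d A B + rank_dist d A B"
    by (simp add: distrib_right)
  ultimately show ?case using Suc rank_dist_add_identity[OF A B d] unfolding amplify.simps power_Suc by linarith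
qed

section \<open>The walk of a Jordan form\<close>

text \<open>The formal eigenvalues of a Jordan form: a pair \<open>(l, s)\<close> stands for \<open>l t\<^sup>s\<close> with an indeterminate
\<open>t\<close>. A block of size \<open>a\<close> contributes \<open>a div 2\<close> blocks of size 2, each of which gives \<open>l t\<close> and
\<open>l / t\<close>, and \<open>a mod 2\<close> blocks of size 1.\<close>

definition jordan_steps :: "(nat \<times> complex) list \<Rightarrow> (complex \<times> int) list" where
  "jordan_steps n_as = concat (map (\<lambda>(a, l). replicate (a mod 2) (l, 0)
     @ replicate (a div 2) (l, 1) @ replicate (a div 2) (l, -1)) n_as)"

definition shift :: "complex \<times> int \<Rightarrow> complex \<times> int \<Rightarrow> complex \<times> int" where
  "shift s x = (fst x / fst s, snd x + snd s)"

lemma jordan_steps_simps [simp]: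
  "jordan_steps [] = []"
  "jordan_steps ((a, l) # n_as) = replicate (a mod 2) (l, 0) @ replicate (a div 2) (l, 1)
     @ replicate (a div 2) (l, -1) @ jordan_steps n_as"
  by (simp_all add: jordan_steps_def)

lemma length_jordan_steps: "length (jordan_steps n_as) = sum_list (map fst n_as)"
proof (induction n_as)
  case (Cons al n_as)
  then show ?case by (cases al) (simp, presburger)
qed simp

lemma jordan_steps_source:
  "s \<in> set (jordan_steps n_as) \<Longrightarrow> (\<exists>a. (a, fst s) \<in> set n_as) \<and> -1 \<le> snd s"
proof (induction n_as)
  case (Cons al n_as)
  obtain a l where al: "al = (a, l)" by force
  from Cons.prems have "s \<in> {(l, 0), (l, 1), (l, -1)} \<or> s \<in> set (jordan_steps n_as)"
    unfolding al jordan_steps_simps set_append Un_iff in_set_replicate by blast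
  then show ?case
  proof
    assume "s \<in> {(l, 0), (l, 1), (l, -1)}"
    then show ?thesis unfolding al by force
  next
    assume "s \<in> set (jordan_steps n_as)"
    from Cons.IH[OF this] show ?thesis by (meson list.set_intros(2))
  qed
qed simp

text \<open>For \<open>b \<ge> 0\<close> this is the dimension of the kernel of \<open>(1 - \<mu>)\<^sup>b\<close> on a one-dimensional space. The kernel
dimensions are only defined for \<open>b \<ge> 0\<close> and vanish at \<open>b = 0\<close>; they are continued to negative \<open>b\<close>
as an odd function (the reflection principle), so that the walk needs no boundary condition.\<close>

definition signed_unit :: "complex \<times> int \<Rightarrow> real" where
  "signed_unit x = (if fst x = 1 then real_of_int (sgn (snd x)) else 0)"

abbreviation walk :: "(complex \<times> int) list \<Rightarrow> (complex \<times> int \<Rightarrow> real) \<Rightarrow> complex \<times> int \<Rightarrow> real" where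
  "walk ss \<equiv> lazy_step (map shift ss)"

definition mirror :: "complex \<times> int \<Rightarrow> complex \<times> int" where
  "mirror x = (fst x, - snd x)"

lemma sum_list_steps_mirror:
  assumes "\<And>x. u (mirror x) = - u x"
  shows "(\<Sum>s\<leftarrow>jordan_steps n_as. u (shift s (mirror x))) = - (\<Sum>s\<leftarrow>jordan_steps n_as. u (shift s x) :: real)"
proof (induction n_as)
  case (Cons al n_as)
  obtain a l where al: "al = (a, l)" by force
  have 0: "shift (l, 0) (mirror x) = mirror (shift (l, 0) x)"
    and 1: "shift (l, 1) (mirror x) = mirror (shift (l, -1) x)"
    and 2: "shift (l, -1) (mirror x) = mirror (shift (l, 1) x)"
    by (auto simp: shift_def mirror_def)
  show ?case using Cons by (simp add: al sum_list_replicate 0 1 2 assms)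
qed simp

lemma walk_step_odd:
  assumes "\<And>x. u (mirror x) = - u x"
  shows "walk (jordan_steps n_as) u (mirror x) = - walk (jordan_steps n_as) u x"
  using sum_list_steps_mirror[of u x n_as, OF assms]
  unfolding lazy_step_def list.map_comp comp_def length_map assms by (simp add: field_simps)

lemma walk_odd: "(walk (jordan_steps n_as) ^^ n) signed_unit (mirror x) = - (walk (jordan_steps n_as) ^^ n) signed_unit x"
proof (induction n arbitrary: x)
  case 0
  show ?case by (simp add: signed_unit_def mirror_def sgn_minus)
next
  case (Suc n)
  show ?case unfolding funpow.simps comp_def by (rule walk_step_odd) (rule Suc)
qed

lemma walk_zero: "(walk (jordan_steps n_as) ^^ n) signed_unit (\<mu>, 0) = 0"
  using walk_odd[of n n_as "(\<mu>, 0)"] by (simp add: mirror_def)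

lemma dim_gen_eigenspace_0:
  fixes X :: "complex mat"
  assumes "X \<in> carrier_mat D D"
  shows "dim_gen_eigenspace X \<mu> 0 = 0"
proof -
  have "kernel_dim (1\<^sub>m D :: complex mat) \<le> 0"
    by (rule kernel_dim_le[of _ D D "0\<^sub>m 0 D"]) auto
  moreover have "char_matrix X \<mu> ^\<^sub>m 0 = 1\<^sub>m D" using assms by (simp add: char_matrix_def)
  ultimately show ?thesis by (simp add: dim_gen_eigenspace_def)
qed

lemma GL_jordan_form:
  fixes A :: "complex mat"
  assumes A: "A \<in> GL d"
  obtains n_as where "jordan_nf A n_as" "sum_list (map fst n_as) = d" "\<And>a l. (a, l) \<in> set n_as \<Longrightarrow> l \<noteq> 0"
proof -
  obtain B where Ac: "A \<in> carrier_mat d d" and B: "B \<in> carrier_mat d d" "A * B = 1\<^sub>m d" "B * A = 1\<^sub>m d"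
    using A by (auto simp: GL_iff)
  obtain as where "char_poly A = (\<Prod>a\<leftarrow>as. [:- a, 1:])"
    using char_poly_factorized[OF Ac] by auto
  then obtain n_as where jnf: "jordan_nf A n_as" using jordan_nf_exists[OF Ac] by blast
  have d: "sum_list (map fst n_as) = d"
    using jnf Ac by (metis jordan_nf_def jordan_matrix_dim(1) similar_mat_def similar_mat_witD carrier_matD(1))
  have "l \<noteq> 0" if "(a, l) \<in> set n_as" for a l
  proof
    assume l: "l = 0"
    have "a \<noteq> 0" using that jnf by (force simp: jordan_nf_def)
    moreover have "a \<le> Polynomial.order 0 (char_poly A)"
      using jordan_nf_block_size_order_bound[OF jnf that] l by simp
    ultimately have "poly (char_poly A) 0 = 0" by (metis le_zero_eq order_0I)
    then have "eigenvalue A 0" using eigenvalue_root_char_poly[OF Ac] by simp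
    then obtain v where v: "v \<in> carrier_vec d" "v \<noteq> 0\<^sub>v d" "A *\<^sub>v v = 0 \<cdot>\<^sub>v v"
      using Ac by (auto simp: eigenvalue_def eigenvector_def)
    have "v = (B * A) *\<^sub>v v" using B v by simp
    also have "\<dots> = B *\<^sub>v (A *\<^sub>v v)" by (rule assoc_mult_mat_vec[OF B(1) Ac v(1)])
    also have "A *\<^sub>v v = 0\<^sub>v d" unfolding v(3) using v(1) by (intro eq_vecI) auto
    also have "B *\<^sub>v 0\<^sub>v d = 0\<^sub>v d" by (rule mult_mat_zero_vec[OF B(1)])
    finally show False using v by simp
  qed
  then show ?thesis using that jnf d by blast
qed

lemma add_identity_jordan_form:
  assumes A: "A \<in> carrier_mat d d" and jnf: "jordan_nf A n_as"
  shows "similar_mat (add_identity A) (jordan_matrix (n_as @ replicate d (1, 1)))"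
proof -
  have one: "jordan_matrix (replicate k (1, 1)) = (1\<^sub>m k :: complex mat)" for k
  proof (induction k)
    case (Suc k)
    have "jordan_block 1 1 = (1\<^sub>m 1 :: complex mat)" by (intro eq_matI) auto
    then show ?case using Suc four_block_one_mat[of 1 k, where ?'a = complex]
      by (simp add: jordan_matrix_Cons sum_list_replicate)
  qed (auto simp: jordan_matrix_def intro: eq_matI)
  let ?J = "jordan_matrix n_as"
  have sim: "similar_mat A ?J" using jnf by (simp add: jordan_nf_def)
  then have J: "?J \<in> carrier_mat d d"
    using A by (metis similar_mat_def similar_mat_witD carrier_matD(1))
  have "jordan_matrix (n_as @ replicate d (1, 1)) = four_block_mat ?J (0\<^sub>m d d) (0\<^sub>m d d) (1\<^sub>m d)"
    using J one[of d] by (simp add: jordan_matrix_def diag_block_mat_append Let_def)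
  moreover have "add_identity A = four_block_mat A (0\<^sub>m d d) (0\<^sub>m d d) (1\<^sub>m d)" using A by (simp add: add_identity_def)
  ultimately show ?thesis
    using similar_mat_four_block_0_0[OF sim similar_mat_refl[OF one_carrier_mat] A one_carrier_mat] by simp
qed

lemma sum_jordan_steps:
  fixes f :: "complex \<times> int \<Rightarrow> 'b::semiring_1"
  shows "(\<Sum>s\<leftarrow>jordan_steps n_as. f s) = (\<Sum>(a, l)\<leftarrow>n_as. of_nat (a mod 2) * f (l, 0) + of_nat (a div 2) * (f (l, 1) + f (l, -1)))"
  by (induction n_as) (auto simp: sum_list_replicate algebra_simps)

text \<open>By \<open>dim_gen_eigenspace_kron_jordan_matrix\<close>, the effect of a further Kronecker factor \<open>A \<oplus> 1\<close> on the
dimensions of generalised eigenspaces is bounded by one lazy step, times \<open>2 d\<close>. At \<open>b = 0\<close> both sides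
vanish, the right one because it is odd in \<open>b\<close>; this keeps the induction inside \<open>b \<ge> 0\<close>.\<close>

lemma dim_gen_eigenspace_amplify_le_walk:
  assumes A: "A \<in> GL d" and d: "d > 0" and jnf: "jordan_nf A n_as" and len: "sum_list (map fst n_as) = d"
    and nz: "\<And>a l. (a, l) \<in> set n_as \<Longrightarrow> l \<noteq> 0" and mu: "\<mu> \<noteq> 0"
  shows "real (dim_gen_eigenspace (amplify n A) \<mu> b)
    \<le> real ((2 * d) ^ n) * (walk (jordan_steps n_as) ^^ n) signed_unit (\<mu>, int b)"
  using mu
proof (induction n arbitrary: \<mu> b)
  case 0
  have "(1\<^sub>m 1 :: complex mat) = jordan_matrix [(1, 1)]"
    by (intro eq_matI) (auto simp: jordan_matrix_def)
  then have "dim_gen_eigenspace (1\<^sub>m 1 :: complex mat) \<mu> b = (\<Sum>n \<leftarrow> map fst [(n, e)\<leftarrow>[(1, 1)]. e = \<mu>]. min b n)"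
    using dim_gen_eigenspace_jordan_matrix[of "[(1, 1)]" \<mu> b] by simp
  then show ?case by (cases b) (auto simp: signed_unit_def)
next
  case (Suc n)
  have Ac: "A \<in> carrier_mat d d" using A by (simp add: GL_def)
  show ?case
  proof (cases "b = 0")
    case True
    then show ?thesis using dim_gen_eigenspace_0[OF amplify_carrier[OF Ac], of "Suc n" \<mu>]
      walk_zero[of "Suc n" n_as \<mu>] by simp
  next
    case False
    let ?X = "amplify n A" and ?u = "(walk (jordan_steps n_as) ^^ n) signed_unit"
    let ?K = "\<lambda>\<mu> b. real (dim_gen_eigenspace ?X \<mu> b)" and ?D = "real ((2 * d) ^ n)"
    have X: "?X \<in> carrier_mat ((2 * d) ^ n) ((2 * d) ^ n)" by (rule amplify_carrier[OF Ac])
    have "dim_gen_eigenspace (amplify (Suc n) A) \<mu> b = dim_gen_eigenspace (kron (jordan_matrix (n_as @ replicate d (1, 1))) ?X) \<mu> b"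
      using dim_gen_eigenspace_similar[OF similar_mat_kron[OF add_identity_jordan_form[OF Ac jnf] add_identity_carrier[OF Ac] X]] by simp
    also have "\<dots> \<le> (\<Sum>(a, l)\<leftarrow>n_as @ replicate d (1, 1). (a mod 2) * dim_gen_eigenspace ?X (\<mu> / l) b
      + (a div 2) * (dim_gen_eigenspace ?X (\<mu> / l) (b + 1) + dim_gen_eigenspace ?X (\<mu> / l) (b - 1)))"
      using nz False Suc.prems by (intro dim_gen_eigenspace_kron_jordan_matrix[OF X]) auto
    also have "\<dots> = d * dim_gen_eigenspace ?X \<mu> b + (\<Sum>(a, l)\<leftarrow>n_as. (a mod 2) * dim_gen_eigenspace ?X (\<mu> / l) b
      + (a div 2) * (dim_gen_eigenspace ?X (\<mu> / l) (b + 1) + dim_gen_eigenspace ?X (\<mu> / l) (b - 1)))"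
      by (simp add: sum_list_replicate)
    also have "(\<Sum>(a, l)\<leftarrow>n_as. (a mod 2) * dim_gen_eigenspace ?X (\<mu> / l) b
      + (a div 2) * (dim_gen_eigenspace ?X (\<mu> / l) (b + 1) + dim_gen_eigenspace ?X (\<mu> / l) (b - 1)))
      = (\<Sum>s\<leftarrow>jordan_steps n_as. dim_gen_eigenspace ?X (\<mu> / fst s) (nat (int b + snd s)))"
    proof -
      have "nat (int b + 1) = b + 1" "nat (int b - 1) = b - 1" by auto
      then show ?thesis unfolding sum_jordan_steps by simp
    qed
    finally have "real (dim_gen_eigenspace (amplify (Suc n) A) \<mu> b)
      \<le> real (d * dim_gen_eigenspace ?X \<mu> b + (\<Sum>s\<leftarrow>jordan_steps n_as. dim_gen_eigenspace ?X (\<mu> / fst s) (nat (int b + snd s))))"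
      unfolding of_nat_le_iff .
    also have "\<dots> = real d * ?K \<mu> b + (\<Sum>s\<leftarrow>jordan_steps n_as. ?K (\<mu> / fst s) (nat (int b + snd s)))"
    proof -
      have "real (\<Sum>s\<leftarrow>xs. f s) = (\<Sum>s\<leftarrow>xs. real (f s))" for f :: "complex \<times> int \<Rightarrow> nat" and xs
        by (induction xs) auto
      then show ?thesis by simp
    qed
    also have "\<dots> \<le> real d * (?D * ?u (\<mu>, int b)) + (\<Sum>s\<leftarrow>jordan_steps n_as. ?D * ?u (shift s (\<mu>, int b)))"
    proof (intro add_mono mult_left_mono sum_list_mono)
      show "?K \<mu> b \<le> ?D * ?u (\<mu>, int b)" using Suc by blast
      fix s assume s: "s \<in> set (jordan_steps n_as)"
      have "fst s \<noteq> 0" using jordan_steps_source[OF s] nz by blast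
      then have ms: "\<mu> / fst s \<noteq> 0" using Suc.prems by simp
      have "snd s \<ge> -1" using jordan_steps_source[OF s] by blast
      then have nb: "int (nat (int b + snd s)) = int b + snd s" using False by simp
      have sh: "shift s (\<mu>, int b) = (\<mu> / fst s, int b + snd s)" by (simp add: shift_def)
      show "?K (\<mu> / fst s) (nat (int b + snd s)) \<le> ?D * ?u (shift s (\<mu>, int b))"
        using Suc.IH[OF ms, of "nat (int b + snd s)"] unfolding sh nb .
    qed simp
    also have "\<dots> = real ((2 * d) ^ Suc n) * lazy_step (map shift (jordan_steps n_as)) ?u (\<mu>, int b)"
      using d len by (simp add: lazy_step_def length_jordan_steps sum_list_const_mult comp_def field_simps)
    finally show ?thesis by simp
  qed
qed

lemma minus_diag_four_block:
  fixes A A' E E' :: "'a::ring mat"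
  assumes "A \<in> carrier_mat n n" "E \<in> carrier_mat m m" "A' \<in> carrier_mat n n" "E' \<in> carrier_mat m m"
  shows "four_block_mat A (0\<^sub>m n m) (0\<^sub>m m n) E - four_block_mat A' (0\<^sub>m n m) (0\<^sub>m m n) E'
    = four_block_mat (A - A') (0\<^sub>m n m) (0\<^sub>m m n) (E - E')"
  using assms by (intro eq_matI) auto

text \<open>A Jordan block has at most one step with second coordinate 0, and if its eigenvalue is an
\<open>M\<close>-th root of unity, its first basis vector is fixed by the \<open>M\<close>-th power.\<close>

lemma bad_steps_le_kernel_dim_jordan:
  "length (filter (\<lambda>s. snd s = 0 \<and> fst s ^ M = 1) (jordan_steps n_as))
    \<le> kernel_dim (jordan_matrix n_as ^\<^sub>m M - 1\<^sub>m (sum_list (map fst n_as)))"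
proof (induction n_as)
  case (Cons al n_as)
  obtain a l where al: "al = (a, l)" by force
  let ?n = "sum_list (map fst n_as)"
  let ?P = "jordan_block a l ^\<^sub>m M - 1\<^sub>m a" and ?R = "jordan_matrix n_as ^\<^sub>m M - 1\<^sub>m ?n"
  have P: "?P \<in> carrier_mat a a" and R: "?R \<in> carrier_mat ?n ?n" by (auto intro: minus_carrier_mat)
  have "jordan_matrix (al # n_as) ^\<^sub>m M = four_block_mat (jordan_block a l ^\<^sub>m M) (0\<^sub>m a ?n) (0\<^sub>m ?n a) (jordan_matrix n_as ^\<^sub>m M)"
    unfolding al jordan_matrix_Cons by (rule pow_four_block_mat) auto
  moreover have "1\<^sub>m (a + ?n) = four_block_mat (1\<^sub>m a) (0\<^sub>m a ?n) (0\<^sub>m ?n a) (1\<^sub>m ?n :: complex mat)"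
    by (rule four_block_one_mat[symmetric])
  ultimately have eq: "jordan_matrix (al # n_as) ^\<^sub>m M - 1\<^sub>m (a + ?n) = four_block_mat ?P (0\<^sub>m a ?n) (0\<^sub>m ?n a) ?R"
    by (simp only: minus_diag_four_block[of "jordan_block a l ^\<^sub>m M" a "jordan_matrix n_as ^\<^sub>m M" ?n "1\<^sub>m a" "1\<^sub>m ?n"]
      jordan_block_pow_carrier pow_carrier_mat jordan_matrix_carrier one_carrier_mat)
  have k: "kernel_dim (jordan_matrix (al # n_as) ^\<^sub>m M - 1\<^sub>m (a + ?n)) = kernel_dim ?P + kernel_dim ?R"
    using kernel_four_block_0_mat[OF eq P R] P R unfolding kernel_dim_def by simp
  have "1 \<le> kernel_dim ?P" if odd: "a mod 2 = 1" and l: "l ^ M = 1"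
  proof -
    have a: "0 < a" using odd by (cases a) auto
    define B :: "complex mat" where "B = mat a 1 (\<lambda>(i, j). if i = 0 then 1 else 0)"
    define C :: "complex mat" where "C = mat 1 a (\<lambda>(i, j). if j = 0 then 1 else 0)"
    have B: "B \<in> carrier_mat a 1" and C: "C \<in> carrier_mat 1 a" by (auto simp: B_def C_def)
    have CB: "C * B = 1\<^sub>m 1"
      using a by (intro eq_matI) (auto simp: B_def C_def scalar_prod_def sum.delta if_distrib cong: if_cong)
    have PB: "?P * B = 0\<^sub>m a 1"
    proof (rule eq_matI)
      fix i j assume "i < dim_row (0\<^sub>m a 1 :: complex mat)" "j < dim_col (0\<^sub>m a 1 :: complex mat)"
      then have i: "i < a" and j: "j = 0" by auto
      have "(?P * B) $$ (i, j) = (\<Sum>m<a. ?P $$ (i, m) * (if m = 0 then 1 else 0))"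
        using i j by (simp add: B_def scalar_prod_def atLeast0LessThan)
      also have "\<dots> = (\<Sum>m<a. if m = 0 then ?P $$ (i, m) else 0)"
        by (intro sum.cong) auto
      also have "\<dots> = ?P $$ (i, 0)" using a by (simp only: sum.delta finite_lessThan lessThan_iff if_True)
      also have "\<dots> = 0" using i a l by (auto simp: jordan_block_pow)
      finally show "(?P * B) $$ (i, j) = (0\<^sub>m a 1 :: complex mat) $$ (i, j)" using i j by simp
    qed (auto simp: B_def)
    show ?thesis
    proof (rule kernel_dim_ge[OF P B C CB])
      fix v :: "complex vec" assume v: "v \<in> carrier_vec 1"
      show "?P *\<^sub>v (B *\<^sub>v v) = 0\<^sub>v a"
        using assoc_mult_mat_vec[OF P B v] v by (simp only: PB zero_mat_mult_vec)
    qed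
  qed
  then have "length (filter (\<lambda>s. snd s = 0 \<and> fst s ^ M = 1) (replicate (a mod 2) (l, 0 :: int))) \<le> kernel_dim ?P"
    by (cases "a mod 2 = 1") auto
  then have "length (filter (\<lambda>s. snd s = 0 \<and> fst s ^ M = 1) (jordan_steps (al # n_as))) \<le> kernel_dim ?P + kernel_dim ?R"
    using Cons by (simp add: al)
  then show ?case using k by (simp add: al)
qed simp

lemma bad_steps_le_kernel_dim:
  assumes A: "A \<in> carrier_mat d d" and jnf: "jordan_nf A n_as"
  shows "length (filter (\<lambda>s. snd s = 0 \<and> fst s ^ M = 1) (jordan_steps n_as)) \<le> kernel_dim (A ^\<^sub>m M - 1\<^sub>m d)"
proof -
  let ?J = "jordan_matrix n_as"
  have "similar_mat A ?J" using jnf by (simp add: jordan_nf_def)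
  then obtain P Q where w: "similar_mat_wit A ?J P Q" by (auto simp: similar_mat_def)
  from similar_mat_witD2[OF A w] have J: "?J \<in> carrier_mat d d" and P: "P \<in> carrier_mat d d" and Q: "Q \<in> carrier_mat d d"
    and PQ: "P * Q = 1\<^sub>m d" "Q * P = 1\<^sub>m d" by auto
  have w': "similar_mat_wit (A ^\<^sub>m M) (?J ^\<^sub>m M) P Q" by (rule similar_mat_wit_pow[OF w])
  have c: "A ^\<^sub>m M \<in> carrier_mat d d" "?J ^\<^sub>m M \<in> carrier_mat d d" using A J by auto
  have AM: "A ^\<^sub>m M - 1\<^sub>m d = char_matrix (A ^\<^sub>m M) 1" and JM: "?J ^\<^sub>m M - 1\<^sub>m d = char_matrix (?J ^\<^sub>m M) 1"
    using c by (auto simp: char_matrix_def intro!: eq_matI)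
  have w'': "similar_mat_wit (A ^\<^sub>m M - 1\<^sub>m d) (?J ^\<^sub>m M - 1\<^sub>m d) P Q"
    unfolding AM JM by (rule similar_mat_wit_char_matrix[OF w'])
  have cc: "A ^\<^sub>m M - 1\<^sub>m d \<in> carrier_mat d d" "?J ^\<^sub>m M - 1\<^sub>m d \<in> carrier_mat d d" using c by auto
  have "kernel_dim (A ^\<^sub>m M - 1\<^sub>m d) = kernel_dim (?J ^\<^sub>m M - 1\<^sub>m d)"
    using similar_mat_wit_kernel_dim[OF cc(1) w''] cc unfolding kernel_dim_def by simp
  moreover have "sum_list (map fst n_as) = d" using J by (metis carrier_matD(1) jordan_matrix_dim(1))
  ultimately show ?thesis using bad_steps_le_kernel_dim_jordan[of M n_as] by simp
qed

lemma shift_funpow: "fst s \<noteq> 0 \<Longrightarrow> (shift s ^^ j) x = (fst x / fst s ^ j, snd x + int j * snd s)"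
  by (induction j) (auto simp: shift_def algebra_simps)

lemma bij_shift: "fst s \<noteq> 0 \<Longrightarrow> bij (shift s)"
  by (rule bij_betw_byWitness[where f' = "\<lambda>x. (fst x * fst s, snd x - snd s)"]) (auto simp: shift_def)

text \<open>If the orbit closes up in less than \<open>k\<close> steps, then the second coordinate of the step is 0 and the
first has order less than \<open>k\<close>, which divides \<open>k!\<close>.\<close>

lemma inj_on_shift_orbit:
  assumes s: "fst s \<noteq> 0" and x: "fst x \<noteq> 0" and good: "\<not> (snd s = 0 \<and> fst s ^ fact k = 1)"
  shows "inj_on (\<lambda>j. (shift s ^^ j) x) {..<k}"
proof (rule linorder_inj_onI)
  fix i j assume ij: "i < j" "i \<in> {..<k}" "j \<in> {..<k}"
  show "(shift s ^^ i) x \<noteq> (shift s ^^ j) x"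
  proof
    assume "(shift s ^^ i) x = (shift s ^^ j) x"
    then have 1: "fst x / fst s ^ i = fst x / fst s ^ j" and 2: "int i * snd s = int j * snd s"
      unfolding shift_funpow[OF s] by auto
    from 1 s x have "fst s ^ i = fst s ^ j" by (simp add: field_simps)
    also have "fst s ^ j = fst s ^ i * fst s ^ (j - i)" using ij by (simp flip: power_add)
    finally have "fst s ^ (j - i) = 1" using s by simp
    moreover have "j - i dvd fact k" using ij by (intro dvd_fact) auto
    ultimately have "fst s ^ fact k = 1" by (auto simp: dvd_def power_mult)
    moreover have "snd s = 0" using 2 ij by simp
    ultimately show False using good by simp
  qed
qed auto

text \<open>Half the difference of two neighbouring values of \<open>signed_unit\<close>. In contrast to \<open>signed_unit\<close> it has
finite support, and by oddness it determines the value of the walk at \<open>b = 1\<close>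
(\<open>walk_signed_eq_weight_unit\<close>).\<close>

definition weight_unit :: "complex \<times> int \<Rightarrow> real" where
  "weight_unit x = (signed_unit (fst x, snd x + 1) - signed_unit (fst x, snd x - 1)) / 2"

lemma weight_unit_nonneg: "weight_unit x \<ge> 0"
  by (auto simp: weight_unit_def signed_unit_def sgn_if)

lemma weight_unit_support: "weight_unit x \<noteq> 0 \<Longrightarrow> x \<in> {(1, 0), (1, 1), (1, -1)}"
  by (cases x) (auto simp: weight_unit_def signed_unit_def sgn_if split: if_splits)

lemma fin_supp_weight_unit: "fin_supp weight_unit"
  unfolding fin_supp_def using weight_unit_support by (rule_tac finite_subset[of _ "{(1, 0), (1, 1), (1, -1)}"]) auto

lemma walk_eq: "walk ss u x = (u x + (\<Sum>s\<leftarrow>ss. u (shift s x)) / real (length ss)) / 2"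
  by (simp add: lazy_step_def comp_def)

lemma walk_weight_unit:
  "(walk ss ^^ n) weight_unit x = ((walk ss ^^ n) signed_unit (fst x, snd x + 1) - (walk ss ^^ n) signed_unit (fst x, snd x - 1)) / 2"
proof (induction n arbitrary: x)
  case 0
  show ?case by (simp add: weight_unit_def)
next
  case (Suc n)
  let ?u = "(walk ss ^^ n) signed_unit"
  have sh: "shift s (fst x, snd x + 1) = (fst (shift s x), snd (shift s x) + 1)"
    "shift s (fst x, snd x - 1) = (fst (shift s x), snd (shift s x) - 1)" for s
    by (simp_all add: shift_def)
  define P Q where "P = (\<Sum>s\<leftarrow>ss. ?u (shift s (fst x, snd x + 1)))" and "Q = (\<Sum>s\<leftarrow>ss. ?u (shift s (fst x, snd x - 1)))"
  have lin: "(\<Sum>s\<leftarrow>ts. (f s - g s) / 2) = ((\<Sum>s\<leftarrow>ts. f s) - (\<Sum>s\<leftarrow>ts. g s)) / 2"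
    for f g :: "complex \<times> int \<Rightarrow> real" and ts
    by (induction ts) (simp_all add: field_simps)
  have sum: "(\<Sum>s\<leftarrow>ss. (walk ss ^^ n) weight_unit (shift s x)) = (P - Q) / 2"
    unfolding P_def Q_def sh Suc by (rule lin)
  have fr: "((a - b) / 2 + ((P - Q) / 2) / L) / 2 = ((a + P / L) / 2 - (b + Q / L) / 2) / 2" for a b L :: real
    by (simp add: diff_divide_distrib add_divide_distrib)
  show ?case
    unfolding funpow.simps comp_apply walk_eq[of ss "(walk ss ^^ n) weight_unit"] walk_eq[of ss ?u] sum P_def[symmetric] Q_def[symmetric]
    unfolding Suc by (rule fr)
qed

lemma walk_signed_eq_weight_unit:
  "(walk (jordan_steps n_as) ^^ n) signed_unit (\<mu>, 1) = (walk (jordan_steps n_as) ^^ n) weight_unit (\<mu>, 0)"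
  using walk_weight_unit[of n "jordan_steps n_as" "(\<mu>, 0)"] walk_odd[of n n_as "(\<mu>, 1)"] by (simp add: mirror_def)

lemma walk_decay:
  assumes nz: "\<And>s. s \<in> set ss \<Longrightarrow> fst s \<noteq> 0" and ne: "ss \<noteq> []" and k: "k > 0" and c: "c \<ge> 0"
    and good: "c * real (length ss) \<le> real (length (filter (\<lambda>s. \<not> (snd s = 0 \<and> fst s ^ fact k = 1)) ss))"
  shows "((walk ss ^^ n) weight_unit x)\<^sup>2 \<le> (Sum_any weight_unit)\<^sup>2 / real k + Sum_any (\<lambda>z. (weight_unit z)\<^sup>2) * (1 - c / (2 * real k ^ 2)) ^ n"
proof -
  define V :: "(complex \<times> int) set" where "V = {x. fst x \<noteq> 0}"
  define gd where "gd \<tau> \<longleftrightarrow> (\<forall>x\<in>V. inj_on (\<lambda>j. (\<tau> ^^ j) x) {..<k})" for \<tau> :: "complex \<times> int \<Rightarrow> complex \<times> int"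
  have sub: "gd (shift s)" if "s \<in> set ss" "\<not> (snd s = 0 \<and> fst s ^ fact k = 1)" for s
    using inj_on_shift_orbit[of s _ k] nz that by (auto simp: gd_def V_def)
  have "length (filter (\<lambda>s. \<not> (snd s = 0 \<and> fst s ^ fact k = 1)) ts) \<le> length (filter gd (map shift ts))"
    if "set ts \<subseteq> set ss" for ts
    using that by (induction ts) (auto dest: sub intro: le_SucI)
  from this[of ss] have "c * real (length (map shift ss)) \<le> real (length (filter gd (map shift ss)))"
    using good by simp
  then show ?thesis
  proof (intro lazy_walk_decay[where V = V and good = gd])
    show "z \<in> V" if "weight_unit z \<noteq> 0" for z using weight_unit_support[OF that] by (auto simp: V_def)
    show "z \<in> V" if "\<tau> \<in> set (map shift ss)" "\<tau> z \<in> V" for \<tau> z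
      using that by (auto simp: V_def shift_def)
    show "bij \<tau>" if "\<tau> \<in> set (map shift ss)" for \<tau> using that nz bij_shift by auto
  qed (use fin_supp_weight_unit weight_unit_nonneg ne k c in \<open>auto simp: gd_def\<close>)
qed

text \<open>The point is that \<open>k\<close> and \<open>N\<close> depend on \<open>c\<close> and \<open>e\<close> only, and not on the list of steps. First \<open>k\<close> is
chosen so large that the limiting energy is at most \<open>e\<^sup>2 / 2\<close>, then \<open>N\<close> so large that the excess is.\<close>

lemma walk_eventually_small:
  assumes c: "c > 0" and e: "e > 0"
  shows "\<exists>k N. \<forall>n\<ge>N. (\<forall>ss x. ss \<noteq> [] \<longrightarrow> (\<forall>s\<in>set ss. fst s \<noteq> 0) \<longrightarrow>
     c * real (length ss) \<le> real (length (filter (\<lambda>s. \<not> (snd s = 0 \<and> fst s ^ fact k = 1)) ss)) \<longrightarrow>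
     (walk ss ^^ n) weight_unit x \<le> e)"
proof -
  define m E0 where "m = Sum_any weight_unit" and "E0 = Sum_any (\<lambda>z. (weight_unit z)\<^sup>2)"
  define c' where "c' = min c 1"
  obtain k :: nat where k: "2 * m\<^sup>2 / e\<^sup>2 + 1 < real k" using reals_Archimedean2 by blast
  have "0 \<le> 2 * m\<^sup>2 / e\<^sup>2" by simp
  then have k1: "real k > 1" and k0: "k > 0" using k by linarith+
  have mk: "m\<^sup>2 / real k \<le> e\<^sup>2 / 2"
  proof -
    have "2 * m\<^sup>2 / e\<^sup>2 \<le> real k" using k by simp
    then have "2 * m\<^sup>2 \<le> real k * e\<^sup>2" using e by (simp add: divide_le_eq)
    then show ?thesis using k0 by (simp add: divide_le_eq mult.commute)
  qed
  have E0: "E0 \<ge> 0"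
    using Sum_any_mono[OF fin_supp_zero fin_supp_square[OF fin_supp_weight_unit]] by (simp add: E0_def)
  define r where "r = 1 - c' / (2 * real k ^ 2)"
  have c': "0 < c'" "c' \<le> 1" using c by (auto simp: c'_def)
  have k2: "real k ^ 2 \<ge> 1" using k1 by simp
  have "c' / (2 * real k ^ 2) > 0" by (rule divide_pos_pos) (use k2 c' in linarith)+
  moreover have "c' / (2 * real k ^ 2) \<le> 1 / (2 * 1)" by (rule frac_le) (use k2 c' in linarith)+
  ultimately have r: "0 \<le> r" "r < 1" unfolding r_def by linarith+
  obtain N where N: "r ^ N < e\<^sup>2 / (2 * (E0 + 1))"
    using real_arch_pow_inv[of "e\<^sup>2 / (2 * (E0 + 1))" r] e E0 r by auto
  have En: "E0 * r ^ n \<le> e\<^sup>2 / 2" if "n \<ge> N" for n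
  proof -
    have "r ^ n \<le> r ^ N" using r that by (intro power_decreasing) auto
    then have "E0 * r ^ n \<le> E0 * (e\<^sup>2 / (2 * (E0 + 1)))" using E0 N by (intro mult_left_mono) auto
    also have "\<dots> \<le> e\<^sup>2 / 2"
    proof -
      have "E0 * e\<^sup>2 \<le> (E0 + 1) * e\<^sup>2" by (intro mult_right_mono) auto
      then show ?thesis using E0 by (simp add: divide_le_eq field_simps)
    qed
    finally show ?thesis .
  qed
  have "(walk ss ^^ n) weight_unit x \<le> e"
    if n: "n \<ge> N" and ss: "ss \<noteq> []" "\<forall>s\<in>set ss. fst s \<noteq> 0"
      and g: "c * real (length ss) \<le> real (length (filter (\<lambda>s. \<not> (snd s = 0 \<and> fst s ^ fact k = 1)) ss))" for n ss x
  proof -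
    have "c' * real (length ss) \<le> c * real (length ss)" by (intro mult_right_mono) (auto simp: c'_def)
    with g have g': "c' * real (length ss) \<le> real (length (filter (\<lambda>s. \<not> (snd s = 0 \<and> fst s ^ fact k = 1)) ss))"
      by linarith
    have "((walk ss ^^ n) weight_unit x)\<^sup>2 \<le> m\<^sup>2 / real k + E0 * r ^ n"
      unfolding m_def E0_def r_def using ss g' k0 c' by (intro walk_decay) auto
    then have "((walk ss ^^ n) weight_unit x)\<^sup>2 \<le> e\<^sup>2" using mk En[OF n] by linarith
    then show ?thesis by (rule power2_le_imp_le) (rule less_imp_le[OF e])
  qed
  then show ?thesis by blast
qed

lemma walk_funpow_mono:
  "(\<And>x. u x \<le> v x) \<Longrightarrow> (walk ss ^^ n) u x \<le> (walk ss ^^ n) v x"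
proof (induction n arbitrary: x)
  case (Suc n)
  then have "\<And>x. (walk ss ^^ n) u x \<le> (walk ss ^^ n) v x" by blast
  then show ?case unfolding funpow.simps comp_apply walk_eq
    by (intro divide_right_mono add_mono sum_list_mono) auto
qed simp

text \<open>For the bound \<open>1/2\<close> the second coordinate is discarded: \<open>signed_unit\<close> is dominated by the indicator
function of first coordinate 1.\<close>

definition unit_ind :: "complex \<times> int \<Rightarrow> real" where
  "unit_ind x = (if fst x = 1 then 1 else 0)"

text \<open>The value at \<open>x\<close> is the probability that a random walk from \<open>x\<close> ends with first coordinate 1. If two
walks make the same steps, their first coordinates stay different, so that at most one of them
ends there.\<close>

lemma walk_unit_ind_pair:
  assumes nz: "\<And>s. s \<in> set ss \<Longrightarrow> fst s \<noteq> 0"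
  shows "fst x \<noteq> fst y \<Longrightarrow> (walk ss ^^ n) unit_ind x + (walk ss ^^ n) unit_ind y \<le> 1"
proof (induction n arbitrary: x y)
  case (Suc n)
  let ?u = "(walk ss ^^ n) unit_ind"
  have "(\<Sum>s\<leftarrow>ss. ?u (shift s x)) + (\<Sum>s\<leftarrow>ss. ?u (shift s y)) = (\<Sum>s\<leftarrow>ss. ?u (shift s x) + ?u (shift s y))"
    by (simp add: sum_list_addf)
  also have "\<dots> \<le> (\<Sum>s\<leftarrow>ss. 1)"
    using Suc nz by (intro sum_list_mono Suc.IH) (auto simp: shift_def)
  finally have "((\<Sum>s\<leftarrow>ss. ?u (shift s x)) + (\<Sum>s\<leftarrow>ss. ?u (shift s y))) / real (length ss) \<le> 1"
    by (simp add: divide_le_eq sum_list_triv)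
  then have "(\<Sum>s\<leftarrow>ss. ?u (shift s x)) / real (length ss) + (\<Sum>s\<leftarrow>ss. ?u (shift s y)) / real (length ss) \<le> 1"
    by (simp only: add_divide_distrib)
  moreover have "(a + p) / 2 + (b + q) / 2 \<le> 1" if "p + q \<le> 1" "a + b \<le> 1" for a b p q :: real
  proof -
    have "(a + p) / 2 + (b + q) / 2 = ((a + b) + (p + q)) / 2" by (simp add: add_divide_distrib)
    also have "\<dots> \<le> (1 + 1) / 2" using that by (intro divide_right_mono add_mono) auto
    finally show ?thesis by simp
  qed
  ultimately show ?case using Suc.IH[OF Suc.prems]
    unfolding funpow.simps comp_apply walk_eq[of ss ?u] by blast
qed (auto simp: unit_ind_def)

lemma walk_unit_ind_cong:
  "fst x = fst y \<Longrightarrow> (walk ss ^^ n) unit_ind x = (walk ss ^^ n) unit_ind y"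
proof (induction n arbitrary: x y)
  case (Suc n)
  have "(walk ss ^^ n) unit_ind (shift s x) = (walk ss ^^ n) unit_ind (shift s y)" for s
    using Suc by (intro Suc.IH) (simp add: shift_def)
  then show ?case using Suc.IH[OF Suc.prems] unfolding funpow.simps comp_apply walk_eq by simp
qed (simp add: unit_ind_def)

text \<open>A step that changes the first coordinate averages the values at two different points, which is at
most \<open>1/2\<close> by \<open>walk_unit_ind_pair\<close>; the other steps leave the value unchanged. So in each step the
excess over \<open>1/2\<close> is multiplied by at most the proportion of the other steps.\<close>

lemma walk_unit_ind_le:
  assumes nz: "\<And>s. s \<in> set ss \<Longrightarrow> fst s \<noteq> 0" and ne: "ss \<noteq> []" and c: "0 \<le> c" "c \<le> 1"
    and g: "c * real (length ss) \<le> real (length (filter (\<lambda>s. fst s \<noteq> 1) ss))"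
  shows "fst x \<noteq> 0 \<Longrightarrow> (walk ss ^^ n) unit_ind x \<le> 1 / 2 + (1 - c) ^ n / 2"
proof (induction n arbitrary: x)
  case 0
  show ?case by (simp add: unit_ind_def)
next
  case (Suc n)
  let ?u = "(walk ss ^^ n) unit_ind"
  define L where "L = real (length ss)"
  define G where "G = real (length (filter (\<lambda>s. fst s \<noteq> 1) ss))"
  define q where "q = 1 / 2 + (1 - c) ^ n / 2"
  have L: "L > 0" using ne by (simp add: L_def)
  have q: "q \<ge> 1 / 2" using c by (simp add: q_def)
  have "(\<Sum>s\<leftarrow>ss. ?u x + ?u (shift s x)) \<le> (\<Sum>s\<leftarrow>ss. if fst s \<noteq> 1 then 1 else 2 * q)"
  proof (rule sum_list_mono)
    fix s assume s: "s \<in> set ss"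
    show "?u x + ?u (shift s x) \<le> (if fst s \<noteq> 1 then 1 else 2 * q)"
    proof (cases "fst s = 1")
      case True
      then have "?u (shift s x) = ?u x" by (intro walk_unit_ind_cong) (simp add: shift_def)
      then show ?thesis using True Suc.IH[OF Suc.prems] by (simp add: q_def)
    next
      case False
      then have "fst x \<noteq> fst (shift s x)" using Suc.prems nz[OF s] by (auto simp: shift_def field_simps)
      then show ?thesis using walk_unit_ind_pair[of ss x "shift s x" n] nz False by simp
    qed
  qed
  also have "\<dots> = G + (L - G) * (2 * q)"
    unfolding G_def L_def by (induction ss) (auto simp: algebra_simps)
  finally have "(\<Sum>s\<leftarrow>ss. ?u x + ?u (shift s x)) \<le> L * (2 * q) - G * (2 * q - 1)"
    by (simp add: algebra_simps)
  also have "\<dots> \<le> L * (2 * q) - (c * L) * (2 * q - 1)"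
    using g q by (intro diff_left_mono mult_right_mono) (auto simp: L_def G_def)
  finally have "L * ?u x + (\<Sum>s\<leftarrow>ss. ?u (shift s x)) \<le> L * (2 * q - c * (2 * q - 1))"
    by (simp add: sum_list_addf sum_list_triv L_def algebra_simps)
  then have "(\<Sum>s\<leftarrow>ss. ?u (shift s x)) \<le> (2 * q - c * (2 * q - 1) - ?u x) * L"
    by (simp add: algebra_simps)
  then have "(\<Sum>s\<leftarrow>ss. ?u (shift s x)) / L \<le> 2 * q - c * (2 * q - 1) - ?u x"
    using L by (simp add: pos_divide_le_eq)
  then have "?u x + (\<Sum>s\<leftarrow>ss. ?u (shift s x)) / L \<le> 2 * q - c * (2 * q - 1)" by linarith
  then have "(walk ss ^^ Suc n) unit_ind x \<le> (2 * q - c * (2 * q - 1)) / 2"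
    unfolding funpow.simps comp_apply walk_eq[of ss ?u] L_def[symmetric] by (rule divide_right_mono) simp
  also have "\<dots> = 1 / 2 + (1 - c) ^ Suc n / 2"
  proof -
    have "2 * q = 1 + (1 - c) ^ n" by (simp add: q_def)
    then show ?thesis by (simp add: left_diff_distrib add_divide_distrib diff_divide_distrib)
  qed
  finally show ?case .
qed

lemma walk_eventually_half:
  assumes c: "c > 0" and e: "e > 0"
  shows "\<exists>N. \<forall>n\<ge>N. \<forall>ss x. ss \<noteq> [] \<longrightarrow> (\<forall>s\<in>set ss. fst s \<noteq> 0) \<longrightarrow> fst x \<noteq> 0 \<longrightarrow>
     c * real (length ss) \<le> real (length (filter (\<lambda>s. fst s \<noteq> 1) ss)) \<longrightarrow>
     (walk ss ^^ n) signed_unit x \<le> 1 / 2 + e"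
proof -
  define c' where "c' = min c 1"
  have c': "0 < c'" "c' \<le> 1" using c by (auto simp: c'_def)
  obtain N where N: "(1 - c') ^ N < 2 * e" using real_arch_pow_inv[of "2 * e" "1 - c'"] e c' by auto
  have "(walk ss ^^ n) signed_unit x \<le> 1 / 2 + e"
    if nN: "n \<ge> N" and ss: "ss \<noteq> []" "\<forall>s\<in>set ss. fst s \<noteq> 0" and x: "fst x \<noteq> 0"
      and g: "c * real (length ss) \<le> real (length (filter (\<lambda>s. fst s \<noteq> 1) ss))" for n ss x
  proof -
    have "(1 - c') ^ n \<le> (1 - c') ^ N" using c' nN by (intro power_decreasing) auto
    then have n: "(1 - c') ^ n < 2 * e" using N by (rule le_less_trans)
    have "c' * real (length ss) \<le> c * real (length ss)" by (intro mult_right_mono) (auto simp: c'_def)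
    with g have g': "c' * real (length ss) \<le> real (length (filter (\<lambda>s. fst s \<noteq> 1) ss))" by linarith
    have "(walk ss ^^ n) signed_unit x \<le> (walk ss ^^ n) unit_ind x"
      by (rule walk_funpow_mono) (auto simp: signed_unit_def unit_ind_def sgn_if)
    also have "\<dots> \<le> 1 / 2 + (1 - c') ^ n / 2"
      using ss g' c' x by (intro walk_unit_ind_le) auto
    also have "\<dots> \<le> 1 / 2 + (2 * e) / 2"
      by (intro add_mono divide_right_mono less_imp_le[OF n]) simp_all
    also have "\<dots> = 1 / 2 + e" by simp
    finally show ?thesis .
  qed
  then show ?thesis by blast
qed

section \<open>Amplified rank distance to the identity\<close>

lemma dim_gen_eigenspace_one:
  fixes X :: "complex mat"
  assumes X: "X \<in> carrier_mat D D"
  shows "dim_gen_eigenspace X 1 1 = kernel_dim (X - 1\<^sub>m D)"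
proof -
  have "char_matrix X 1 = X - 1\<^sub>m D" using X by (intro eq_matI) (auto simp: char_matrix_def)
  moreover have "X - 1\<^sub>m D \<in> carrier_mat D D" using X by (intro minus_carrier_mat) auto
  then have "(X - 1\<^sub>m D) ^\<^sub>m 1 = X - 1\<^sub>m D" by (simp only: One_nat_def pow_mat.simps carrier_matD(1) left_mult_one_mat)
  ultimately show ?thesis by (simp only: dim_gen_eigenspace_def)
qed

lemma rank_dist_amplify_one_ge:
  assumes A: "A \<in> GL d" and d: "d > 0" and jnf: "jordan_nf A n_as" and len: "sum_list (map fst n_as) = d"
    and nz: "\<And>a l. (a, l) \<in> set n_as \<Longrightarrow> l \<noteq> 0"
    and w: "(walk (jordan_steps n_as) ^^ n) signed_unit (1, 1) \<le> w"
  shows "rank_dist ((2 * d) ^ n) (amplify n A) (1\<^sub>m ((2 * d) ^ n)) \<ge> 1 - w"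
proof -
  let ?D = "(2 * d) ^ n"
  have X: "amplify n A \<in> carrier_mat ?D ?D" using A by (intro amplify_carrier) (simp add: GL_def)
  have D: "?D > 0" using d by simp
  have "real (kernel_dim (amplify n A - 1\<^sub>m ?D)) \<le> real ?D * (walk (jordan_steps n_as) ^^ n) signed_unit (1, 1)"
    using dim_gen_eigenspace_amplify_le_walk[OF A d jnf len nz, where \<mu> = 1 and n = n and b = 1] unfolding dim_gen_eigenspace_one[OF X] by simp
  also have "\<dots> \<le> real ?D * w" using w by (intro mult_left_mono) auto
  finally have "real (kernel_dim (amplify n A - 1\<^sub>m ?D)) / real ?D \<le> w"
    using D by (simp only: pos_divide_le_eq of_nat_0_less_iff mult.commute)
  then show ?thesis unfolding rank_dist_kernel_dim[OF X one_carrier_mat D] by linarith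
qed

lemma good_steps_ge:
  assumes A: "A \<in> GL d" and d: "d > 0" and jnf: "jordan_nf A n_as" and len: "sum_list (map fst n_as) = d"
    and c: "rank_dist d (A ^\<^sub>m M) (1\<^sub>m d) \<ge> c"
  shows "c * real (length (jordan_steps n_as))
    \<le> real (length (filter (\<lambda>s. \<not> (snd s = 0 \<and> fst s ^ M = 1)) (jordan_steps n_as)))"
proof -
  let ?bad = "\<lambda>s. snd s = 0 \<and> fst s ^ M = 1" and ?ss = "jordan_steps n_as"
  have Ac: "A \<in> carrier_mat d d" using A by (simp add: GL_def)
  have AM: "A ^\<^sub>m M \<in> carrier_mat d d" using Ac by (rule pow_carrier_mat)
  have L: "length ?ss = d" using len by (simp add: length_jordan_steps)
  have "length (filter ?bad ?ss) + length (filter (\<lambda>s. \<not> ?bad s) ?ss) = d"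
    using sum_length_filter_compl[of ?bad ?ss] L by simp
  then have "real (length (filter ?bad ?ss)) + real (length (filter (\<lambda>s. \<not> ?bad s) ?ss)) = real d"
    unfolding of_nat_add[symmetric] by (rule arg_cong)
  moreover have "real (length (filter ?bad ?ss)) \<le> real (kernel_dim (A ^\<^sub>m M - 1\<^sub>m d))"
    unfolding of_nat_le_iff by (rule bad_steps_le_kernel_dim[OF Ac jnf])
  moreover have "real (kernel_dim (A ^\<^sub>m M - 1\<^sub>m d)) / real d \<le> 1 - c"
    using c unfolding rank_dist_kernel_dim[OF AM one_carrier_mat d] by linarith
  then have "real (kernel_dim (A ^\<^sub>m M - 1\<^sub>m d)) \<le> (1 - c) * real d"
    using d by (simp only: pos_divide_le_eq of_nat_0_less_iff)
  ultimately show ?thesis unfolding L by (simp only: left_diff_distrib)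
qed

lemma jordan_steps_nonempty:
  assumes "d > 0" "sum_list (map fst n_as) = d"
  shows "jordan_steps n_as \<noteq> []"
proof
  assume "jordan_steps n_as = []"
  then have "length (jordan_steps n_as) = 0" by simp
  then show False unfolding length_jordan_steps using assms by simp
qed

text \<open>The exponent is \<open>M = k!\<close>: a formal eigenvalue of order less than \<open>k\<close> is then a bad step, and the
rank distance of \<open>A ^ M\<close> to the identity bounds the proportion of these.\<close>

lemma amplify_nearly_full_rank:
  assumes c: "c > 0" and e: "e > 0"
  shows "\<exists>M N. M > 0 \<and> (\<forall>n\<ge>N. \<forall>d>0. \<forall>A\<in>GL d. rank_dist d (A ^\<^sub>m M) (1\<^sub>m d) \<ge> c \<longrightarrow>
    rank_dist ((2 * d) ^ n) (amplify n A) (1\<^sub>m ((2 * d) ^ n)) \<ge> 1 - e)"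
proof -
  obtain k N where w: "\<And>n ss x. n \<ge> N \<Longrightarrow> ss \<noteq> [] \<Longrightarrow> \<forall>s\<in>set ss. fst s \<noteq> 0 \<Longrightarrow>
     c * real (length ss) \<le> real (length (filter (\<lambda>s. \<not> (snd s = 0 \<and> fst s ^ fact k = 1)) ss)) \<Longrightarrow>
     (walk ss ^^ n) weight_unit x \<le> e"
    using walk_eventually_small[OF c e] by blast
  have "rank_dist ((2 * d) ^ n) (amplify n A) (1\<^sub>m ((2 * d) ^ n)) \<ge> 1 - e"
    if n: "n \<ge> N" and d: "d > 0" and A: "A \<in> GL d" and r: "rank_dist d (A ^\<^sub>m fact k) (1\<^sub>m d) \<ge> c" for n d A
  proof -
    obtain n_as where J: "jordan_nf A n_as" "sum_list (map fst n_as) = d" "\<And>a l. (a, l) \<in> set n_as \<Longrightarrow> l \<noteq> 0"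
      using GL_jordan_form[OF A] by blast
    show ?thesis
    proof (rule rank_dist_amplify_one_ge[OF A d J])
      show "(walk (jordan_steps n_as) ^^ n) signed_unit (1, 1) \<le> e"
        unfolding walk_signed_eq_weight_unit
      proof (rule w[OF n])
        show "jordan_steps n_as \<noteq> []" by (rule jordan_steps_nonempty[OF d J(2)])
        show "\<forall>s\<in>set (jordan_steps n_as). fst s \<noteq> 0" using jordan_steps_source J(3) by blast
      qed (rule good_steps_ge[OF A d J(1,2) r])
    qed
  qed
  then show ?thesis by (intro exI[of _ "fact k"] exI[of _ N]) auto
qed

text \<open>Every good step moves the second coordinate or changes the first one, so one of these two kinds
makes up at least half of them. The two cases need different walk estimates, and \<open>n\<close> is chosen
large enough for both, because the case that occurs depends on \<open>A\<close>.\<close>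

lemma amplify_nearly_half_rank:
  assumes c: "c > 0" and e: "e > 0"
  shows "\<exists>n. \<forall>d>0. \<forall>A\<in>GL d. rank_dist d A (1\<^sub>m d) \<ge> c \<longrightarrow>
    rank_dist ((2 * d) ^ n) (amplify n A) (1\<^sub>m ((2 * d) ^ n)) \<ge> 1 / 2 - e"
proof -
  have c2: "c / 2 > 0" using c by simp
  have h: "(1 / 2 :: real) > 0" by simp
  obtain k N where w: "\<And>n ss x. n \<ge> N \<Longrightarrow> ss \<noteq> [] \<Longrightarrow> \<forall>s\<in>set ss. fst s \<noteq> 0 \<Longrightarrow>
     (c / 2) * real (length ss) \<le> real (length (filter (\<lambda>s. \<not> (snd s = 0 \<and> fst s ^ fact k = 1)) ss)) \<Longrightarrow>
     (walk ss ^^ n) weight_unit x \<le> 1 / 2"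
    using walk_eventually_small[OF c2 h] by blast
  obtain N' where w': "\<And>n ss x. n \<ge> N' \<Longrightarrow> ss \<noteq> [] \<Longrightarrow> \<forall>s\<in>set ss. fst s \<noteq> 0 \<Longrightarrow> fst x \<noteq> 0 \<Longrightarrow>
     (c / 2) * real (length ss) \<le> real (length (filter (\<lambda>s. fst s \<noteq> 1) ss)) \<Longrightarrow>
     (walk ss ^^ n) signed_unit x \<le> 1 / 2 + e"
    using walk_eventually_half[OF c2 e] by blast
  define n where "n = max N N'"
  have n: "n \<ge> N" "n \<ge> N'" by (auto simp: n_def)
  have "rank_dist ((2 * d) ^ n) (amplify n A) (1\<^sub>m ((2 * d) ^ n)) \<ge> 1 / 2 - e"
    if d: "d > 0" and A: "A \<in> GL d" and r: "rank_dist d A (1\<^sub>m d) \<ge> c" for d A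
  proof -
    obtain n_as where J: "jordan_nf A n_as" "sum_list (map fst n_as) = d" "\<And>a l. (a, l) \<in> set n_as \<Longrightarrow> l \<noteq> 0"
      using GL_jordan_form[OF A] by blast
    let ?ss = "jordan_steps n_as"
    have ne: "?ss \<noteq> []" by (rule jordan_steps_nonempty[OF d J(2)])
    have nz: "\<forall>s\<in>set ?ss. fst s \<noteq> 0" using jordan_steps_source J(3) by blast
    have "A ^\<^sub>m 1 = A" using A by (simp add: GL_def)
    then have g: "c * real (length ?ss) \<le> real (length (filter (\<lambda>s. \<not> (snd s = 0 \<and> fst s = 1)) ?ss))"
      using good_steps_ge[OF A d J(1,2), of c 1] r by simp
    have split: "length (filter (\<lambda>s. \<not> (snd s = 0 \<and> fst s = 1)) ts)
        \<le> length (filter (\<lambda>s. snd s \<noteq> 0) ts) + length (filter (\<lambda>s. fst s \<noteq> 1) ts)" for ts :: "(complex \<times> int) list"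
      by (induction ts) auto
    have "real (length (filter (\<lambda>s. \<not> (snd s = 0 \<and> fst s = 1)) ?ss))
        \<le> real (length (filter (\<lambda>s. snd s \<noteq> 0) ?ss)) + real (length (filter (\<lambda>s. fst s \<noteq> 1) ?ss))"
      unfolding of_nat_add[symmetric] of_nat_le_iff by (rule split)
    with g have sum: "c * real (length ?ss) \<le> real (length (filter (\<lambda>s. snd s \<noteq> 0) ?ss)) + real (length (filter (\<lambda>s. fst s \<noteq> 1) ?ss))"
      by (rule order_trans)
    have half: "c * real (length ?ss) = (c / 2) * real (length ?ss) + (c / 2) * real (length ?ss)" by simp
    consider "(c / 2) * real (length ?ss) \<le> real (length (filter (\<lambda>s. snd s \<noteq> 0) ?ss))"
      | "(c / 2) * real (length ?ss) \<le> real (length (filter (\<lambda>s. fst s \<noteq> 1) ?ss))"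
      using sum half by linarith
    then have wh: "(walk ?ss ^^ n) signed_unit (1, 1) \<le> 1 / 2 + e"
    proof cases
      case 1
      have "length (filter (\<lambda>s. snd s \<noteq> 0) ts) \<le> length (filter (\<lambda>s. \<not> (snd s = 0 \<and> fst s ^ fact k = 1)) ts)"
        for ts :: "(complex \<times> int) list" by (induction ts) auto
      then have "(c / 2) * real (length ?ss) \<le> real (length (filter (\<lambda>s. \<not> (snd s = 0 \<and> fst s ^ fact k = 1)) ?ss))"
        using 1 by (meson of_nat_le_iff order_trans)
      then have "(walk ?ss ^^ n) signed_unit (1, 1) \<le> 1 / 2"
        unfolding walk_signed_eq_weight_unit by (rule w[OF n(1) ne nz])
      then show ?thesis using e by linarith
    next
      case 2
      then show ?thesis by (intro w'[OF n(2) ne nz]) simp_all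
    qed
    have "1 - (1 / 2 + e) \<le> rank_dist ((2 * d) ^ n) (amplify n A) (1\<^sub>m ((2 * d) ^ n))"
      by (rule rank_dist_amplify_one_ge[OF A d J(1,2) _ wh]) (fact J(3))
    then show ?thesis by linarith
  qed
  then show ?thesis by blast
qed

section \<open>Amplification of linear sofic approximations\<close>

lemma rank_dist_triangle:
  fixes A B C :: "complex mat"
  assumes "A \<in> carrier_mat d d" "B \<in> carrier_mat d d" "C \<in> carrier_mat d d"
  shows "rank_dist d A C \<le> rank_dist d A B + rank_dist d B C"
proof -
  have "A - C = (A - B) + (B - C)" using assms by (intro eq_matI) auto
  moreover have "vec_space.rank d ((A - B) + (B - C)) \<le> vec_space.rank d (A - B) + vec_space.rank d (B - C)"
    using assms by (intro vec_space.rank_subadditive) auto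
  ultimately have "real (vec_space.rank d (A - C)) \<le> real (vec_space.rank d (A - B)) + real (vec_space.rank d (B - C))"
    unfolding of_nat_add[symmetric] of_nat_le_iff by (simp only:)
  then show ?thesis unfolding rank_dist_def add_divide_distrib[symmetric] by (intro divide_right_mono) auto
qed

lemma rank_dist_mult_right:
  fixes A B X :: "complex mat"
  assumes A: "A \<in> carrier_mat d d" and B: "B \<in> carrier_mat d d" and X: "X \<in> GL d" and d: "d > 0"
  shows "rank_dist d (A * X) (B * X) = rank_dist d A B"
proof -
  obtain Y where X': "X \<in> carrier_mat d d" and Y: "Y \<in> carrier_mat d d" "X * Y = 1\<^sub>m d" using X unfolding GL_iff by blast
  have AB: "A - B \<in> carrier_mat d d" using A B by auto
  have "A * X - B * X = (A - B) * X" by (rule minus_mult_distrib_mat[OF A B X', symmetric])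
  moreover have "kernel_dim ((A - B) * X) = kernel_dim (A - B)"
    using mat_kernel_dim_mult_eq_right[OF AB X' Y] X' B unfolding kernel_dim_def by simp
  ultimately show ?thesis
    using rank_dist_kernel_dim[OF A B d] rank_dist_kernel_dim[OF mult_carrier_mat[OF A X'] mult_carrier_mat[OF B X'] d] by simp
qed

text \<open>The approximation is taken for a set that contains the powers \<open>g ^ j\<close> with \<open>j \<le> M\<close>. Then \<open>\<phi> (g ^ M)\<close>
differs from \<open>(\<phi> g) ^ M\<close> by at most \<open>M\<close> errors, and the error is chosen such that this
costs only half of the separation \<open>\<kappa> / 2\<close> of \<open>g ^ M\<close> from the identity.\<close>

lemma linear_sofic_separating_powers:
  fixes G :: "('a, 'm) monoid_scheme"
  assumes G: "group G" and sof: "kappa_linear_sofic TYPE(complex) \<kappa> G" and kap: "0 < \<kappa>" 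
    and S: "S \<subseteq> carrier G" "finite S" and M: "M > 0"
    and tf: "\<And>g. g \<in> S - {\<one>\<^bsub>G\<^esub>} \<Longrightarrow> g [^]\<^bsub>G\<^esub> M \<noteq> \<one>\<^bsub>G\<^esub>" and \<eta>: "\<eta> > 0"
  obtains d and \<phi> :: "'a \<Rightarrow> complex mat" where "d > 0" "\<And>g. g \<in> S \<Longrightarrow> \<phi> g \<in> GL d"
    "\<And>g h. g \<in> S \<Longrightarrow> h \<in> S \<Longrightarrow> g \<otimes>\<^bsub>G\<^esub> h \<in> S \<Longrightarrow> rank_dist d (\<phi> (g \<otimes>\<^bsub>G\<^esub> h)) (\<phi> g * \<phi> h) < \<eta>"
    "\<And>g. g \<in> S - {\<one>\<^bsub>G\<^esub>} \<Longrightarrow> rank_dist d (\<phi> g ^\<^sub>m M) (1\<^sub>m d) \<ge> \<kappa> / 4"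
proof -
  interpret G: group G by fact
  have p1: "g [^]\<^bsub>G\<^esub> Suc 0 = g" if "g \<in> carrier G" for g
    using G.nat_pow_Suc[of g 0] that by simp
  define T where "T = (\<lambda>(g, j). g [^]\<^bsub>G\<^esub> j) ` (S \<times> {..M})"
  define \<eta>' where "\<eta>' = min \<eta> (\<kappa> / (4 * real M))"
  have T: "T \<subseteq> carrier G" "finite T" using S by (auto simp: T_def)
  have powT: "g [^]\<^bsub>G\<^esub> j \<in> T" if "g \<in> S" "j \<le> M" for g and j :: nat using that by (force simp: T_def)
  have ST: "S \<subseteq> T"
  proof
    fix g assume g: "g \<in> S"
    then have "g [^]\<^bsub>G\<^esub> Suc 0 = g" using S p1 by blast
    then show "g \<in> T" using powT[OF g, of "Suc 0"] M by simp
  qed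
  have \<eta>': "\<eta>' > 0" using \<eta> kap M by (simp add: \<eta>'_def)
  have k2: "0 \<le> \<kappa> / 2" "\<kappa> / 2 < \<kappa>" using kap by simp_all
  from sof[unfolded kappa_linear_sofic_def, THEN spec[of _ T], THEN spec[of _ \<eta>'], THEN spec[of _ "\<kappa> / 2"],
      THEN mp, OF T(1), THEN mp, OF T(2), THEN mp, OF \<eta>', THEN mp, OF k2(1), THEN mp, OF k2(2)]
  obtain d \<phi> where d: "d \<ge> 1" and \<phi>: "\<forall>g\<in>T. \<phi> g \<in> GL d"
    and AH: "\<forall>g\<in>T. \<forall>h\<in>T. g \<otimes>\<^bsub>G\<^esub> h \<in> T \<longrightarrow> rank_dist d (\<phi> (g \<otimes>\<^bsub>G\<^esub> h)) (\<phi> g * \<phi> h) < \<eta>'"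
    and D: "\<forall>g\<in>T - {\<one>\<^bsub>G\<^esub>}. rank_dist d (\<phi> g :: complex mat) (1\<^sub>m d) \<ge> \<kappa> / 2"
    by (elim exE conjE) (rule that)
  have d0: "d > 0" using d by simp
  have pow: "rank_dist d (\<phi> (g [^]\<^bsub>G\<^esub> Suc j)) (\<phi> g ^\<^sub>m Suc j) \<le> real j * \<eta>'" if g: "g \<in> S" and j: "Suc j \<le> M" for g j
    using j
  proof (induction j)
    case 0
    have c: "\<phi> g \<in> carrier_mat d d" using \<phi> g ST by (auto simp: GL_def)
    have "g [^]\<^bsub>G\<^esub> Suc 0 = g" using g S p1 by blast
    moreover have "\<phi> g ^\<^sub>m Suc 0 = \<phi> g" using c by simp
    moreover have "rank_dist d (\<phi> g) (\<phi> g) = 0"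
    proof -
      have "\<phi> g - \<phi> g = 0\<^sub>m d d" using c by simp
      then show ?thesis by (simp only: rank_dist_def vec_space.rank_0I)
    qed
    ultimately show ?case by simp
  next
    case (Suc j)
    have gT: "g \<in> T" using g ST by blast
    have jT: "g [^]\<^bsub>G\<^esub> Suc j \<in> T" "g [^]\<^bsub>G\<^esub> Suc (Suc j) \<in> T"
      by (rule powT[OF g Suc_leD[OF Suc.prems]], rule powT[OF g Suc.prems])
    have ps: "g [^]\<^bsub>G\<^esub> Suc (Suc j) = g [^]\<^bsub>G\<^esub> Suc j \<otimes>\<^bsub>G\<^esub> g" by (rule G.nat_pow_Suc)
    have GLs: "\<phi> g \<in> GL d" "\<phi> (g [^]\<^bsub>G\<^esub> Suc j) \<in> GL d" "\<phi> (g [^]\<^bsub>G\<^esub> Suc (Suc j)) \<in> GL d"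
      using \<phi> gT jT by auto
    then have c: "\<phi> g \<in> carrier_mat d d" "\<phi> (g [^]\<^bsub>G\<^esub> Suc j) \<in> carrier_mat d d" "\<phi> (g [^]\<^bsub>G\<^esub> Suc (Suc j)) \<in> carrier_mat d d"
      by (auto simp: GL_def)
    have cp: "\<phi> g ^\<^sub>m Suc j \<in> carrier_mat d d" "\<phi> g ^\<^sub>m Suc (Suc j) \<in> carrier_mat d d" by (rule pow_carrier_mat[OF c(1)])+
    have "rank_dist d (\<phi> (g [^]\<^bsub>G\<^esub> Suc (Suc j))) (\<phi> g ^\<^sub>m Suc (Suc j))
        \<le> rank_dist d (\<phi> (g [^]\<^bsub>G\<^esub> Suc (Suc j))) (\<phi> (g [^]\<^bsub>G\<^esub> Suc j) * \<phi> g)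
          + rank_dist d (\<phi> (g [^]\<^bsub>G\<^esub> Suc j) * \<phi> g) (\<phi> g ^\<^sub>m Suc (Suc j))"
      using c cp(2) by (intro rank_dist_triangle mult_carrier_mat) 
    also have "rank_dist d (\<phi> (g [^]\<^bsub>G\<^esub> Suc j) * \<phi> g) (\<phi> g ^\<^sub>m Suc (Suc j))
        = rank_dist d (\<phi> (g [^]\<^bsub>G\<^esub> Suc j)) (\<phi> g ^\<^sub>m Suc j)"
      unfolding pow_mat.simps(2)[of "\<phi> g" "Suc j"] by (rule rank_dist_mult_right[OF c(2) cp(1) GLs(1) d0])
    also have "\<dots> \<le> real j * \<eta>'" using Suc by simp
    also have "rank_dist d (\<phi> (g [^]\<^bsub>G\<^esub> Suc (Suc j))) (\<phi> (g [^]\<^bsub>G\<^esub> Suc j) * \<phi> g) \<le> \<eta>'"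
      unfolding ps by (rule less_imp_le, rule AH[rule_format, OF jT(1) gT]) (rule jT(2)[unfolded ps])
    finally have "rank_dist d (\<phi> (g [^]\<^bsub>G\<^esub> Suc (Suc j))) (\<phi> g ^\<^sub>m Suc (Suc j)) \<le> \<eta>' + real j * \<eta>'"
      by simp
    also have "\<dots> = real (Suc j) * \<eta>'" by (simp add: distrib_right)
    finally show ?case .
  qed
  have "rank_dist d (\<phi> g ^\<^sub>m M) (1\<^sub>m d) \<ge> \<kappa> / 4" if g: "g \<in> S - {\<one>\<^bsub>G\<^esub>}" for g
  proof -
    obtain j where j: "M = Suc j" using M by (cases M) auto
    have gT: "g [^]\<^bsub>G\<^esub> M \<in> T" "g \<in> T" using powT g ST by auto
    have c: "\<phi> g \<in> carrier_mat d d" "\<phi> (g [^]\<^bsub>G\<^esub> M) \<in> carrier_mat d d" using \<phi> gT by (auto simp: GL_def)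
    have cp: "\<phi> g ^\<^sub>m M \<in> carrier_mat d d" using c(1) by (rule pow_carrier_mat)
    have "\<kappa> / 2 \<le> rank_dist d (\<phi> (g [^]\<^bsub>G\<^esub> M)) (1\<^sub>m d)" using D gT tf[OF g] by blast
    also have "\<dots> \<le> rank_dist d (\<phi> (g [^]\<^bsub>G\<^esub> M)) (\<phi> g ^\<^sub>m M) + rank_dist d (\<phi> g ^\<^sub>m M) (1\<^sub>m d)"
      using c(2) cp by (intro rank_dist_triangle) auto
    finally have 1: "\<kappa> / 2 \<le> rank_dist d (\<phi> (g [^]\<^bsub>G\<^esub> M)) (\<phi> g ^\<^sub>m M) + rank_dist d (\<phi> g ^\<^sub>m M) (1\<^sub>m d)" .
    have "rank_dist d (\<phi> (g [^]\<^bsub>G\<^esub> M)) (\<phi> g ^\<^sub>m M) \<le> real j * \<eta>'"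
      using pow[of g j] g j by simp
    also have "\<dots> \<le> real M * \<eta>'" using \<eta>' j by (intro mult_right_mono) auto
    also have "\<dots> \<le> real M * (\<kappa> / (4 * real M))" by (intro mult_left_mono) (auto simp: \<eta>'_def)
    also have "\<dots> = \<kappa> / 4" using M by simp
    finally show ?thesis using 1 by linarith
  qed
  moreover have "rank_dist d (\<phi> (g \<otimes>\<^bsub>G\<^esub> h)) (\<phi> g * \<phi> h) < \<eta>" if "g \<in> S" "h \<in> S" "g \<otimes>\<^bsub>G\<^esub> h \<in> S" for g h
  proof -
    have "rank_dist d (\<phi> (g \<otimes>\<^bsub>G\<^esub> h)) (\<phi> g * \<phi> h) < \<eta>'" using AH that ST by blast
    then show ?thesis by (simp add: \<eta>'_def)
  qed
  moreover have "\<And>g. g \<in> S \<Longrightarrow> \<phi> g \<in> GL d" using \<phi> ST by blast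
  ultimately show ?thesis using that d0 by blast
qed

text \<open>The exponents \<open>M\<close> and \<open>n\<close> have to be found before the approximation is chosen, since its precision
depends on them. This is why the amplification has to be uniform in the size \<open>d\<close>.\<close>

lemma kappa_linear_sofic_by_amplification:
  fixes G :: "('a, 'm) monoid_scheme"
  assumes G: "group G" and sof: "kappa_linear_sofic TYPE(complex) \<kappa> G" and kap: "0 < \<kappa>"
    and amplify: "\<And>\<kappa>'. 0 \<le> \<kappa>' \<Longrightarrow> \<kappa>' < \<tau> \<Longrightarrow> \<exists>M n. M > 0 \<and> (\<forall>g\<in>carrier G - {\<one>\<^bsub>G\<^esub>}. g [^]\<^bsub>G\<^esub> M \<noteq> \<one>\<^bsub>G\<^esub>) \<and>
      (\<forall>d>0. \<forall>A\<in>GL d. rank_dist d (A ^\<^sub>m M) (1\<^sub>m d) \<ge> \<kappa> / 4 \<longrightarrow>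
        rank_dist ((2 * d) ^ n) (amplify n A) (1\<^sub>m ((2 * d) ^ n)) \<ge> \<kappa>')"
  shows "kappa_linear_sofic TYPE(complex) \<tau> G"
  unfolding kappa_linear_sofic_def
proof (intro allI impI)
  fix S \<delta> \<kappa>'
  assume S: "S \<subseteq> carrier G" "finite S" and \<delta>: "(0 :: real) < \<delta>" and \<kappa>': "0 \<le> \<kappa>'" "\<kappa>' < \<tau>"
  obtain M n where M: "M > 0" "\<forall>g\<in>carrier G - {\<one>\<^bsub>G\<^esub>}. g [^]\<^bsub>G\<^esub> M \<noteq> \<one>\<^bsub>G\<^esub>"
    and n: "\<And>d A. d > 0 \<Longrightarrow> A \<in> GL d \<Longrightarrow> rank_dist d (A ^\<^sub>m M) (1\<^sub>m d) \<ge> \<kappa> / 4 \<Longrightarrow>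
        rank_dist ((2 * d) ^ n) (amplify n A) (1\<^sub>m ((2 * d) ^ n)) \<ge> \<kappa>'"
    using amplify[OF \<kappa>'] by blast
  define \<eta> where "\<eta> = \<delta> / (real n + 1)"
  have \<eta>: "\<eta> > 0" using \<delta> by (simp add: \<eta>_def)
  have tf: "\<And>g. g \<in> S - {\<one>\<^bsub>G\<^esub>} \<Longrightarrow> g [^]\<^bsub>G\<^esub> M \<noteq> \<one>\<^bsub>G\<^esub>" using M S by blast
  obtain d and \<phi> :: "'a \<Rightarrow> complex mat" where d: "d > 0" and \<phi>: "\<And>g. g \<in> S \<Longrightarrow> \<phi> g \<in> GL d"
    and AH: "\<And>g h. g \<in> S \<Longrightarrow> h \<in> S \<Longrightarrow> g \<otimes>\<^bsub>G\<^esub> h \<in> S \<Longrightarrow> rank_dist d (\<phi> (g \<otimes>\<^bsub>G\<^esub> h)) (\<phi> g * \<phi> h) < \<eta>"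
    and D: "\<And>g. g \<in> S - {\<one>\<^bsub>G\<^esub>} \<Longrightarrow> rank_dist d (\<phi> g ^\<^sub>m M) (1\<^sub>m d) \<ge> \<kappa> / 4"
    using linear_sofic_separating_powers[OF G sof kap S M(1) tf \<eta>] by blast
  let ?D = "(2 * d) ^ n"
  have c: "\<phi> g \<in> carrier_mat d d" if "g \<in> S" for g using \<phi>[OF that] by (simp add: GL_def)
  have "rank_dist ?D (amplify n (\<phi> (g \<otimes>\<^bsub>G\<^esub> h))) (amplify n (\<phi> g) * amplify n (\<phi> h)) < \<delta>"
    if g: "g \<in> S" and h: "h \<in> S" and gh: "g \<otimes>\<^bsub>G\<^esub> h \<in> S" for g h
  proof -
    have "rank_dist ?D (amplify n (\<phi> (g \<otimes>\<^bsub>G\<^esub> h))) (amplify n (\<phi> g) * amplify n (\<phi> h))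
        \<le> real n * rank_dist d (\<phi> (g \<otimes>\<^bsub>G\<^esub> h)) (\<phi> g * \<phi> h)"
      unfolding amplify_mult[OF c[OF g] c[OF h]]
      by (rule rank_dist_amplify[OF c[OF gh] mult_carrier_mat[OF c[OF g] c[OF h]] d])
    also have "\<dots> \<le> real n * \<eta>" using AH[OF g h gh] by (intro mult_left_mono) auto
    also have "\<dots> < (real n + 1) * \<eta>" using \<eta> by (intro mult_strict_right_mono) auto
    also have "\<dots> = \<delta>" by (simp add: \<eta>_def)
    finally show ?thesis .
  qed
  moreover have "rank_dist ?D (amplify n (\<phi> g)) (1\<^sub>m ?D) \<ge> \<kappa>'" if g: "g \<in> S - {\<one>\<^bsub>G\<^esub>}" for g
    using n[OF d \<phi> D[OF g]] g by blast
  moreover have "amplify n (\<phi> g) \<in> GL ?D" if "g \<in> S" for g by (rule amplify_GL[OF \<phi>[OF that]])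
  moreover have "?D \<ge> 1" using d by simp
  ultimately show "\<exists>d\<ge>1. \<exists>\<phi> :: 'a \<Rightarrow> complex mat. (\<forall>g\<in>S. \<phi> g \<in> GL d) \<and>
        (\<forall>g\<in>S. \<forall>h\<in>S. g \<otimes>\<^bsub>G\<^esub> h \<in> S \<longrightarrow> rank_dist d (\<phi> (g \<otimes>\<^bsub>G\<^esub> h)) (\<phi> g * \<phi> h) < \<delta>) \<and>
        (\<forall>g\<in>S - {\<one>\<^bsub>G\<^esub>}. rank_dist d (\<phi> g) (1\<^sub>m d) \<ge> \<kappa>')"
    by (intro exI[of _ ?D] conjI exI[of _ "\<lambda>g. amplify n (\<phi> g)"]) blast+
qed

lemma linear_sofic_torsion_free:
  fixes G :: "('a, 'm) monoid_scheme"
  assumes G: "group G" and sof: "linear_sofic TYPE(complex) G" and tf: "torsion_free G"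
  shows "kappa_linear_sofic TYPE(complex) 1 G"
proof -
  obtain \<kappa> where \<kappa>: "0 < \<kappa>" and s: "kappa_linear_sofic TYPE(complex) \<kappa> G"
    using sof by (auto simp: linear_sofic_def)
  show ?thesis
  proof (rule kappa_linear_sofic_by_amplification[OF G s \<kappa>])
    fix \<kappa>' :: real assume "0 \<le> \<kappa>'" "\<kappa>' < 1"
    then have e: "1 - \<kappa>' > 0" and c: "\<kappa> / 4 > 0" using \<kappa> by simp_all
    obtain M N where M: "M > 0" and N: "\<forall>n\<ge>N. \<forall>d>0. \<forall>A\<in>GL d. rank_dist d (A ^\<^sub>m M) (1\<^sub>m d) \<ge> \<kappa> / 4 \<longrightarrow>
        rank_dist ((2 * d) ^ n) (amplify n A) (1\<^sub>m ((2 * d) ^ n)) \<ge> 1 - (1 - \<kappa>')"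
      using amplify_nearly_full_rank[OF c e] by blast
    have "1 - (1 - \<kappa>') = \<kappa>'" by simp
    moreover have "\<forall>g\<in>carrier G - {\<one>\<^bsub>G\<^esub>}. g [^]\<^bsub>G\<^esub> M \<noteq> \<one>\<^bsub>G\<^esub>"
      using tf M by (auto simp: torsion_free_def)
    ultimately show "\<exists>M n. M > 0 \<and> (\<forall>g\<in>carrier G - {\<one>\<^bsub>G\<^esub>}. g [^]\<^bsub>G\<^esub> M \<noteq> \<one>\<^bsub>G\<^esub>) \<and>
      (\<forall>d>0. \<forall>A\<in>GL d. rank_dist d (A ^\<^sub>m M) (1\<^sub>m d) \<ge> \<kappa> / 4 \<longrightarrow>
        rank_dist ((2 * d) ^ n) (amplify n A) (1\<^sub>m ((2 * d) ^ n)) \<ge> \<kappa>')"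
      using M N by (intro exI[of _ M] exI[of _ N]) simp
  qed
qed

lemma linear_sofic_half:
  fixes G :: "('a, 'm) monoid_scheme"
  assumes G: "group G" and sof: "linear_sofic TYPE(complex) G"
  shows "kappa_linear_sofic TYPE(complex) (1/2) G"
proof -
  obtain \<kappa> where \<kappa>: "0 < \<kappa>" and s: "kappa_linear_sofic TYPE(complex) \<kappa> G"
    using sof by (auto simp: linear_sofic_def)
  interpret G: group G by fact
  have p1: "g [^]\<^bsub>G\<^esub> (1 :: nat) = g" if "g \<in> carrier G" for g
    using G.nat_pow_Suc[of g 0] that by simp
  show ?thesis
  proof (rule kappa_linear_sofic_by_amplification[OF G s \<kappa>])
    fix \<kappa>' :: real assume "0 \<le> \<kappa>'" "\<kappa>' < 1/2"
    then have e: "1/2 - \<kappa>' > 0" and c: "\<kappa> / 4 > 0" using \<kappa> by simp_all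
    obtain n where n: "\<forall>d>0. \<forall>A\<in>GL d. rank_dist d A (1\<^sub>m d) \<ge> \<kappa> / 4 \<longrightarrow>
        rank_dist ((2 * d) ^ n) (amplify n A) (1\<^sub>m ((2 * d) ^ n)) \<ge> 1/2 - (1/2 - \<kappa>')"
      using amplify_nearly_half_rank[OF c e] by blast
    have eq: "1/2 - (1/2 - \<kappa>') = \<kappa>'" by simp
    have A1: "A ^\<^sub>m 1 = A" if "A \<in> GL d" for A :: "complex mat" and d using that by (simp add: GL_def)
    have "\<forall>g\<in>carrier G - {\<one>\<^bsub>G\<^esub>}. g [^]\<^bsub>G\<^esub> (1 :: nat) \<noteq> \<one>\<^bsub>G\<^esub>"
      using p1 by auto
    then show "\<exists>M n. M > 0 \<and> (\<forall>g\<in>carrier G - {\<one>\<^bsub>G\<^esub>}. g [^]\<^bsub>G\<^esub> M \<noteq> \<one>\<^bsub>G\<^esub>) \<and>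
      (\<forall>d>0. \<forall>A\<in>GL d. rank_dist d (A ^\<^sub>m M) (1\<^sub>m d) \<ge> \<kappa> / 4 \<longrightarrow>
        rank_dist ((2 * d) ^ n) (amplify n A) (1\<^sub>m ((2 * d) ^ n)) \<ge> \<kappa>')"
      using n unfolding eq by (intro exI[of _ "1 :: nat"] exI[of _ n]) (auto simp: A1 simp del: pow_mat.simps One_nat_def)
  qed
qed

section \<open>Elementary abelian 2-groups\<close>

text \<open>The sum of \<open>M\<^sup>* M\<close> over a list of matrices. It is positive semidefinite, so its kernel is the
intersection of the kernels of the summands, while its rank is at most the sum of their ranks.\<close>

fun gram :: "nat \<Rightarrow> complex mat list \<Rightarrow> complex mat" where
  "gram d [] = 0\<^sub>m d d"
| "gram d (M # Ms) = conj_transpose M * M + gram d Ms"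

lemma gram_carrier: "set Ms \<subseteq> carrier_mat d d \<Longrightarrow> gram d Ms \<in> carrier_mat d d"
  by (induction Ms) (auto intro: conj_transpose_carrier mult_carrier_mat)

lemma gram_quadratic_form:
  assumes "set Ms \<subseteq> carrier_mat d d" and v: "v \<in> carrier_vec d"
  shows "(\<Sum>j<d. cnj (v $ j) * (gram d Ms *\<^sub>v v) $ j)
    = complex_of_real (\<Sum>M\<leftarrow>Ms. \<Sum>i<d. (cmod ((M *\<^sub>v v) $ i))\<^sup>2)"
  using assms(1)
proof (induction Ms)
  case Nil
  then show ?case using v by (simp add: zero_mat_mult_vec)
next
  case (Cons M Ms)
  then have M: "M \<in> carrier_mat d d" and Ms: "gram d Ms \<in> carrier_mat d d" using gram_carrier by auto
  have aM: "conj_transpose M \<in> carrier_mat d d" by (rule conj_transpose_carrier[OF M])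
  have Mv: "M *\<^sub>v v \<in> carrier_vec d" using M v by (rule mult_mat_vec_carrier)
  have e: "gram d (M # Ms) *\<^sub>v v = conj_transpose M *\<^sub>v (M *\<^sub>v v) + gram d Ms *\<^sub>v v"
    unfolding gram.simps add_mult_distrib_mat_vec[OF mult_carrier_mat[OF aM M] Ms v] assoc_mult_mat_vec[OF aM M v] ..
  have c: "conj_transpose M *\<^sub>v (M *\<^sub>v v) \<in> carrier_vec d" "gram d Ms *\<^sub>v v \<in> carrier_vec d"
    using aM Mv Ms v by (auto intro: mult_mat_vec_carrier)
  have "(\<Sum>j<d. cnj (v $ j) * (gram d (M # Ms) *\<^sub>v v) $ j)
      = (\<Sum>j<d. cnj (v $ j) * (conj_transpose M *\<^sub>v (M *\<^sub>v v)) $ j) + (\<Sum>j<d. cnj (v $ j) * (gram d Ms *\<^sub>v v) $ j)"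
    unfolding e sum.distrib[symmetric] using c by (intro sum.cong refl) (simp only: index_add_vec carrier_vecD lessThan_iff distrib_left)
  also have "(\<Sum>j<d. cnj (v $ j) * (conj_transpose M *\<^sub>v (M *\<^sub>v v)) $ j) = (\<Sum>i<d. complex_of_real ((cmod ((M *\<^sub>v v) $ i))\<^sup>2))"
    unfolding conj_transpose_inner[OF M Mv v] by (intro sum.cong refl) (simp only: complex_norm_square mult.commute)
  finally show ?case using Cons by simp
qed

lemma gram_kernel:
  assumes Ms: "set Ms \<subseteq> carrier_mat d d" and v: "v \<in> carrier_vec d"
  shows "gram d Ms *\<^sub>v v = 0\<^sub>v d \<longleftrightarrow> (\<forall>M\<in>set Ms. M *\<^sub>v v = 0\<^sub>v d)"
proof
  assume "gram d Ms *\<^sub>v v = 0\<^sub>v d"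
  then have "complex_of_real (\<Sum>M\<leftarrow>Ms. \<Sum>i<d. (cmod ((M *\<^sub>v v) $ i))\<^sup>2) = 0"
    unfolding gram_quadratic_form[OF Ms v, symmetric] by simp
  then have 0: "(\<Sum>M\<leftarrow>Ms. \<Sum>i<d. (cmod ((M *\<^sub>v v) $ i))\<^sup>2) = 0" unfolding of_real_eq_0_iff .
  have "\<forall>M\<in>set Ms. (\<Sum>i<d. (cmod ((M *\<^sub>v v) $ i))\<^sup>2) = 0"
  proof -
    have "\<forall>M\<in>set Ms. f M = (0 :: real)" if "(\<Sum>M\<leftarrow>Ms. f M) = 0" "\<And>M. f M \<ge> 0" for f :: "complex mat \<Rightarrow> real"
      using that sum_list_nonneg_eq_0_iff[of "map f Ms"] by auto
    from this[OF 0] show ?thesis by (simp add: sum_nonneg)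
  qed
  then show "\<forall>M\<in>set Ms. M *\<^sub>v v = 0\<^sub>v d"
    using Ms by (auto simp: sum_nonneg_eq_0_iff intro!: eq_vecI)
next
  assume "\<forall>M\<in>set Ms. M *\<^sub>v v = 0\<^sub>v d"
  then show "gram d Ms *\<^sub>v v = 0\<^sub>v d"
    using Ms
  proof (induction Ms)
    case (Cons M Ms)
    then have M: "M \<in> carrier_mat d d" and c: "gram d Ms \<in> carrier_mat d d" using gram_carrier by auto
    have aM: "conj_transpose M \<in> carrier_mat d d" by (rule conj_transpose_carrier[OF M])
    have "gram d (M # Ms) *\<^sub>v v = conj_transpose M *\<^sub>v (M *\<^sub>v v) + gram d Ms *\<^sub>v v"
      unfolding gram.simps add_mult_distrib_mat_vec[OF mult_carrier_mat[OF aM M] c v] assoc_mult_mat_vec[OF aM M v] ..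
    then show ?case using Cons mult_mat_zero_vec[OF aM] by simp
  qed (simp add: zero_mat_mult_vec v)
qed

lemma rank_gram:
  "set Ms \<subseteq> carrier_mat d d \<Longrightarrow> vec_space.rank d (gram d Ms) \<le> (\<Sum>M\<leftarrow>Ms. vec_space.rank d M)"
proof (induction Ms)
  case Nil
  then show ?case by (simp add: vec_space.rank_0I)
next
  case (Cons M Ms)
  then have M: "M \<in> carrier_mat d d" and c: "gram d Ms \<in> carrier_mat d d" using gram_carrier by auto
  have aM: "conj_transpose M \<in> carrier_mat d d" by (rule conj_transpose_carrier[OF M])
  have aMM: "conj_transpose M * M \<in> carrier_mat d d" by (rule mult_carrier_mat[OF aM M])
  have "kernel_dim M \<le> kernel_dim (conj_transpose M * M)"
  proof -
    obtain B C where B: "B \<in> carrier_mat d (kernel_dim M)" and C: "C \<in> carrier_mat (kernel_dim M) d"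
      and CB: "C * B = 1\<^sub>m (kernel_dim M)" and f: "\<And>v. v \<in> carrier_vec (kernel_dim M) \<Longrightarrow> M *\<^sub>v (B *\<^sub>v v) = 0\<^sub>v d"
      by (rule kernel_basis_coordinates[OF M refl]) (rule that; blast)
    show ?thesis
    proof (rule kernel_dim_ge[OF aMM B C CB])
      fix v :: "complex vec" assume v: "v \<in> carrier_vec (kernel_dim M)"
      have Bv: "B *\<^sub>v v \<in> carrier_vec d" using B v by (rule mult_mat_vec_carrier)
      show "(conj_transpose M * M) *\<^sub>v (B *\<^sub>v v) = 0\<^sub>v d"
        unfolding assoc_mult_mat_vec[OF aM M Bv] f[OF v] by (rule mult_mat_zero_vec[OF aM])
    qed
  qed
  then have "vec_space.rank d (conj_transpose M * M) \<le> vec_space.rank d M"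
    using rank_plus_kernel_dim[OF M] rank_plus_kernel_dim[OF aMM] by linarith
  then show ?case using vec_space.rank_subadditive[OF aMM c] Cons by simp
qed

definition mat_trace :: "complex mat \<Rightarrow> complex" where
  "mat_trace A = (\<Sum>i<dim_row A. A $$ (i, i))"

lemma mat_trace_mult_commute:
  assumes "A \<in> carrier_mat n m" "B \<in> carrier_mat m n"
  shows "mat_trace (A * B) = mat_trace (B * A)"
proof -
  have "mat_trace (A * B) = (\<Sum>i<n. \<Sum>j<m. A $$ (i, j) * B $$ (j, i))"
    using assms by (simp add: mat_trace_def scalar_prod_def atLeast0LessThan)
  also have "\<dots> = (\<Sum>j<m. \<Sum>i<n. A $$ (i, j) * B $$ (j, i))" by (rule sum.swap)
  also have "\<dots> = mat_trace (B * A)"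
    using assms by (simp add: mat_trace_def scalar_prod_def atLeast0LessThan mult.commute)
  finally show ?thesis .
qed

lemma vec_diff_eq_zero_iff:
  fixes x y :: "'a::ab_group_add vec"
  assumes "x \<in> carrier_vec d" "y \<in> carrier_vec d"
  shows "x - y = 0\<^sub>v d \<longleftrightarrow> x = y"
  using assms by (auto simp: vec_eq_iff)

text \<open>With a basis \<open>B\<close> and coordinates \<open>C\<close> for the kernel of \<open>1 - Q\<close>, which is the image of \<open>Q\<close>, one has
\<open>Q = B C Q\<close> and \<open>Q B = B\<close>, so that \<open>Q\<close> has the same trace as \<open>C Q B = C B = 1\<close>.\<close>

lemma mat_trace_idempotent:
  assumes Q: "Q \<in> carrier_mat m m" and QQ: "Q * Q = Q"
  shows "mat_trace Q = of_nat (kernel_dim (1\<^sub>m m - Q))"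
proof -
  let ?k = "kernel_dim (1\<^sub>m m - Q)"
  have c: "1\<^sub>m m - Q \<in> carrier_mat m m" using Q by (rule minus_carrier_mat)
  have one: "(1\<^sub>m m - Q) *\<^sub>v v = v - Q *\<^sub>v v" if "v \<in> carrier_vec m" for v
    using minus_mult_distrib_mat_vec[OF one_carrier_mat Q that] that by simp
  obtain B C where B: "B \<in> carrier_mat m ?k" and C: "C \<in> carrier_mat ?k m" and CB: "C * B = 1\<^sub>m ?k"
    and f1: "\<And>v. v \<in> carrier_vec ?k \<Longrightarrow> (1\<^sub>m m - Q) *\<^sub>v (B *\<^sub>v v) = 0\<^sub>v m"
    and f2: "\<And>v. v \<in> carrier_vec m \<Longrightarrow> (1\<^sub>m m - Q) *\<^sub>v v = 0\<^sub>v m \<Longrightarrow> B *\<^sub>v (C *\<^sub>v v) = v"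
    by (rule kernel_basis_coordinates[OF c refl]) (rule that; blast)
  have QB: "Q * B = B"
  proof (rule mat_eq_by_mult_vec[of _ m ?k])
    fix v :: "complex vec" assume v: "v \<in> carrier_vec ?k"
    have Bv: "B *\<^sub>v v \<in> carrier_vec m" using B v by (rule mult_mat_vec_carrier)
    have "B *\<^sub>v v = Q *\<^sub>v (B *\<^sub>v v)"
      using f1[OF v] unfolding one[OF Bv] vec_diff_eq_zero_iff[OF Bv mult_mat_vec_carrier[OF Q Bv]] .
    then show "(Q * B) *\<^sub>v v = B *\<^sub>v v" unfolding assoc_mult_mat_vec[OF Q B v] by (rule sym)
  qed (rule mult_carrier_mat[OF Q B], rule B)
  have CQ: "C * Q \<in> carrier_mat ?k m" by (rule mult_carrier_mat[OF C Q])
  have "B * (C * Q) = Q"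
  proof (rule mat_eq_by_mult_vec[of _ m m])
    fix v :: "complex vec" assume v: "v \<in> carrier_vec m"
    have Qv: "Q *\<^sub>v v \<in> carrier_vec m" using Q v by (rule mult_mat_vec_carrier)
    have "Q *\<^sub>v (Q *\<^sub>v v) = Q *\<^sub>v v" using assoc_mult_mat_vec[OF Q Q v] QQ by simp
    then have "(1\<^sub>m m - Q) *\<^sub>v (Q *\<^sub>v v) = 0\<^sub>v m" unfolding one[OF Qv] using Qv by simp
    from f2[OF Qv this]
    show "(B * (C * Q)) *\<^sub>v v = Q *\<^sub>v v"
      unfolding assoc_mult_mat_vec[OF B CQ v] assoc_mult_mat_vec[OF C Q v] .
  qed (rule mult_carrier_mat[OF B CQ], rule Q)
  then have "mat_trace Q = mat_trace (B * (C * Q))" by simp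
  also have "\<dots> = mat_trace ((C * Q) * B)" by (rule mat_trace_mult_commute[OF B CQ])
  also have "(C * Q) * B = 1\<^sub>m ?k" unfolding assoc_mult_mat[OF C Q B] QB by (rule CB)
  also have "mat_trace (1\<^sub>m ?k) = of_nat ?k" by (simp add: mat_trace_def)
  finally show ?thesis .
qed

text \<open>The matrix \<open>(1 + A) / 2\<close> is the projection onto the fixed space of the involution \<open>A\<close>.\<close>

lemma mat_trace_involution:
  assumes A: "A \<in> carrier_mat m m" and AA: "A * A = 1\<^sub>m m"
  shows "(of_nat m + mat_trace A) / 2 = of_nat (kernel_dim (A - 1\<^sub>m m))"
proof -
  define Q where "Q = (1 / 2) \<cdot>\<^sub>m (1\<^sub>m m + A)"
  have s: "1\<^sub>m m + A \<in> carrier_mat m m" using A by simp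
  have Q: "Q \<in> carrier_mat m m" using s by (simp add: Q_def)
  have "(1\<^sub>m m + A) * (1\<^sub>m m + A) = (1\<^sub>m m + A) + (A + 1\<^sub>m m)"
    unfolding add_mult_distrib_mat[OF one_carrier_mat A s] mult_add_distrib_mat[OF A one_carrier_mat A] AA
      left_mult_one_mat[OF s] right_mult_one_mat[OF A] ..
  then have "Q * Q = (1 / 2) \<cdot>\<^sub>m ((1 / 2) \<cdot>\<^sub>m ((1\<^sub>m m + A) + (A + 1\<^sub>m m)))"
    unfolding Q_def using s by (simp add: mult_smult_assoc_mat[of _ m m _ m] mult_smult_distrib[of _ m m _ m])
  also have "\<dots> = Q" unfolding Q_def using A by (intro eq_matI) (auto simp: field_simps)
  finally have QQ: "Q * Q = Q" .
  have c: "1\<^sub>m m - Q \<in> carrier_mat m m" "A - 1\<^sub>m m \<in> carrier_mat m m" using Q by (auto intro: minus_carrier_mat)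
  have eq: "1\<^sub>m m - Q = (- 1 / 2) \<cdot>\<^sub>m (A - 1\<^sub>m m)"
    unfolding Q_def using A by (intro eq_matI) (auto simp: field_simps)
  have "mat_kernel (1\<^sub>m m - Q) = mat_kernel (A - 1\<^sub>m m)"
    unfolding eq by (rule mat_kernel_smult_eq[OF c(2)]) simp
  then have "kernel_dim (1\<^sub>m m - Q) = kernel_dim (A - 1\<^sub>m m)"
    unfolding kernel_dim_def carrier_matD(2)[OF c(1)] carrier_matD(2)[OF c(2)] by simp
  moreover have "mat_trace Q = (of_nat m + mat_trace A) / 2"
    using A by (simp add: Q_def mat_trace_def sum.distrib sum_divide_distrib[symmetric])
  ultimately show ?thesis using mat_trace_idempotent[OF Q QQ] by simp
qed

text \<open>The elementary abelian group of order \<open>2 ^ n\<close>, realised on binary numerals.\<close>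

definition xor_group :: "nat \<Rightarrow> nat monoid" where
  "xor_group n = \<lparr>carrier = {..<2 ^ n}, monoid.mult = xor, one = 0\<rparr>"

lemma xor_less: "a < 2 ^ n \<Longrightarrow> b < 2 ^ n \<Longrightarrow> xor a b < (2 :: nat) ^ n"
  by (metis take_bit_nat_eq_self_iff take_bit_xor)

lemma group_xor: "group (xor_group n)"
proof (rule groupI)
  fix x assume "x \<in> carrier (xor_group n)"
  then show "\<exists>y\<in>carrier (xor_group n). y \<otimes>\<^bsub>xor_group n\<^esub> x = \<one>\<^bsub>xor_group n\<^esub>"
    by (intro bexI[of _ x]) (auto simp: xor_group_def)
qed (auto simp: xor_group_def xor_less xor.assoc)

lemma xor_cancel_left: "xor g (xor g x) = (x :: nat)"
  by (simp flip: xor.assoc)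

lemma bij_betw_xor: "g < 2 ^ n \<Longrightarrow> bij_betw (xor g) {..<2 ^ n} {..<(2 :: nat) ^ n}"
  by (rule bij_betw_byWitness[where f' = "xor g"]) (auto simp: xor_cancel_left xor_less)

text \<open>The average \<open>P\<close> of the matrices is idempotent, so its trace is a dimension.\<close>

lemma xor_rep_trace_nonneg:
  fixes A :: "nat \<Rightarrow> complex mat"
  assumes A: "\<And>g. g < 2 ^ n \<Longrightarrow> A g \<in> carrier_mat m m"
    and mult: "\<And>g k. g < 2 ^ n \<Longrightarrow> k < 2 ^ n \<Longrightarrow> A g * A k = A (xor g k)"
  shows "0 \<le> Re (\<Sum>g<2 ^ n. mat_trace (A g))"
proof -
  let ?h = "(2 :: nat) ^ n"
  define h :: complex where "h = of_nat ?h"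
  have h: "h \<noteq> 0" by (simp add: h_def)
  define P where "P = mat m m (\<lambda>(i, j). (\<Sum>g<?h. A g $$ (i, j)) / h)"
  have P: "P \<in> carrier_mat m m" by (simp add: P_def)
  have "P * P = P"
  proof (rule eq_matI)
    fix i j assume "i < dim_row P" "j < dim_col P"
    then have i: "i < m" and j: "j < m" by (auto simp: P_def)
    have ent: "(\<Sum>l<m. A g $$ (i, l) * A k $$ (l, j)) = A (xor g k) $$ (i, j)" if "g < ?h" "k < ?h" for g k
      unfolding mult[OF that, symmetric] using A[OF that(1)] A[OF that(2)] i j by (simp add: scalar_prod_def atLeast0LessThan)
    have "(P * P) $$ (i, j) = (\<Sum>l<m. ((\<Sum>g<?h. A g $$ (i, l)) / h) * ((\<Sum>k<?h. A k $$ (l, j)) / h))"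
      using i j by (simp add: P_def scalar_prod_def atLeast0LessThan)
    also have "\<dots> = (\<Sum>l<m. \<Sum>g<?h. \<Sum>k<?h. A g $$ (i, l) * A k $$ (l, j)) / (h * h)"
      unfolding sum_divide_distrib[of _ _ "h * h"] by (intro sum.cong refl) (simp add: sum_product sum_divide_distrib)
    also have "(\<Sum>l<m. \<Sum>g<?h. \<Sum>k<?h. A g $$ (i, l) * A k $$ (l, j)) = (\<Sum>g<?h. \<Sum>l<m. \<Sum>k<?h. A g $$ (i, l) * A k $$ (l, j))"
      by (rule sum.swap)
    also have "\<dots> = (\<Sum>g<?h. \<Sum>k<?h. \<Sum>l<m. A g $$ (i, l) * A k $$ (l, j))"
      by (rule sum.cong[OF refl]) (rule sum.swap)
    also have "\<dots> = (\<Sum>g<?h. \<Sum>k<?h. A (xor g k) $$ (i, j))"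
      by (intro sum.cong refl ent) auto
    also have "\<dots> = (\<Sum>g<?h. \<Sum>k<?h. A k $$ (i, j))"
      by (intro sum.cong refl sum.reindex_bij_betw bij_betw_xor) auto
    also have "\<dots> / (h * h) = P $$ (i, j)" using h i j by (simp add: P_def h_def)
    finally show "(P * P) $$ (i, j) = P $$ (i, j)" .
  qed (auto simp: P_def)
  from mat_trace_idempotent[OF P this] have trP: "mat_trace P = of_nat (kernel_dim (1\<^sub>m m - P))" .
  have trA: "mat_trace (A g) = (\<Sum>i<m. A g $$ (i, i))" if "g < ?h" for g using A[OF that] by (simp add: mat_trace_def)
  have "(\<Sum>g<?h. mat_trace (A g)) = (\<Sum>g<?h. \<Sum>i<m. A g $$ (i, i))" by (intro sum.cong refl trA) auto
  also have "\<dots> = (\<Sum>i<m. \<Sum>g<?h. A g $$ (i, i))" by (rule sum.swap)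
  also have "\<dots> = h * mat_trace P" using h by (simp add: mat_trace_def P_def sum_divide_distrib[symmetric])
  finally have "(\<Sum>g<?h. mat_trace (A g)) = of_nat (?h * kernel_dim (1\<^sub>m m - P))" unfolding trP h_def by simp
  then show ?thesis by simp
qed

lemma xor_rep_kernel_sum:
  fixes A :: "nat \<Rightarrow> complex mat"
  assumes A: "\<And>g. g < 2 ^ n \<Longrightarrow> A g \<in> carrier_mat m m"
    and mult: "\<And>g k. g < 2 ^ n \<Longrightarrow> k < 2 ^ n \<Longrightarrow> A g * A k = A (xor g k)"
    and one: "A 0 = 1\<^sub>m m"
  shows "real (2 ^ n * m) / 2 \<le> (\<Sum>g<2 ^ n. real (kernel_dim (A g - 1\<^sub>m m)))"
proof -
  let ?h = "(2 :: nat) ^ n"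
  have "real (kernel_dim (A g - 1\<^sub>m m)) = (real m + Re (mat_trace (A g))) / 2" if g: "g < ?h" for g
  proof -
    have "A g * A g = 1\<^sub>m m" using mult[OF g g] one by simp
    from mat_trace_involution[OF A[OF g] this]
    have "Re ((of_nat m + mat_trace (A g)) / 2) = Re (of_nat (kernel_dim (A g - 1\<^sub>m m)))" by (rule arg_cong)
    then show ?thesis by simp
  qed
  then have "(\<Sum>g<?h. real (kernel_dim (A g - 1\<^sub>m m))) = (\<Sum>g<?h. (real m + Re (mat_trace (A g))) / 2)"
    by (intro sum.cong refl) auto
  also have "\<dots> = (real (?h * m) + Re (\<Sum>g<?h. mat_trace (A g))) / 2"
    by (simp add: sum_divide_distrib[symmetric] sum.distrib)
  finally show ?thesis using xor_rep_trace_nonneg[of n A m, OF A mult] by simp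
qed

text \<open>Let \<open>W\<close> be the space of all \<open>v\<close> with \<open>\<phi> (g k) v = \<phi> g (\<phi> k v)\<close> for all \<open>g\<close> and \<open>k\<close>; it is the kernel of
the matrix \<open>N\<close> and has codimension at most \<open>h\<^sup>2 \<delta> d\<close>. It is invariant under every \<open>\<phi> k\<close>: for \<open>v\<close> in \<open>W\<close>,
both \<open>\<phi> (g l) (\<phi> k v)\<close> and \<open>\<phi> g (\<phi> l (\<phi> k v))\<close> are equal to \<open>\<phi> (g l k) v\<close>. In a basis \<open>B\<close> of \<open>W\<close> with
coordinates \<open>C\<close> the map \<open>\<phi>\<close> becomes the representation \<open>A g = C \<phi>(g) B\<close>, to which
\<open>xor_rep_kernel_sum\<close> applies, and a vector fixed by \<open>A g\<close> gives a vector fixed by \<open>\<phi> g\<close>.\<close>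

lemma approximate_xor_rep_rank_sum:
  fixes \<phi> :: "nat \<Rightarrow> complex mat"
  assumes GL: "\<And>g. g < 2 ^ n \<Longrightarrow> \<phi> g \<in> GL d" and d: "d > 0"
    and AH: "\<And>g k. g < 2 ^ n \<Longrightarrow> k < 2 ^ n \<Longrightarrow> rank_dist d (\<phi> (xor g k)) (\<phi> g * \<phi> k) \<le> \<delta>"
  shows "(\<Sum>g<2 ^ n. rank_dist d (\<phi> g) (1\<^sub>m d)) \<le> real (2 ^ n) / 2 + real (2 ^ n) ^ 3 * \<delta> / 2"
proof -
  let ?h = "(2 :: nat) ^ n" and ?x = "xor :: nat \<Rightarrow> nat \<Rightarrow> nat"
  have c: "\<phi> g \<in> carrier_mat d d" if "g < ?h" for g using GL[OF that] by (simp add: GL_def)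
  have inv: "v = 0\<^sub>v d" if g: "g < ?h" and v: "v \<in> carrier_vec d" and z: "\<phi> g *\<^sub>v v = 0\<^sub>v d" for g v
  proof -
    obtain B where B: "B \<in> carrier_mat d d" "B * \<phi> g = 1\<^sub>m d" using GL[OF g] unfolding GL_iff by blast
    have "B *\<^sub>v (\<phi> g *\<^sub>v v) = v" using assoc_mult_mat_vec[OF B(1) c[OF g] v] B(2) v by simp
    then show ?thesis unfolding z mult_mat_zero_vec[OF B(1)] by (rule sym)
  qed
  define E where "E g k = \<phi> (?x g k) - \<phi> g * \<phi> k" for g k
  define Ms where "Ms = map (\<lambda>(g, k). E g k) (List.product [0..<?h] [0..<?h])"
  have lenMs: "length Ms = ?h * ?h" by (simp add: Ms_def)
  have E: "E g k \<in> carrier_mat d d" if "g < ?h" "k < ?h" for g k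
    unfolding E_def by (rule minus_carrier_mat[OF mult_carrier_mat[OF c[OF that(1)] c[OF that(2)]]])
  have setMs: "set Ms = {E g k | g k. g < ?h \<and> k < ?h}" unfolding Ms_def by auto blast
  have Ms: "set Ms \<subseteq> carrier_mat d d" unfolding setMs using E by auto
  define N where "N = gram d Ms"
  have N: "N \<in> carrier_mat d d" unfolding N_def by (rule gram_carrier[OF Ms])
  define m where "m = kernel_dim N"
  have Nker: "N *\<^sub>v v = 0\<^sub>v d \<longleftrightarrow> (\<forall>g<?h. \<forall>k<?h. \<phi> (?x g k) *\<^sub>v v = \<phi> g *\<^sub>v (\<phi> k *\<^sub>v v))" if v: "v \<in> carrier_vec d" for v
  proof -
    have "E g k *\<^sub>v v = 0\<^sub>v d \<longleftrightarrow> \<phi> (?x g k) *\<^sub>v v = \<phi> g *\<^sub>v (\<phi> k *\<^sub>v v)" if gk: "g < ?h" "k < ?h" for g k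
    proof -
      have e: "E g k *\<^sub>v v = \<phi> (?x g k) *\<^sub>v v - \<phi> g *\<^sub>v (\<phi> k *\<^sub>v v)"
        unfolding E_def using minus_mult_distrib_mat_vec[OF c[OF xor_less[OF gk]] mult_carrier_mat[OF c[OF gk(1)] c[OF gk(2)]] v]
          assoc_mult_mat_vec[OF c[OF gk(1)] c[OF gk(2)] v] by simp
      have ca: "\<phi> (?x g k) *\<^sub>v v \<in> carrier_vec d" by (rule mult_mat_vec_carrier[OF c[OF xor_less[OF gk]] v])
      have cb: "\<phi> g *\<^sub>v (\<phi> k *\<^sub>v v) \<in> carrier_vec d"
        by (rule mult_mat_vec_carrier[OF c[OF gk(1)] mult_mat_vec_carrier[OF c[OF gk(2)] v]])
      show ?thesis unfolding e by (rule vec_diff_eq_zero_iff[OF ca cb])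
    qed
    then show ?thesis unfolding N_def gram_kernel[OF Ms v] setMs by blast
  qed
  obtain B C where B: "B \<in> carrier_mat d m" and C: "C \<in> carrier_mat m d" and CB: "C * B = 1\<^sub>m m"
    and f1: "\<And>v. v \<in> carrier_vec m \<Longrightarrow> N *\<^sub>v (B *\<^sub>v v) = 0\<^sub>v d"
    and f2: "\<And>v. v \<in> carrier_vec d \<Longrightarrow> N *\<^sub>v v = 0\<^sub>v d \<Longrightarrow> B *\<^sub>v (C *\<^sub>v v) = v"
    by (rule kernel_basis_coordinates[OF N m_def[symmetric]]) (rule that; blast)
  have Bc: "B *\<^sub>v v \<in> carrier_vec d" if "v \<in> carrier_vec m" for v by (rule mult_mat_vec_carrier[OF B that])
  have hom: "\<phi> (?x g k) *\<^sub>v (B *\<^sub>v v) = \<phi> g *\<^sub>v (\<phi> k *\<^sub>v (B *\<^sub>v v))" if "g < ?h" "k < ?h" "v \<in> carrier_vec m" for g k v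
    using f1[OF that(3)] Nker[OF Bc[OF that(3)]] that by blast
  have stable: "N *\<^sub>v (\<phi> k *\<^sub>v (B *\<^sub>v v)) = 0\<^sub>v d" if k: "k < ?h" and v: "v \<in> carrier_vec m" for k v
  proof -
    have cv: "\<phi> k *\<^sub>v (B *\<^sub>v v) \<in> carrier_vec d" by (rule mult_mat_vec_carrier[OF c[OF k] Bc[OF v]])
    have "\<phi> (?x g l) *\<^sub>v (\<phi> k *\<^sub>v (B *\<^sub>v v)) = \<phi> g *\<^sub>v (\<phi> l *\<^sub>v (\<phi> k *\<^sub>v (B *\<^sub>v v)))" if g: "g < ?h" and l: "l < ?h" for g l
      using hom[OF xor_less[OF g l] k v] hom[OF g xor_less[OF l k] v] hom[OF l k v] by (simp add: xor.assoc)
    then show ?thesis unfolding Nker[OF cv] by blast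
  qed
  define A where "A g = C * (\<phi> g * B)" for g
  have gB: "\<phi> g * B \<in> carrier_mat d m" if "g < ?h" for g by (rule mult_carrier_mat[OF c[OF that] B])
  have A: "A g \<in> carrier_mat m m" if "g < ?h" for g unfolding A_def by (rule mult_carrier_mat[OF C gB[OF that]])
  have Av: "A g *\<^sub>v v = C *\<^sub>v (\<phi> g *\<^sub>v (B *\<^sub>v v))" if g: "g < ?h" and v: "v \<in> carrier_vec m" for g v
    unfolding A_def assoc_mult_mat_vec[OF C gB[OF g] v] assoc_mult_mat_vec[OF c[OF g] B v] ..
  have BA: "B *\<^sub>v (A g *\<^sub>v v) = \<phi> g *\<^sub>v (B *\<^sub>v v)" if g: "g < ?h" and v: "v \<in> carrier_vec m" for g v
    unfolding Av[OF g v] by (rule f2[OF mult_mat_vec_carrier[OF c[OF g] Bc[OF v]] stable[OF g v]])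
  have AA: "A g * A k = A (?x g k)" if g: "g < ?h" and k: "k < ?h" for g k
  proof (rule mat_eq_by_mult_vec[of _ m m])
    fix v :: "complex vec" assume v: "v \<in> carrier_vec m"
    have Akv: "A k *\<^sub>v v \<in> carrier_vec m" by (rule mult_mat_vec_carrier[OF A[OF k] v])
    show "(A g * A k) *\<^sub>v v = A (?x g k) *\<^sub>v v"
      unfolding assoc_mult_mat_vec[OF A[OF g] A[OF k] v] Av[OF g Akv] BA[OF k v] Av[OF xor_less[OF g k] v] hom[OF g k v] ..
  qed (rule mult_carrier_mat[OF A[OF g] A[OF k]], rule A[OF xor_less[OF g k]])
  \<comment> \<open>\<open>\<phi> 0\<close> is idempotent on the invariant space and injective, hence the identity there\<close>
  have A0: "A 0 = 1\<^sub>m m"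
  proof (rule mat_eq_by_mult_vec[of _ m m])
    fix v :: "complex vec" assume v: "v \<in> carrier_vec m"
    have z: "(0 :: nat) < ?h" by simp
    let ?w = "B *\<^sub>v v"
    have pw: "\<phi> 0 *\<^sub>v ?w \<in> carrier_vec d" by (rule mult_mat_vec_carrier[OF c[OF z] Bc[OF v]])
    have "\<phi> 0 *\<^sub>v (\<phi> 0 *\<^sub>v ?w - ?w) = \<phi> 0 *\<^sub>v (\<phi> 0 *\<^sub>v ?w) - \<phi> 0 *\<^sub>v ?w"
      by (rule mult_minus_distrib_mat_vec[OF c[OF z] pw Bc[OF v]])
    also have "\<dots> = 0\<^sub>v d" using hom[OF z z v] mult_mat_vec_carrier[OF c[OF z] pw] pw by simp
    finally have "\<phi> 0 *\<^sub>v ?w - ?w = 0\<^sub>v d" by (rule inv[OF z minus_carrier_vec[OF pw Bc[OF v]]])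
    then have "\<phi> 0 *\<^sub>v ?w = ?w" unfolding vec_diff_eq_zero_iff[OF pw Bc[OF v]] .
    then show "A 0 *\<^sub>v v = 1\<^sub>m m *\<^sub>v v"
      unfolding Av[OF z v] using assoc_mult_mat_vec[OF C B v] CB by simp
  qed (rule A, simp, simp)
  have ker: "kernel_dim (A g - 1\<^sub>m m) \<le> kernel_dim (\<phi> g - 1\<^sub>m d)" if g: "g < ?h" for g
  proof -
    let ?k = "kernel_dim (A g - 1\<^sub>m m)"
    have cA: "A g - 1\<^sub>m m \<in> carrier_mat m m" by (rule minus_carrier_mat[OF one_carrier_mat])
    have cp: "\<phi> g - 1\<^sub>m d \<in> carrier_mat d d" by (rule minus_carrier_mat[OF one_carrier_mat])
    obtain B' C' where B': "B' \<in> carrier_mat m ?k" and C': "C' \<in> carrier_mat ?k m" and CB': "C' * B' = 1\<^sub>m ?k"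
      and f': "\<And>v. v \<in> carrier_vec ?k \<Longrightarrow> (A g - 1\<^sub>m m) *\<^sub>v (B' *\<^sub>v v) = 0\<^sub>v m"
      by (rule kernel_basis_coordinates[OF cA refl]) (rule that; blast)
    have "(C' * C) * (B * B') = C' * ((C * B) * B')"
      using assoc_mult_mat[OF C' C mult_carrier_mat[OF B B']] assoc_mult_mat[OF C B B'] by simp
    also have "\<dots> = 1\<^sub>m ?k" unfolding CB left_mult_one_mat[OF B'] by (rule CB')
    finally have inv: "(C' * C) * (B * B') = 1\<^sub>m ?k" .
    show ?thesis
    proof (rule kernel_dim_ge[OF cp mult_carrier_mat[OF B B'] mult_carrier_mat[OF C' C] inv])
      fix v :: "complex vec" assume v: "v \<in> carrier_vec ?k"
      let ?u = "B' *\<^sub>v v"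
      have u: "?u \<in> carrier_vec m" by (rule mult_mat_vec_carrier[OF B' v])
      have Au: "A g *\<^sub>v ?u \<in> carrier_vec m" by (rule mult_mat_vec_carrier[OF A[OF g] u])
      have "A g *\<^sub>v ?u - ?u = 0\<^sub>v m"
        using f'[OF v] minus_mult_distrib_mat_vec[OF A[OF g] one_carrier_mat u] u by simp
      then have "A g *\<^sub>v ?u = ?u" unfolding vec_diff_eq_zero_iff[OF Au u] .
      then have "\<phi> g *\<^sub>v (B *\<^sub>v ?u) = B *\<^sub>v ?u" using BA[OF g u] by simp
      then show "(\<phi> g - 1\<^sub>m d) *\<^sub>v ((B * B') *\<^sub>v v) = 0\<^sub>v d"
        unfolding assoc_mult_mat_vec[OF B B' v]
        using minus_mult_distrib_mat_vec[OF c[OF g] one_carrier_mat Bc[OF u]] Bc[OF u] by simp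
    qed
  qed
  have rankE: "real (vec_space.rank d (E g k)) \<le> \<delta> * real d" if "g < ?h" "k < ?h" for g k
    using AH[OF that] d by (simp add: rank_dist_def E_def pos_divide_le_eq)
  have "real (vec_space.rank d N) \<le> (\<Sum>M\<leftarrow>Ms. real (vec_space.rank d M))"
  proof -
    have "real (\<Sum>M\<leftarrow>Ms. vec_space.rank d M) = (\<Sum>M\<leftarrow>Ms. real (vec_space.rank d M))" by (induction Ms) auto
    moreover have "real (vec_space.rank d N) \<le> real (\<Sum>M\<leftarrow>Ms. vec_space.rank d M)"
      unfolding of_nat_le_iff N_def by (rule rank_gram[OF Ms])
    ultimately show ?thesis by simp
  qed
  also have "\<dots> \<le> (\<Sum>M\<leftarrow>Ms. \<delta> * real d)"
    using rankE setMs by (intro sum_list_mono) auto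
  also have "\<dots> = real ?h * real ?h * (\<delta> * real d)" by (simp add: sum_list_triv lenMs)
  finally have "real d - real ?h * real ?h * (\<delta> * real d) \<le> real m"
    using arg_cong[OF rank_plus_kernel_dim[OF N], of real] unfolding m_def[symmetric] by simp
  then have "(1 - real ?h * real ?h * \<delta>) * real d \<le> real m" by (simp add: algebra_simps)
  then have md: "1 - real ?h * real ?h * \<delta> \<le> real m / real d"
    using d by (simp only: pos_le_divide_eq of_nat_0_less_iff)
  have "real (?h * m) / 2 \<le> (\<Sum>g<?h. real (kernel_dim (A g - 1\<^sub>m m)))"
    by (rule xor_rep_kernel_sum[OF A AA A0])
  also have "\<dots> \<le> (\<Sum>g<?h. real (kernel_dim (\<phi> g - 1\<^sub>m d)))"
    using ker by (intro sum_mono) simp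
  finally have K: "real (?h * m) / 2 \<le> (\<Sum>g<?h. real (kernel_dim (\<phi> g - 1\<^sub>m d)))" .
  have "(\<Sum>g<?h. rank_dist d (\<phi> g) (1\<^sub>m d)) = (\<Sum>g<?h. 1 - real (kernel_dim (\<phi> g - 1\<^sub>m d)) / real d)"
    by (intro sum.cong refl rank_dist_kernel_dim c one_carrier_mat d) auto
  also have "\<dots> = real ?h - (\<Sum>g<?h. real (kernel_dim (\<phi> g - 1\<^sub>m d))) / real d"
    by (simp add: sum_subtractf sum_divide_distrib)
  also have "\<dots> \<le> real ?h - (real (?h * m) / 2) / real d"
    by (intro diff_left_mono divide_right_mono K) simp
  also have "\<dots> = real ?h - (real ?h / 2) * (real m / real d)" by simp
  also have "\<dots> \<le> real ?h - (real ?h / 2) * (1 - real ?h * real ?h * \<delta>)"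
    by (intro diff_left_mono mult_left_mono md) simp
  also have "\<dots> = real ?h / 2 + real ?h ^ 3 * \<delta> / 2" by (simp add: power3_eq_cube field_simps)
  finally show ?thesis .
qed

text \<open>If all \<open>h - 1\<close> nontrivial elements had rank distance at least \<open>\<kappa>' > 1/2\<close> from the identity, the sum of
the distances would exceed \<open>h / 2\<close> by a definite amount for large \<open>h\<close>, contrary to
\<open>approximate_xor_rep_rank_sum\<close> with small \<open>\<delta>\<close>.\<close>

lemma xor_group_not_kappa:
  assumes \<kappa>: "1 / 2 < \<kappa>"
  shows "\<exists>n. \<not> kappa_linear_sofic TYPE(complex) \<kappa> (xor_group n)"
proof -
  define \<kappa>' where "\<kappa>' = (\<kappa> + 1 / 2) / 2"
  have k': "0 \<le> \<kappa>'" "\<kappa>' < \<kappa>" "1 / 2 < \<kappa>'" using \<kappa> by (auto simp: \<kappa>'_def field_simps)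
  \<comment> \<open>this makes \<open>(h - 1) \<kappa>'\<close> larger than \<open>h / 2\<close>\<close>
  obtain n where n: "\<kappa>' / (\<kappa>' - 1 / 2) < real 2 ^ n"
    using real_arch_pow[of 2 "\<kappa>' / (\<kappa>' - 1 / 2)"] by auto
  let ?h = "(2 :: nat) ^ n"
  define h where "h = real ?h"
  have h: "h \<ge> 1" by (simp add: h_def)
  have "\<kappa>' < h * (\<kappa>' - 1 / 2)" using n k' by (simp add: pos_divide_less_eq h_def)
  then have gap: "h / 2 < (h - 1) * \<kappa>'" by (simp add: algebra_simps)
  \<comment> \<open>the error term \<open>h\<^sup>3 \<delta> / 2\<close> is then half of the gap between \<open>(h - 1) \<kappa>'\<close> and \<open>h / 2\<close>\<close>
  define \<delta> where "\<delta> = ((h - 1) * \<kappa>' - h / 2) / h ^ 3"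
  have h3: "h ^ 3 > 0" using h by simp
  have \<delta>: "\<delta> > 0" unfolding \<delta>_def using gap h3 by (intro divide_pos_pos) auto
  have "\<not> kappa_linear_sofic TYPE(complex) \<kappa> (xor_group n)"
  proof
    assume sof: "kappa_linear_sofic TYPE(complex) \<kappa> (xor_group n)"
    have S: "{..<?h} \<subseteq> carrier (xor_group n)" "finite {..<?h}" by (auto simp: xor_group_def)
    from sof[unfolded kappa_linear_sofic_def, THEN spec[of _ "{..<?h}"], THEN spec[of _ \<delta>], THEN spec[of _ \<kappa>'],
      THEN mp, OF S(1), THEN mp, OF S(2), THEN mp, OF \<delta>, THEN mp, OF k'(1), THEN mp, OF k'(2)]
    obtain d and \<phi> :: "nat \<Rightarrow> complex mat" where d: "d \<ge> 1" and GL: "\<forall>g\<in>{..<?h}. \<phi> g \<in> GL d"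
      and AH: "\<forall>g\<in>{..<?h}. \<forall>k\<in>{..<?h}. g \<otimes>\<^bsub>xor_group n\<^esub> k \<in> {..<?h} \<longrightarrow>
        rank_dist d (\<phi> (g \<otimes>\<^bsub>xor_group n\<^esub> k)) (\<phi> g * \<phi> k) < \<delta>"
      and D: "\<forall>g\<in>{..<?h} - {\<one>\<^bsub>xor_group n\<^esub>}. rank_dist d (\<phi> g) (1\<^sub>m d) \<ge> \<kappa>'"
      by (elim exE conjE) (rule that)
    have AH': "rank_dist d (\<phi> (xor g k)) (\<phi> g * \<phi> k) \<le> \<delta>" if "g < ?h" "k < ?h" for g k
      using AH[rule_format, of g k] that xor_less[OF that] by (simp add: xor_group_def)
    have "(h - 1) * \<kappa>' = (\<Sum>g\<in>{..<?h} - {0}. \<kappa>')" by (simp add: h_def card_Diff_singleton of_nat_diff)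
    also have "\<dots> \<le> (\<Sum>g\<in>{..<?h} - {0}. rank_dist d (\<phi> g) (1\<^sub>m d))"
      using D by (intro sum_mono) (auto simp: xor_group_def)
    also have "\<dots> \<le> (\<Sum>g<?h. rank_dist d (\<phi> g) (1\<^sub>m d))"
      by (intro sum_mono2) (auto simp: rank_dist_def)
    also have "\<dots> \<le> real ?h / 2 + real ?h ^ 3 * \<delta> / 2"
      using GL d AH' by (intro approximate_xor_rep_rank_sum) auto
    also have "\<dots> = h / 2 + ((h - 1) * \<kappa>' - h / 2) / 2"
      unfolding h_def[symmetric] using h3 by (simp add: \<delta>_def)
    finally show False using gap by (simp add: field_simps)
  qed
  then show ?thesis by blast
qed

text \<open>The regular representation is exact and faithful, and a nonzero matrix of size \<open>h\<close> has normalised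
rank at least \<open>1 / h\<close>.\<close>

lemma xor_group_linear_sofic: "linear_sofic TYPE(complex) (xor_group n)"
proof -
  let ?h = "(2 :: nat) ^ n" and ?x = "xor :: nat \<Rightarrow> nat \<Rightarrow> nat"
  define R :: "nat \<Rightarrow> complex mat" where "R g = mat ?h ?h (\<lambda>(i, j). if i = ?x g j then 1 else 0)" for g
  have R: "R g \<in> carrier_mat ?h ?h" for g by (simp add: R_def)
  have RR: "R g * R k = R (?x g k)" if k: "k < ?h" for g k
  proof (rule eq_matI)
    fix i j assume "i < dim_row (R (?x g k))" "j < dim_col (R (?x g k))"
    then have i: "i < ?h" and j: "j < ?h" by (auto simp: R_def)
    have "(R g * R k) $$ (i, j) = (\<Sum>l<?h. (if i = ?x g l then 1 else 0) * (if l = ?x k j then 1 else 0))"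
      using i j by (simp add: R_def scalar_prod_def atLeast0LessThan)
    also have "\<dots> = (\<Sum>l<?h. if l = ?x k j then (if i = ?x g l then 1 else 0) else 0)"
      by (intro sum.cong) auto
    also have "\<dots> = (if i = ?x g (?x k j) then 1 else 0)"
      using xor_less[OF k j] by (simp add: sum.delta)
    also have "\<dots> = R (?x g k) $$ (i, j)" using i j by (simp add: R_def xor.assoc)
    finally show "(R g * R k) $$ (i, j) = R (?x g k) $$ (i, j)" .
  qed (auto simp: R_def)
  have R0: "R 0 = 1\<^sub>m ?h" by (intro eq_matI) (auto simp: R_def)
  have GL: "R g \<in> GL ?h" if "g < ?h" for g
    unfolding GL_iff using R RR[OF that, of g] R0 by (intro conjI bexI[of _ "R g"]) auto
  have zero: "rank_dist ?h (R (?x g k)) (R g * R k) = 0" if "k < ?h" for g k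
  proof -
    have "R (?x g k) - R g * R k = 0\<^sub>m ?h ?h" unfolding RR[OF that] using R by simp
    then show ?thesis by (simp add: rank_dist_def vec_space.rank_0I)
  qed
  have pos: "1 / real ?h \<le> rank_dist ?h (R g) (1\<^sub>m ?h)" if g: "g < ?h" "g \<noteq> 0" for g
  proof -
    define M where "M = R g - 1\<^sub>m ?h"
    have M: "M \<in> carrier_mat ?h ?h" unfolding M_def by (rule minus_carrier_mat[OF one_carrier_mat])
    have "vec_space.rank ?h M \<noteq> 0"
    proof
      assume "vec_space.rank ?h M = 0"
      then have k: "kernel_dim M = ?h" using rank_plus_kernel_dim[OF M] by simp
      obtain B C where B: "B \<in> carrier_mat ?h ?h" and C: "C \<in> carrier_mat ?h ?h" and CB: "C * B = 1\<^sub>m ?h"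
        and f: "\<And>v. v \<in> carrier_vec ?h \<Longrightarrow> M *\<^sub>v (B *\<^sub>v v) = 0\<^sub>v ?h"
        by (rule kernel_basis_coordinates[OF M k]) (rule that; blast)
      have BC: "B * C = 1\<^sub>m ?h" by (rule mat_mult_left_right_inverse[OF C B CB])
      have u: "unit_vec ?h 0 \<in> carrier_vec ?h" by simp
      have Cu: "C *\<^sub>v unit_vec ?h 0 \<in> carrier_vec ?h" by (rule mult_mat_vec_carrier[OF C u])
      have "B *\<^sub>v (C *\<^sub>v unit_vec ?h 0) = unit_vec ?h 0" using assoc_mult_mat_vec[OF B C u] BC by simp
      then have "M *\<^sub>v unit_vec ?h 0 = 0\<^sub>v ?h" using f[OF Cu] by simp
      then have "(M *\<^sub>v unit_vec ?h 0) $ g = 0" using g by simp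
      moreover have "(M *\<^sub>v unit_vec ?h 0) $ g = 1"
        using g M by (simp add: scalar_prod_right_unit M_def R_def)
      ultimately show False by simp
    qed
    then have "1 \<le> real (vec_space.rank ?h M)" by simp
    then show ?thesis unfolding rank_dist_def M_def by (intro divide_right_mono) auto
  qed
  have "kappa_linear_sofic TYPE(complex) (1 / real ?h) (xor_group n)"
    unfolding kappa_linear_sofic_def
  proof (intro allI impI)
    fix S \<delta> \<kappa>'
    assume S: "S \<subseteq> carrier (xor_group n)" and \<delta>: "(0 :: real) < \<delta>" and \<kappa>': "\<kappa>' < 1 / real ?h"
    have S': "g < ?h" if "g \<in> S" for g using S that by (auto simp: xor_group_def)
    show "\<exists>d\<ge>1. \<exists>\<phi> :: nat \<Rightarrow> complex mat. (\<forall>g\<in>S. \<phi> g \<in> GL d) \<and>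
        (\<forall>g\<in>S. \<forall>h\<in>S. g \<otimes>\<^bsub>xor_group n\<^esub> h \<in> S \<longrightarrow> rank_dist d (\<phi> (g \<otimes>\<^bsub>xor_group n\<^esub> h)) (\<phi> g * \<phi> h) < \<delta>) \<and>
        (\<forall>g\<in>S - {\<one>\<^bsub>xor_group n\<^esub>}. rank_dist d (\<phi> g) (1\<^sub>m d) \<ge> \<kappa>')"
    proof (intro exI[of _ ?h] exI[of _ R] conjI ballI impI)
      fix g assume "g \<in> S - {\<one>\<^bsub>xor_group n\<^esub>}"
      then have "g < ?h" "g \<noteq> 0" using S' by (auto simp: xor_group_def)
      from pos[OF this] show "\<kappa>' \<le> rank_dist ?h (R g) (1\<^sub>m ?h)" using \<kappa>' by linarith
    qed (use GL S' zero \<delta> in \<open>auto simp: xor_group_def\<close>)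
  qed
  moreover have "0 < 1 / real ?h" "1 / real ?h \<le> 1" by simp_all
  ultimately show ?thesis unfolding linear_sofic_def by blast
qed

theorem theorem1:
  fixes G :: "('a, 'm) monoid_scheme"
  assumes "group G"
    and "countable (carrier G)"
    and "linear_sofic TYPE(complex) G"
  shows "(torsion_free G \<longrightarrow> kappa_linear_sofic TYPE(complex) 1 G) \<and>
    (kappa_linear_sofic TYPE(complex) (1/2) G \<and>
     (\<forall>\<kappa>::real. 1/2 < \<kappa> \<and> \<kappa> \<le> 1 \<longrightarrow>
       (\<exists>H :: nat monoid. group H \<and> countable (carrier H) \<and>
         linear_sofic TYPE(complex) H \<and> \<not> kappa_linear_sofic TYPE(complex) \<kappa> H)))"
proof (intro conjI impI allI)
  assume "torsion_free G"
  then show "kappa_linear_sofic TYPE(complex) 1 G"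
    by (rule linear_sofic_torsion_free[OF assms(1,3)])
next
  show "kappa_linear_sofic TYPE(complex) (1/2) G"
    by (rule linear_sofic_half[OF assms(1,3)])
next
  fix \<kappa> :: real assume \<kappa>: "1/2 < \<kappa> \<and> \<kappa> \<le> 1"
  then obtain n where n: "\<not> kappa_linear_sofic TYPE(complex) \<kappa> (xor_group n)"
    using xor_group_not_kappa by blast
  have "countable (carrier (xor_group n))"
    by (simp add: xor_group_def countable_finite)
  then show "\<exists>H :: nat monoid. group H \<and> countable (carrier H) \<and>
         linear_sofic TYPE(complex) H \<and> \<not> kappa_linear_sofic TYPE(complex) \<kappa> H"
    using group_xor xor_group_linear_sofic n by blast
qed

end
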